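(* Let $f\in\mathcal P_{n,d}$ and $N_f(\alpha):=\#\{x\in\mathbb Z^n:f(x)\le\alpha\}$. Then for all $\alpha>0$, $$N_f(\alpha)=\mathbb V_n(f)\,\alpha^{n/d}+O_n\Big(\sum_{j=0}^{n-1}\mathbb V_j(f)\,\alpha^{j/d}\Big),$$ i.e. there is a constant $C_n>0$ depending only on $n$ such that $\big|N_f(\alpha)-\mathbb V_n(f)\alpha^{n/d}\big|\le C_n\sum_{j=0}^{n-1}\mathbb V_j(f)\alpha^{j/d}$ for all such $f$ and all $\alpha>0$. In particular, $$N_f(\alpha)=\mathbb V_n(f)\,\alpha^{n/d}+O_{n,f}\big(\alpha^{(n-1)/d}\big)\quad\text{as }\alpha\to\infty,$$ where the implied constant depends on $n$ and $f$.
   Context: Fix natural numbers $n\ge2$ and $d\ge2$ with $d$ even. $\mathcal P_{n,d}$ is the set of convex polynomials $f:\mathbb R^n\to\mathbb R$ that are positively $d$-homogeneous ($f(\lambda x)=\lambda^df(x)$ for all $\lambda>0$) and satisfy $f(x)>0$ for all $x\ne0$. $G(j,n)$ is the Grassmannian of $j$-dimensional linear subspaces of $\mathbb R^n$ with its rotation-invariant (Haar) probability measure $\nu_j$; $\kappa_m$ is the volume of the unit ball of $\mathbb R^m$; $\beta_{j,n}=\binom nj\frac{\kappa_n}{\kappa_j\kappa_{n-j}}$; $\Pi_Ef(y):=\inf_{z\in E^\perp}f(y+z)$ for $y\in E$. For $f\in\mathcal P_{n,d}$: $\mathbb V_0(f):=1$; $\mathbb V_j(f):=\frac{\beta_{j,n}}{\Gamma(1+j/d)}\int_{G(j,n)}\int_Ee^{-\Pi_Ef(y)}\,dy\,d\nu_j(E)$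 for $1\le j\le n-1$; $\mathbb V_n(f):=\frac1{\Gamma(1+n/d)}\int_{\mathbb R^n}e^{-f(x)}\,dx$. For $0\le j\le n$, $\mathbb V_j(f)$ equals the $j$-th intrinsic volume of the convex body $\{x:f(x)\le1\}$. *)

theory Defs
  imports "HOL-Probability.Probability" "HOL-Library.Landau_Symbols"
begin

definition hom_convex_polys :: "nat \<Rightarrow> (real^'n::finite \<Rightarrow> real) set" where
  "hom_convex_polys d = {f. real_polynomial_function f \<and> convex_on UNIV f \<and>
     (\<forall>c>0. \<forall>x. f (c *\<^sub>R x) = c ^ d * f x) \<and> (\<forall>x. x \<noteq> 0 \<longrightarrow> f x > 0)}"

definition grassmannian :: "nat \<Rightarrow> (real^'n::finite) set set" where
  "grassmannian j = {E. subspace E \<and> dim E = j}"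

text \<open>The topology of the Grassmannian is the one induced by identifying a subspace with the
  matrix of the orthogonal projection onto it; for a subspace \<open>E\<close>, this projection is
  \<open>closest_point E\<close>. The Borel sets are therefore the preimages of Borel sets of matrices.\<close>

definition grassmannian_borel :: "nat \<Rightarrow> (real^'n::finite) set measure" where
  "grassmannian_borel j =
     vimage_algebra (grassmannian j) (\<lambda>E. matrix (closest_point E)) borel"

definition is_grassmannian_haar :: "nat \<Rightarrow> (real^'n::finite) set measure \<Rightarrow> bool" where
  "is_grassmannian_haar j \<nu> \<longleftrightarrow> prob_space \<nu> \<and> sets \<nu> = sets (grassmannian_borel j) \<and>
     (\<forall>Q. rotation_matrix Q \<longrightarrow> distr \<nu> \<nu> (\<lambda>E. (*v) Q ` E) = \<nu>)"

definition grassmannian_haar :: "nat \<Rightarrow> (real^'n::finite) set measure" where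
  "grassmannian_haar j = (SOME \<nu>. is_grassmannian_haar j \<nu>)"

text \<open>Lebesgue measure of a linear subspace, as a Borel measure on the ambient space concentrated
  on the subspace: transport of the product Lebesgue measure along the coordinates with respect to
  an orthonormal basis. It does not depend on the basis.\<close>

definition subspace_lborel :: "(real^'n::finite) set \<Rightarrow> (real^'n) measure" where
  "subspace_lborel E =
     (let B = (SOME B. pairwise orthogonal B \<and> (\<forall>b\<in>B. norm b = 1) \<and> span B = E)
      in distr (Pi\<^sub>M B (\<lambda>_. lborel)) borel (\<lambda>c. \<Sum>b\<in>B. c b *\<^sub>R b))"

definition proj_fun :: "(real^'n::finite) set \<Rightarrow> (real^'n \<Rightarrow> real) \<Rightarrow> real^'n \<Rightarrow> real" where
  "proj_fun E f y = (INF z\<in>E\<^sup>\<bottom>. f (y + z))"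

definition kubota_coeff :: "nat \<Rightarrow> nat \<Rightarrow> real" where
  "kubota_coeff j n = real (n choose j) *
     (unit_ball_vol (real n) / (unit_ball_vol (real j) * unit_ball_vol (real (n - j))))"

text \<open>For \<open>f\<close> homogeneous of degree \<open>d\<close>. Only the indices \<open>j \<le> CARD('n)\<close> are meaningful.\<close>

definition intrinsic_V :: "nat \<Rightarrow> nat \<Rightarrow> (real^'n::finite \<Rightarrow> real) \<Rightarrow> real" where
  "intrinsic_V d j f =
     (if j = 0 then 1
      else if j = CARD('n) then
        1 / Gamma (1 + real j / real d) * (LINT x|lborel. exp (- f x))
      else
        kubota_coeff j CARD('n) / Gamma (1 + real j / real d) *
          (LINT E|grassmannian_haar j. LINT y|subspace_lborel E. exp (- proj_fun E f y)))"

definition lattice_count :: "(real^'n::finite \<Rightarrow> real) \<Rightarrow> real \<Rightarrow> nat" where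
  "lattice_count f \<alpha> = card {x. (\<forall>i. x $ i \<in> \<int>) \<and> f x \<le> \<alpha>}"

subsection \<open>Existence of the rotation-invariant measure\<close>

text \<open>By induction on the dimension: if \<open>E\<close> is distributed according to the invariant measure on
  \<open>j\<close>-dimensional subspaces and \<open>v\<close> is independent of \<open>E\<close> and uniform in the unit ball, then almost
  surely \<open>v \<notin> E\<close>, and the law of \<open>span (insert v E)\<close> is invariant in dimension \<open>j + 1\<close>.\<close>

lemma closest_point_subspace:
  fixes E :: "(real^'n::finite) set"
  assumes "subspace E"
  shows "closest_point E x \<in> E" "\<And>e. e \<in> E \<Longrightarrow> (x - closest_point E x) \<bullet> e = 0"
proof -
  have cl: "closed E" "convex E" "E \<noteq> {}"
    using assms closed_subspace subspace_imp_convex subspace_0 by auto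
  show 1: "closest_point E x \<in> E" using cl closest_point_in_set by blast
  fix e assume e: "e \<in> E"
  have "(x - closest_point E x) \<bullet> (closest_point E x + e - closest_point E x) \<le> 0"
    by (rule closest_point_dot) (use cl 1 e assms subspace_add in auto)
  moreover have "(x - closest_point E x) \<bullet> (closest_point E x - e - closest_point E x) \<le> 0"
    by (rule closest_point_dot) (use cl 1 e assms subspace_diff in auto)
  ultimately show "(x - closest_point E x) \<bullet> e = 0" by (simp add: inner_diff_right inner_add_right)
qed

lemma closest_point_subspace_eqI:
  fixes E :: "(real^'n::finite) set"
  assumes "subspace E" "p \<in> E" "\<And>e. e \<in> E \<Longrightarrow> (x - p) \<bullet> e = 0"
  shows "closest_point E x = p"
proof -
  let ?q = "closest_point E x"
  have "p - ?q \<in> E" using assms closest_point_subspace(1) subspace_diff by blast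
  then have "(x - p) \<bullet> (p - ?q) = 0" "(x - ?q) \<bullet> (p - ?q) = 0"
    using assms closest_point_subspace(2) by blast+
  then have "(p - ?q) \<bullet> (p - ?q) = 0" by (simp add: inner_diff_left)
  then show ?thesis by simp
qed

lemma linear_closest_point_subspace:
  fixes E :: "(real^'n::finite) set"
  assumes "subspace E"
  shows "linear (closest_point E)"
proof (rule linearI)
  note c = closest_point_subspace[OF assms]
  show "closest_point E (x + y) = closest_point E x + closest_point E y" for x y
  proof (rule closest_point_subspace_eqI[OF assms])
    show "closest_point E x + closest_point E y \<in> E" using c(1) assms subspace_add by blast
    fix e assume "e \<in> E"
    then show "(x + y - (closest_point E x + closest_point E y)) \<bullet> e = 0"
      using c(2)[of e x] c(2)[of e y] by (simp add: inner_diff_left inner_add_left)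
  qed
  show "closest_point E (r *\<^sub>R x) = r *\<^sub>R closest_point E x" for r x
  proof (rule closest_point_subspace_eqI[OF assms])
    show "r *\<^sub>R closest_point E x \<in> E" using c(1) assms subspace_scale by blast
    fix e assume "e \<in> E"
    then show "(r *\<^sub>R x - r *\<^sub>R closest_point E x) \<bullet> e = 0"
      using c(2)[of e x] by (simp add: inner_diff_left)
  qed
qed

lemma matrix_closest_point_mul:
  fixes E :: "(real^'n::finite) set"
  assumes "subspace E"
  shows "matrix (closest_point E) *v x = closest_point E x"
  by (rule fun_cong[OF matrix_vector_mul(2)[OF linear_closest_point_subspace[OF assms]]])

lemma closest_point_span_insert:
  fixes E :: "(real^'n::finite) set"
  assumes E: "subspace E" and u: "u = v - closest_point E v"
  shows "closest_point (span (insert v E)) x = closest_point E x + ((u \<bullet> x) / (u \<bullet> u)) *\<^sub>R u"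
proof (rule closest_point_subspace_eqI[OF subspace_span])
  let ?S = "span (insert v E)"
  let ?p = "closest_point E x + ((u \<bullet> x) / (u \<bullet> u)) *\<^sub>R u"
  have ES: "e \<in> ?S" if "e \<in> E" for e using that by (simp add: span_base)
  have vS: "v \<in> ?S" by (simp add: span_base)
  have uS: "u \<in> ?S" unfolding u by (intro span_diff vS ES[OF closest_point_subspace(1)[OF E]])
  show "?p \<in> ?S" by (intro span_add span_scale uS ES[OF closest_point_subspace(1)[OF E]])
  have ue: "u \<bullet> e = 0" if "e \<in> E" for e using closest_point_subspace(2)[OF E that] u by simp
  have orthE: "(x - ?p) \<bullet> e = 0" if "e \<in> E" for e
    using closest_point_subspace(2)[OF E that, of x] ue[OF that]
    by (simp add: inner_diff_left inner_add_left)
  have orthu: "(x - ?p) \<bullet> u = 0"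
    using ue[OF closest_point_subspace(1)[OF E, of x]] inner_commute[of x u]
      inner_commute[of "closest_point E x" u]
    by (cases "u = 0") (simp_all add: inner_diff_left inner_add_left)
  have orthv: "(x - ?p) \<bullet> v = 0"
  proof -
    have "v = u + closest_point E v" using u by simp
    then have "(x - ?p) \<bullet> v = (x - ?p) \<bullet> (u + closest_point E v)" by (rule arg_cong)
    also have "\<dots> = 0"
      by (simp only: inner_add_right[of "x - ?p"] orthu orthE[OF closest_point_subspace(1)[OF E]] add_0)
    finally show ?thesis .
  qed
  fix e assume "e \<in> ?S"
  then show "(x - ?p) \<bullet> e = 0"
  proof (induction rule: span_induct)
    case base
    show ?case by (simp add: subspace_def inner_add_right)
  next
    case (step y)
    then show ?case using orthE orthv by auto
  qed
qed

lemma space_grassmannian_borel [simp]: "space (grassmannian_borel j) = grassmannian j"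
  by (simp add: grassmannian_borel_def)

lemma matrix_measurable_grassmannian [measurable]:
  "(\<lambda>E. matrix (closest_point E)) \<in> grassmannian_borel j \<rightarrow>\<^sub>M borel"
  unfolding grassmannian_borel_def by (rule measurable_vimage_algebra1) auto

lemma measurable_grassmannianI:
  assumes "(\<lambda>x. matrix (closest_point (g x))) \<in> borel_measurable N"
    and "\<And>x. x \<in> space N \<Longrightarrow> g x \<in> grassmannian j"
  shows "g \<in> N \<rightarrow>\<^sub>M grassmannian_borel j"
  unfolding grassmannian_borel_def
  by (rule measurable_vimage_algebra2) (use assms in auto)

lemma orthogonal_matrix_inner:
  fixes Q :: "real^'n::finite^'n"
  assumes "orthogonal_matrix Q"
  shows "(Q *v x) \<bullet> y = x \<bullet> (transpose Q *v y)" "transpose Q *v (Q *v x) = x"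
    "Q *v (transpose Q *v x) = x"
proof -
  show "(Q *v x) \<bullet> y = x \<bullet> (transpose Q *v y)"
    using dot_lmul_matrix[of y Q x] by (simp add: inner_commute)
  have "transpose Q ** Q = mat 1" "Q ** transpose Q = mat 1"
    using assms by (auto simp: orthogonal_matrix_def)
  then show "transpose Q *v (Q *v x) = x" "Q *v (transpose Q *v x) = x"
    by (simp_all only: matrix_vector_mul_assoc matrix_vector_mul_lid)
qed

lemma closest_point_rotate:
  fixes E :: "(real^'n::finite) set"
  assumes E: "subspace E" and Q: "orthogonal_matrix Q"
  shows "closest_point ((*v) Q ` E) x = Q *v closest_point E (transpose Q *v x)"
proof (rule closest_point_subspace_eqI)
  show "subspace ((*v) Q ` E)" using E by (simp add: linear_subspace_image)
  show "Q *v closest_point E (transpose Q *v x) \<in> (*v) Q ` E"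
    using closest_point_subspace(1)[OF E] by blast
  fix e assume "e \<in> (*v) Q ` E"
  then obtain e' where e': "e' \<in> E" "e = Q *v e'" by blast
  have "(x - Q *v closest_point E (transpose Q *v x)) \<bullet> (Q *v e')
     = (transpose Q *v x - closest_point E (transpose Q *v x)) \<bullet> e'"
  proof -
    have "x - Q *v closest_point E (transpose Q *v x)
        = Q *v (transpose Q *v x - closest_point E (transpose Q *v x))"
      by (simp only: matrix_vector_mult_diff_distrib orthogonal_matrix_inner(3)[OF Q])
    then show ?thesis
      by (simp only: orthogonal_matrix_inner(1)[OF Q] orthogonal_matrix_inner(2)[OF Q])
  qed
  then show "(x - Q *v closest_point E (transpose Q *v x)) \<bullet> e = 0"
    using closest_point_subspace(2)[OF E e'(1)] e' by simp
qed

lemma inj_orthogonal_matrix: "orthogonal_matrix Q \<Longrightarrow> inj ((*v) (Q::real^'n::finite^'n))"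
  by (rule inj_on_inverseI) (rule orthogonal_matrix_inner(2))

lemma rotate_in_grassmannian:
  assumes "orthogonal_matrix Q" "E \<in> grassmannian j"
  shows "(*v) Q ` E \<in> grassmannian j"
proof -
  have "subspace E" "dim E = j" using assms(2) by (auto simp: grassmannian_def)
  moreover have "inj_on ((*v) Q) (span E)"
    using inj_orthogonal_matrix[OF assms(1)] inj_on_subset by blast
  ultimately show ?thesis
    by (simp add: grassmannian_def linear_subspace_image dim_image_eq)
qed

lemma rotate_measurable:
  fixes Q :: "real^'n::finite^'n"
  assumes Q: "orthogonal_matrix Q"
  shows "(\<lambda>E. (*v) Q ` E) \<in> grassmannian_borel j \<rightarrow>\<^sub>M grassmannian_borel j"
proof (rule measurable_grassmannianI)
  have "(\<lambda>A. Q ** A ** transpose Q) \<in> borel_measurable borel"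
    unfolding matrix_matrix_mult_def
    by (intro borel_measurable_continuous_onI) (auto intro!: continuous_intros)
  then have a: "(\<lambda>E. Q ** matrix (closest_point E) ** transpose Q) \<in> borel_measurable (grassmannian_borel j)"
    by (rule measurable_compose[OF matrix_measurable_grassmannian])
  have b: "Q ** matrix (closest_point E) ** transpose Q = matrix (closest_point ((*v) Q ` E))"
    if "E \<in> space (grassmannian_borel j)" for E
  proof -
    have E: "subspace E" using that by (simp add: grassmannian_def)
    have "subspace ((*v) Q ` E)" using E by (simp add: linear_subspace_image)
    note sub = this
    have "(Q ** matrix (closest_point E) ** transpose Q) *v x = matrix (closest_point ((*v) Q ` E)) *v x" for x
      by (simp only: matrix_closest_point_mul[OF sub] closest_point_rotate[OF E Q]
          matrix_closest_point_mul[OF E] flip: matrix_vector_mul_assoc)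
    then show ?thesis unfolding matrix_eq by blast
  qed
  show "(\<lambda>E. matrix (closest_point ((*v) Q ` E))) \<in> borel_measurable (grassmannian_borel j)"
    by (rule iffD1[OF measurable_cong[OF b] a])
qed (use rotate_in_grassmannian[OF Q] in auto)

lemma emeasure_unit_cball:
  "emeasure lborel (cball 0 1 :: (real^'n::finite) set) \<noteq> 0"
  "emeasure lborel (cball 0 1 :: (real^'n::finite) set) \<noteq> \<infinity>"
proof -
  have "unit_ball_vol (real CARD('n)) \<noteq> 0" using unit_ball_vol_pos[of "real CARD('n)"] by linarith
  then show "emeasure lborel (cball 0 1 :: (real^'n) set) \<noteq> 0"
    "emeasure lborel (cball 0 1 :: (real^'n) set) \<noteq> \<infinity>"
    by (auto simp: emeasure_cball)
qed

lemma lborel_rotate: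
  fixes Q :: "real^'n::finite^'n"
  assumes Q: "orthogonal_matrix Q"
  shows "distr lborel borel ((*v) Q) = (lborel :: (real^'n) measure)"
proof (rule measure_eqI)
  fix A assume "A \<in> sets (distr lborel borel ((*v) Q))"
  then have A [measurable]: "A \<in> sets borel" by simp
  have mQ [measurable]: "(*v) Q \<in> borel_measurable borel"
    by (intro borel_measurable_continuous_onI)
      (simp add: linear_continuous_on matrix_vector_mul_bounded_linear)
  have nrm: "norm (Q *v x) = norm x" for x
    using Q by (simp add: orthogonal_transformation_matrix orthogonal_transformation_norm)
  let ?b = "indicator (cball 0 1) :: real^'n \<Rightarrow> ennreal"
  let ?B = "emeasure lborel (cball 0 1 :: (real^'n) set)"
  have mB [measurable]: "(cball 0 1 :: (real^'n) set) \<in> sets borel" by simp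
  have tr: "(\<integral>\<^sup>+x. g (c + x) \<partial>lborel) = (\<integral>\<^sup>+x. g x \<partial>lborel)"
    if [measurable]: "g \<in> borel_measurable borel" for g :: "real^'n \<Rightarrow> ennreal" and c
    by (subst (2) lborel_distr_plus[of c, symmetric]) (simp add: nn_integral_distr)
  have 1: "(\<integral>\<^sup>+y. ?b (x - Q *v y) \<partial>lborel) = ?B" for x
  proof -
    have "norm (x - Q *v y) = dist (transpose Q *v x) y" for y
    proof -
      have "x - Q *v y = Q *v (transpose Q *v x - y)"
        by (simp only: matrix_vector_mult_diff_distrib orthogonal_matrix_inner(3)[OF Q])
      then show ?thesis by (simp only: nrm dist_norm)
    qed
    then have "?b (x - Q *v y) = indicator (cball (transpose Q *v x) 1) y" for y
      by (auto simp: indicator_def)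
    then have "(\<integral>\<^sup>+y. ?b (x - Q *v y) \<partial>lborel) = emeasure lborel (cball (transpose Q *v x) 1)"
      by simp
    then show ?thesis by (simp add: emeasure_cball)
  qed
  have 2: "(\<integral>\<^sup>+y. indicator A (x + Q *v y) \<partial>lborel) = emeasure (distr lborel borel ((*v) Q)) A" for x
  proof -
    have "x + Q *v y = Q *v (transpose Q *v x + y)" for y
      by (simp only: matrix_vector_right_distrib orthogonal_matrix_inner(3)[OF Q])
    then have "(\<integral>\<^sup>+y. indicator A (x + Q *v y) \<partial>lborel)
        = (\<integral>\<^sup>+y. indicator A (Q *v (transpose Q *v x + y)) \<partial>lborel)" by simp
    also have "\<dots> = (\<integral>\<^sup>+y. indicator A (Q *v y) \<partial>lborel)" by (rule tr) measurable
    also have "\<dots> = (\<integral>\<^sup>+y. indicator A y \<partial>distr lborel borel ((*v) Q))"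
      by (subst nn_integral_distr) auto
    finally show ?thesis by simp
  qed
  have "?B * emeasure lborel A = (\<integral>\<^sup>+x. indicator A x * (\<integral>\<^sup>+y. ?b (x - Q *v y) \<partial>lborel) \<partial>lborel)"
    by (simp add: 1 nn_integral_multc mult.commute)
  also have "\<dots> = (\<integral>\<^sup>+x. \<integral>\<^sup>+y. indicator A x * ?b (x - Q *v y) \<partial>lborel \<partial>lborel)"
    by (simp add: nn_integral_cmult)
  also have "\<dots> = (\<integral>\<^sup>+y. \<integral>\<^sup>+x. indicator A x * ?b (x - Q *v y) \<partial>lborel \<partial>lborel)"
    by (rule lborel_pair.Fubini') measurable
  also have "\<dots> = (\<integral>\<^sup>+y. \<integral>\<^sup>+x. indicator A (Q *v y + x) * ?b x \<partial>lborel \<partial>lborel)"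
  proof (rule nn_integral_cong)
    fix y :: "real^'n"
    show "(\<integral>\<^sup>+x. indicator A x * ?b (x - Q *v y) \<partial>lborel)
        = (\<integral>\<^sup>+x. indicator A (Q *v y + x) * ?b x \<partial>lborel)"
      by (subst tr[of "\<lambda>x. indicator A x * ?b (x - Q *v y)" "Q *v y", symmetric]) simp_all
  qed
  also have "\<dots> = (\<integral>\<^sup>+x. \<integral>\<^sup>+y. indicator A (Q *v y + x) * ?b x \<partial>lborel \<partial>lborel)"
    by (rule lborel_pair.Fubini') measurable
  also have "\<dots> = (\<integral>\<^sup>+x. emeasure (distr lborel borel ((*v) Q)) A * ?b x \<partial>lborel)"
    by (simp add: nn_integral_multc 2 add.commute)
  also have "\<dots> = ?B * emeasure (distr lborel borel ((*v) Q)) A"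
    by (subst nn_integral_cmult) (simp_all add: mult.commute)
  finally have "?B * emeasure (distr lborel borel ((*v) Q)) A = ?B * emeasure lborel A" by simp
  moreover have "?B \<noteq> 0" "?B \<noteq> \<infinity>"
    using emeasure_unit_cball by blast+
  ultimately show "emeasure (distr lborel borel ((*v) Q)) A = emeasure lborel A"
    by (simp add: ennreal_mult_cancel_left)
qed simp

lemma uniform_ball_rotate:
  fixes Q :: "real^'n::finite^'n"
  assumes Q: "orthogonal_matrix Q"
  defines "U \<equiv> uniform_measure lborel (cball 0 1 :: (real^'n) set)"
  shows "distr U U ((*v) Q) = U"
proof (rule measure_eqI)
  fix A assume "A \<in> sets (distr U U ((*v) Q))"
  then have A: "A \<in> sets borel" by (simp add: U_def)
  have meas: "(*v) Q \<in> borel_measurable borel" 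
    by (intro borel_measurable_continuous_onI) (simp add: linear_continuous_on matrix_vector_mul_bounded_linear)
  have nrm: "norm (Q *v x) = norm x" for x
    using Q by (simp add: orthogonal_transformation_matrix orthogonal_transformation_norm)
  have vA: "(*v) Q -` A \<in> sets borel" using measurable_sets_borel[OF meas A] .
  have "emeasure (distr U U ((*v) Q)) A = emeasure U ((*v) Q -` A)"
    using A meas by (subst emeasure_distr) (auto simp: U_def)
  also have "\<dots> = emeasure lborel (cball 0 1 \<inter> (*v) Q -` A) / emeasure lborel (cball 0 1 :: (real^'n) set)"
    using vA by (simp add: U_def)
  also have "cball 0 1 \<inter> (*v) Q -` A = (*v) Q -` (cball 0 1 \<inter> A)"
    by (auto simp: nrm)
  also have "emeasure lborel \<dots> = emeasure (distr lborel borel ((*v) Q)) (cball 0 1 \<inter> A)"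
    using A meas by (simp add: emeasure_distr)
  also have "\<dots> = emeasure lborel (cball 0 1 \<inter> A)" by (simp add: lborel_rotate[OF Q])
  finally show "emeasure (distr U U ((*v) Q)) A = emeasure U A" using A by (simp add: U_def)
qed simp


lemma AE_uniform_ball_not_in_subspace:
  fixes E :: "(real^'n::finite) set"
  assumes E: "subspace E" "dim E < CARD('n)"
  shows "AE v in uniform_measure lborel (cball 0 1). v \<notin> E"
proof (rule AE_uniform_measureI)
  have "negligible E" using E by (intro negligible_lowdim) simp
  moreover have "E \<in> sets borel" using closed_subspace[OF E(1)] by simp
  ultimately have "E \<in> null_sets lborel"
    by (simp add: negligible_iff_null_sets null_sets_completion_iff)
  then have "AE v in lborel. v \<notin> E" by (rule AE_not_in)
  then show "AE v in lborel. v \<in> cball 0 1 \<longrightarrow> v \<notin> E" by auto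
qed simp

lemma grassmannian_nonempty:
  assumes "j \<le> CARD('n::finite)"
  shows "(grassmannian j :: (real^'n) set set) \<noteq> {}"
proof -
  obtain T :: "(real^'n) set" where "subspace T" "dim T = j"
    using choose_subspace_of_subspace[of j "UNIV :: (real^'n) set"] assms
    by (auto simp: dim_UNIV)
  then show ?thesis by (auto simp: grassmannian_def)
qed

lemma grassmannian_haar_step:
  fixes \<nu> :: "(real^'n::finite) set measure"
  assumes \<nu>: "is_grassmannian_haar j \<nu>" and j: "j < CARD('n)"
  shows "\<exists>\<nu>' :: (real^'n) set measure. is_grassmannian_haar (Suc j) \<nu>'"
proof -
  interpret \<nu>: prob_space \<nu> using \<nu> by (simp add: is_grassmannian_haar_def)
  have sets\<nu>: "sets \<nu> = sets (grassmannian_borel j)" using \<nu> by (simp add: is_grassmannian_haar_def)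
  have space\<nu>: "space \<nu> = grassmannian j" using sets_eq_imp_space_eq[OF sets\<nu>] by simp
  define U where "U = uniform_measure lborel (cball 0 1 :: (real^'n) set)"
  interpret U: prob_space U unfolding U_def
    by (rule prob_space_uniform_measure) (rule emeasure_unit_cball)+
  have setsU [measurable_cong]: "sets U = sets borel" and spaceU: "space U = UNIV"
    by (simp_all add: U_def)
  interpret P: pair_prob_space \<nu> U ..
  define E0 where "E0 = (SOME E. E \<in> (grassmannian (Suc j) :: (real^'n) set set))"
  have E0: "E0 \<in> grassmannian (Suc j)"
    unfolding E0_def using grassmannian_nonempty[of "Suc j", where 'n='n] j by (simp add: some_in_eq)
  define \<phi> :: "(real^'n) set \<times> (real^'n) \<Rightarrow> (real^'n) set"
    where "\<phi> = (\<lambda>p. if snd p \<in> fst p then E0 else span (insert (snd p) (fst p)))"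
  let ?G = "grassmannian_borel (Suc j) :: (real^'n) set measure"
  let ?M = "\<nu> \<Otimes>\<^sub>M U"
  let ?A = "\<lambda>p :: (real^'n) set \<times> (real^'n). matrix (closest_point (fst p))"
  have mA [measurable]: "?A \<in> borel_measurable ?M"
    by (rule measurable_compose[OF measurable_fst])
      (use matrix_measurable_grassmannian[of j] sets\<nu> in \<open>simp cong: measurable_cong_sets\<close>)
  have msnd [measurable]: "snd \<in> borel_measurable ?M"
    using measurable_snd[of \<nu> U] setsU by (simp cong: measurable_cong_sets)
  have mAv [measurable]: "(\<lambda>p. ?A p *v snd p) \<in> borel_measurable ?M"
  proof -
    have "(\<lambda>q :: (real^'n^'n) \<times> (real^'n). fst q *v snd q) \<in> borel_measurable (borel \<Otimes>\<^sub>M borel)"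
      unfolding borel_prod matrix_vector_mult_def
      by (intro borel_measurable_continuous_onI) (auto intro!: continuous_intros)
    from measurable_compose[OF measurable_Pair[OF mA msnd] this] show ?thesis by simp
  qed
  have inE: "snd p \<in> fst p \<longleftrightarrow> ?A p *v snd p = snd p" if "p \<in> space ?M" for p
  proof -
    have "subspace (fst p)" using that by (auto simp: space_pair_measure space\<nu> grassmannian_def)
    then show ?thesis
      using closest_point_refl[of "fst p" "snd p"] closed_subspace subspace_0
      by (auto simp: matrix_closest_point_mul)
  qed
  define u where "u = (\<lambda>p :: (real^'n) set \<times> (real^'n). snd p - ?A p *v snd p)"
  have mu [measurable]: "u \<in> borel_measurable ?M" unfolding u_def by (rule borel_measurable_diff[OF msnd mAv])
  have zu: "{p \<in> space ?M. ?A p *v snd p = snd p} \<in> sets ?M"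
  proof -
    have "u -` {0} \<inter> space ?M \<in> sets ?M" by (rule measurable_sets[OF mu]) simp
    also have "u -` {0} \<inter> space ?M = {p \<in> space ?M. ?A p *v snd p = snd p}"
      unfolding u_def by (auto simp only: vimage_eq singleton_iff right_minus_eq)
    finally show ?thesis .
  qed
  have mo: "(\<lambda>p. (\<chi> a b. u p $ a * u p $ b) :: real^'n^'n) \<in> borel_measurable ?M"
    by (rule measurable_compose[OF mu], intro borel_measurable_continuous_onI)
      (auto intro!: continuous_intros)
  have meq: "matrix (closest_point (\<phi> p)) =
      (if ?A p *v snd p = snd p then matrix (closest_point E0)
       else ?A p + (1 / (u p \<bullet> u p)) *\<^sub>R (\<chi> a b. u p $ a * u p $ b))"
    if p: "p \<in> space ?M" for p
  proof (cases "snd p \<in> fst p")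
    case True
    then show ?thesis using inE[OF p] by (simp add: \<phi>_def)
  next
    case False
    have sub: "subspace (fst p)" using p by (auto simp: space_pair_measure space\<nu> grassmannian_def)
    have u: "u p = snd p - closest_point (fst p) (snd p)"
      by (simp add: u_def matrix_closest_point_mul[OF sub])
    have "matrix (closest_point (\<phi> p)) = 
      ?A p + (1 / (u p \<bullet> u p)) *\<^sub>R (\<chi> a b. u p $ a * u p $ b)"
      using False
      by (simp add: \<phi>_def closest_point_span_insert[OF sub u] matrix_def vec_eq_iff inner_axis)
    then show ?thesis using False inE[OF p] by simp
  qed
  have \<phi>G: "\<phi> p \<in> grassmannian (Suc j)" if "p \<in> space ?M" for p
  proof -
    have "subspace (fst p)" "dim (fst p) = j"
      using that by (auto simp: space_pair_measure space\<nu> grassmannian_def)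
    moreover from this have "snd p \<notin> span (fst p)" if "snd p \<notin> fst p"
      using that span_eq_iff[THEN iffD2, OF calculation(1)] by (simp only: not_False_eq_True)
    ultimately show ?thesis
      using E0 dim_insert[of "snd p" "fst p"]
      by (cases "snd p \<in> fst p") (simp_all add: \<phi>_def grassmannian_def)
  qed
  have m\<phi>: "\<phi> \<in> ?M \<rightarrow>\<^sub>M ?G"
  proof (rule measurable_grassmannianI)
    have mB: "(\<lambda>p. (if ?A p *v snd p = snd p then matrix (closest_point E0)
       else ?A p + (1 / (u p \<bullet> u p)) *\<^sub>R (\<chi> a b. u p $ a * u p $ b))) \<in> borel_measurable ?M"
      by (rule measurable_If[OF borel_measurable_const borel_measurable_add[OF mA
          borel_measurable_scaleR[OF borel_measurable_divide[OF borel_measurable_const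
            borel_measurable_inner[OF mu mu]] mo]] zu])
    show "(\<lambda>p. matrix (closest_point (\<phi> p))) \<in> borel_measurable ?M"
      by (rule iffD2[OF measurable_cong[OF meq] mB])
  qed (rule \<phi>G)
  define \<nu>' where "\<nu>' = distr ?M ?G \<phi>"
  have AE: "AE p in ?M. snd p \<notin> fst p"
  proof (rule P.AE_pair_measure)
    have "{p \<in> space ?M. snd p \<notin> fst p} = {p \<in> space ?M. ?A p *v snd p \<noteq> snd p}"
      using inE by auto
    also have "\<dots> = space ?M - {p \<in> space ?M. ?A p *v snd p = snd p}" by auto
    also have "\<dots> \<in> sets ?M" using zu by (rule sets.compl_sets)
    finally show "{p \<in> space ?M. snd p \<notin> fst p} \<in> sets ?M" .
    show "AE E in \<nu>. AE v in U. snd (E, v) \<notin> fst (E, v)"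
    proof (rule AE_I2)
      fix E assume "E \<in> space \<nu>"
      then have "subspace E" "dim E < CARD('n)" using j by (simp_all add: space\<nu> grassmannian_def)
      then show "AE v in U. snd (E, v) \<notin> fst (E, v)"
        unfolding U_def fst_conv snd_conv by (rule AE_uniform_ball_not_in_subspace)
    qed
  qed
  have "prob_space \<nu>'" unfolding \<nu>'_def by (rule P.prob_space_distr[OF m\<phi>])
  moreover have "sets \<nu>' = sets ?G" by (simp add: \<nu>'_def)
  moreover have "distr \<nu>' \<nu>' (\<lambda>E. (*v) Q ` E) = \<nu>'" if "rotation_matrix Q" for Q
  proof -
    have Q: "orthogonal_matrix Q" using that by (simp add: rotation_matrix_def)
    let ?R = "\<lambda>E. (*v) Q ` E"
    let ?RR = "\<lambda>(E, v). (?R E, Q *v v)"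
    have mR: "?R \<in> \<nu> \<rightarrow>\<^sub>M \<nu>"
      using rotate_measurable[OF Q, of j] sets\<nu> by (simp cong: measurable_cong_sets)
    have mQ: "(*v) Q \<in> U \<rightarrow>\<^sub>M U"
    proof -
      have "(*v) Q \<in> borel_measurable borel"
        by (intro borel_measurable_continuous_onI)
          (simp add: linear_continuous_on matrix_vector_mul_bounded_linear)
      then show ?thesis using setsU by (simp cong: measurable_cong_sets)
    qed
    have mRR: "?RR \<in> ?M \<rightarrow>\<^sub>M ?M"
      unfolding split_beta by (intro measurable_Pair measurable_compose[OF measurable_fst mR]
        measurable_compose[OF measurable_snd mQ])
    have dU: "distr U U ((*v) Q) = U" unfolding U_def by (rule uniform_ball_rotate[OF Q])
    have d\<nu>: "distr \<nu> \<nu> ?R = \<nu>" using \<nu> that by (simp add: is_grassmannian_haar_def)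
    have dM: "distr ?M ?M ?RR = ?M"
      using pair_measure_distr[OF mR mQ] dU d\<nu> U.sigma_finite_measure_axioms by simp
    have "distr \<nu>' \<nu>' ?R = distr \<nu>' ?G ?R" by (rule distr_cong) (simp_all add: \<nu>'_def)
    also have "\<dots> = distr ?M ?G (?R \<circ> \<phi>)"
      unfolding \<nu>'_def by (rule distr_distr[OF rotate_measurable[OF Q] m\<phi>])
    also have "\<dots> = distr ?M ?G (\<phi> \<circ> ?RR)"
    proof (rule distr_cong_AE)
      show "AE p in ?M. (?R \<circ> \<phi>) p = (\<phi> \<circ> ?RR) p"
        using AE
      proof (rule AE_mp, intro AE_I2 impI)
        fix p :: "(real^'n) set \<times> (real^'n)" assume p: "snd p \<notin> fst p"
        obtain E v where pv: "p = (E, v)" by (cases p)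
        have "Q *v v \<notin> ?R E" using p pv inj_orthogonal_matrix[OF Q] by (auto dest: injD)
        moreover have "?R (span (insert v E)) = span (?R (insert v E))"
          by (rule linear_span_image[symmetric]) simp
        ultimately show "(?R \<circ> \<phi>) p = (\<phi> \<circ> ?RR) p" using p pv by (simp add: \<phi>_def)
      qed
      show "?R \<circ> \<phi> \<in> ?M \<rightarrow>\<^sub>M ?G" by (rule measurable_comp[OF m\<phi> rotate_measurable[OF Q]])
      show "\<phi> \<circ> ?RR \<in> ?M \<rightarrow>\<^sub>M ?G" by (rule measurable_comp[OF mRR m\<phi>])
    qed simp_all
    also have "\<dots> = distr (distr ?M ?M ?RR) ?G \<phi>"
      by (rule distr_distr[OF m\<phi> mRR, symmetric])
    also have "\<dots> = \<nu>'" by (simp add: dM \<nu>'_def)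
    finally show ?thesis .
  qed
  ultimately show ?thesis unfolding is_grassmannian_haar_def by blast
qed

lemma grassmannian_haar_exists:
  assumes "j \<le> CARD('n::finite)"
  shows "\<exists>\<nu> :: (real^'n) set measure. is_grassmannian_haar j \<nu>"
  using assms
proof (induction j)
  case 0
  have G0: "grassmannian 0 = {{0 :: real^'n}}"
  proof (intro equalityI subsetI)
    fix E :: "(real^'n) set" assume "E \<in> grassmannian 0"
    then have "0 \<in> E" "E \<subseteq> {0}" by (simp_all add: grassmannian_def subspace_0)
    then show "E \<in> {{0}}" by blast
  qed (simp add: grassmannian_def)
  let ?\<nu> = "return (grassmannian_borel 0) {0 :: real^'n}"
  have "distr ?\<nu> ?\<nu> (\<lambda>E. (*v) Q ` E) = ?\<nu>" if "rotation_matrix Q" for Q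
  proof -
    have "(\<lambda>E. (*v) Q ` E) \<in> grassmannian_borel 0 \<rightarrow>\<^sub>M grassmannian_borel 0"
      using that by (intro rotate_measurable) (simp add: rotation_matrix_def)
    then have "(\<lambda>E. (*v) Q ` E) \<in> grassmannian_borel 0 \<rightarrow>\<^sub>M ?\<nu>"
      by (simp cong: measurable_cong_sets)
    from distr_return[OF this, of "{0}"]
    have "distr ?\<nu> ?\<nu> (\<lambda>E. (*v) Q ` E) = return ?\<nu> {0}" by (simp add: G0)
    also have "return ?\<nu> = return (grassmannian_borel 0)" by (rule return_sets_cong) simp
    finally show ?thesis .
  qed
  moreover have "prob_space ?\<nu>" by (rule prob_space_return) (simp add: G0)
  ultimately show ?case unfolding is_grassmannian_haar_def by (intro exI[of _ ?\<nu>]) simp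
next
  case (Suc j)
  then obtain \<nu> :: "(real^'n) set measure" where "is_grassmannian_haar j \<nu>" by auto
  then show ?case by (rule grassmannian_haar_step) (use Suc.prems in simp)
qed

lemma is_grassmannian_haar_grassmannian_haar:
  assumes "j \<le> CARD('n::finite)"
  shows "is_grassmannian_haar j (grassmannian_haar j :: (real^'n) set measure)"
  unfolding grassmannian_haar_def by (rule someI_ex[OF grassmannian_haar_exists[OF assms]])

end

theory Submission
  imports Defs
begin

text \<open>Let \<open>K = {f \<le> 1}\<close>, \<open>n\<close> the dimension and \<open>t = \<alpha> powr (1/d)\<close>, so that the points to be counted are
  those of \<open>t K\<close>. Up to constants depending on \<open>n\<close> only, the symmetric convex body \<open>K\<close> is a box with
  half-axes \<open>r 0 \<ge> \<dots> \<ge> r (n - 1)\<close> along an orthonormal basis. Comparing \<open>t K\<close> with the union of the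
  unit cells of its lattice points bounds the discrepancy by a multiple of the sum over \<open>j < n\<close> of
  \<open>t ^ j * (\<Prod>i<j. r i)\<close>.

  It remains to bound \<open>intrinsic_V d j f\<close> from below by a multiple of \<open>\<Prod>i<j. r i\<close>. If \<open>E\<close> is close to the
  span \<open>F\<close> of the first \<open>j\<close> axes, then the projection of \<open>K\<close> to \<open>E\<close> contains that of the section of
  \<open>K\<close> by \<open>F\<close>, whose volume is at least such a multiple. By rotation invariance, the probability
  that \<open>E\<close> is close to \<open>F\<close> is a positive constant independent of \<open>F\<close>.\<close>

subsection \<open>Orthonormal frames\<close>

text \<open>The constant may depend neither on \<open>d\<close> nor on \<open>f\<close>. So
  \<open>f\<close> enters the quantitative estimates only through the half-axes \<open>r\<close>,
  with comparison factors that depend on the dimension, and \<open>d\<close> survives only in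
  \<open>Gamma (1 + j/d)\<close>, whose argument stays in the compact interval from 1 to 1 + n. The
  discrepancy bound has two regimes. If the shortest half-axis of t K is long compared with the
  diameter sqrt n of a unit cell, the error is a surface term. Otherwise t K is too thin for its
  volume to approximate the count, and count and volume are each of lower order. For the intrinsic
  volumes the obstacle is measure-theoretic. A Bochner integral that fails to exist has the value 0,
  so a lower bound needs measurability in E and finiteness, while the inner integral runs over a
  space that moves with E, in coordinates given by an arbitrary choice of basis. Therefore the inner
  integral is rewritten as a function of the projection matrix alone, defined for all
  matrices.\<close>

definition index_nat :: "'n::finite \<Rightarrow> nat" where
  "index_nat = (SOME h. bij_betw h UNIV {..<CARD('n)})"

lemma bij_index_nat: "bij_betw (index_nat :: 'n::finite \<Rightarrow> nat) UNIV {..<CARD('n)}"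
  unfolding index_nat_def
  using someI_ex[OF ex_bij_betw_finite_nat[OF finite, of "UNIV :: 'n set"]]
  by (simp add: lessThan_atLeast0)

lemma index_nat_eq_iff [simp]: "index_nat a = index_nat b \<longleftrightarrow> a = (b :: 'n::finite)"
  using bij_index_nat[where 'n='n] by (auto simp: bij_betw_def inj_on_def)

lemma index_nat_less [simp]: "index_nat (a :: 'n::finite) < CARD('n)"
  using bij_index_nat[where 'n='n] by (auto simp: bij_betw_def)

lemma sum_index_nat: "(\<Sum>b\<in>(UNIV :: 'n::finite set). g (index_nat b)) = (\<Sum>i<CARD('n). g i)"
  by (rule sum.reindex_bij_betw[OF bij_index_nat])

lemma prod_index_nat: "(\<Prod>b\<in>(UNIV :: 'n::finite set). g (index_nat b)) = (\<Prod>i<CARD('n). g i)"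
  by (rule prod.reindex_bij_betw[OF bij_index_nat])

lemma ball_index_nat: "(\<forall>b::'n::finite. Q (index_nat b)) \<longleftrightarrow> (\<forall>i<CARD('n). Q i)"
proof -
  have "{..<CARD('n)} = range (index_nat :: 'n \<Rightarrow> nat)"
    using bij_index_nat[where 'n='n] by (simp add: bij_betw_def)
  then show ?thesis by (metis (mono_tags, lifting) imageE index_nat_less lessThan_iff)
qed

text \<open>The order of the axes matters, since the first j of them enter the bounds. Hence frames
  are sequences over the naturals, and \<open>index_nat\<close> links them to the coordinates of the
  vector type. Values from \<open>k\<close> on are free, so a partial frame grows by function
  update.\<close>

definition orthonormal_upto :: "nat \<Rightarrow> (nat \<Rightarrow> 'a::real_inner) \<Rightarrow> bool" where
  "orthonormal_upto k u \<longleftrightarrow> (\<forall>i<k. \<forall>j<k. u i \<bullet> u j = (if i = j then 1 else 0))"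

abbreviation orthonormal_frame :: "(nat \<Rightarrow> real^'n::finite) \<Rightarrow> bool" where
  "orthonormal_frame \<equiv> orthonormal_upto CARD('n)"

lemma orthonormal_uptoD:
  "orthonormal_upto k u \<Longrightarrow> i < k \<Longrightarrow> j < k \<Longrightarrow> u i \<bullet> u j = (if i = j then 1 else 0)"
  by (simp add: orthonormal_upto_def)

lemma orthonormal_upto_norm: "orthonormal_upto k u \<Longrightarrow> i < k \<Longrightarrow> norm (u i) = 1"
  using orthonormal_uptoD[of k u i i] by (simp add: norm_eq_sqrt_inner)

lemma orthogonal_unit_vector:
  fixes u :: "nat \<Rightarrow> real^'n::finite"
  assumes "k < CARD('n)"
  obtains w where "norm w = 1" "\<And>i. i < k \<Longrightarrow> u i \<bullet> w = 0"
proof -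
  have "dim (u ` {..<k}) \<le> card (u ` {..<k})" by (rule dim_le_card') simp
  also have "\<dots> \<le> k" using card_image_le[of "{..<k}" u] by simp
  finally have "dim (u ` {..<k}) < DIM(real^'n)" using assms by simp
  then obtain x where x: "x \<noteq> 0" "\<And>y. y \<in> span (u ` {..<k}) \<Longrightarrow> orthogonal x y"
    by (rule orthogonal_to_subspace_exists) blast
  show ?thesis
  proof (rule that[of "x /\<^sub>R norm x"])
    fix i assume "i < k"
    then have "orthogonal x (u i)" by (intro x(2) span_base) auto
    then show "u i \<bullet> (x /\<^sub>R norm x) = 0" by (simp add: orthogonal_def inner_commute)
  qed (use x(1) in simp)
qed

lemma orthonormal_upto_fun_upd:
  assumes "orthonormal_upto k u" "norm w = 1" "\<And>i. i < k \<Longrightarrow> u i \<bullet> w = 0"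
  shows "orthonormal_upto (Suc k) (u(k := w))"
  using assms by (auto simp: orthonormal_upto_def less_Suc_eq inner_commute dot_square_norm)

lemma orthonormal_frame_extend:
  fixes u :: "nat \<Rightarrow> real^'n::finite"
  assumes "orthonormal_upto k u" "k \<le> CARD('n)"
  shows "\<exists>v. orthonormal_frame v \<and> (\<forall>i<k. v i = u i)"
  using assms(2,1)
\<comment> \<open>The induction descends from the full dimension: the hypothesis for
  \<open>Suc k\<close> is applied to \<open>u\<close> with one more unit vector.\<close>
proof (induction k arbitrary: u rule: inc_induct)
  case base
  then show ?case by auto
next
  case (step k)
  obtain w where "norm w = 1" "\<And>i. i < k \<Longrightarrow> u i \<bullet> w = 0"
    using orthogonal_unit_vector[OF step.hyps(2), of u] by blast
  from step.IH[OF orthonormal_upto_fun_upd[OF step.prems this]] show ?case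
    by (auto simp: less_Suc_eq)
qed

text \<open>Change of basis from the standard basis to the frame; the transpose reads off frame
  coordinates.\<close>

definition frame_matrix :: "(nat \<Rightarrow> real^'n::finite) \<Rightarrow> real^'n^'n" where
  "frame_matrix u = (\<chi> a b. u (index_nat b) $ a)"

lemma transpose_frame_matrix_mult: "(transpose (frame_matrix u) *v x) $ b = u (index_nat b) \<bullet> x"
  by (simp add: frame_matrix_def transpose_def matrix_vector_mult_def inner_vec_def)

lemma frame_matrix_mult:
  fixes u :: "nat \<Rightarrow> real^'n::finite"
  shows "frame_matrix u *v y = (\<Sum>b\<in>UNIV. y $ b *\<^sub>R u (index_nat b))"
  by (simp add: frame_matrix_def matrix_vector_mult_def vec_eq_iff mult.commute)

lemma orthogonal_frame_matrix:
  assumes "orthonormal_frame (u :: nat \<Rightarrow> real^'n::finite)"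
  shows "orthogonal_matrix (frame_matrix u)"
proof -
  have "(transpose (frame_matrix u) ** frame_matrix u) $ a $ b = u (index_nat a) \<bullet> u (index_nat b)" for a b
    by (simp add: frame_matrix_def transpose_def matrix_matrix_mult_def inner_vec_def)
  then have "transpose (frame_matrix u) ** frame_matrix u = mat 1"
    using assms by (simp add: vec_eq_iff mat_def orthonormal_upto_def)
  then show ?thesis by (simp add: orthogonal_matrix)
qed

lemma frame_expansion:
  fixes u :: "nat \<Rightarrow> real^'n::finite"
  assumes "orthonormal_frame u"
  shows "x = (\<Sum>i<CARD('n). (u i \<bullet> x) *\<^sub>R u i)"
proof -
  have "x = frame_matrix u *v (transpose (frame_matrix u) *v x)"
    using orthogonal_matrix_inner(3)[OF orthogonal_frame_matrix[OF assms]] by simp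
  also have "\<dots> = (\<Sum>b\<in>(UNIV :: 'n set). (u (index_nat b) \<bullet> x) *\<^sub>R u (index_nat b))"
    by (simp only: frame_matrix_mult transpose_frame_matrix_mult)
  also have "\<dots> = (\<Sum>i<CARD('n). (u i \<bullet> x) *\<^sub>R u i)"
    by (rule sum_index_nat[of "\<lambda>i. (u i \<bullet> x) *\<^sub>R u i"])
  finally show ?thesis .
qed

lemma inner_frame_sum:
  assumes "orthonormal_upto k u" "finite I" "I \<subseteq> {..<k}" "l < k"
  shows "u l \<bullet> (\<Sum>i\<in>I. c i *\<^sub>R u i) = (if l \<in> I then c l else 0)"
proof -
  have "u l \<bullet> (\<Sum>i\<in>I. c i *\<^sub>R u i) = (\<Sum>i\<in>I. if i = l then c l else 0)"
    unfolding inner_sum_right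
    by (rule sum.cong) (use assms orthonormal_uptoD[OF assms(1,4)] in auto)
  also have "\<dots> = (if l \<in> I then c l else 0)" using assms(2) by (simp add: sum.delta')
  finally show ?thesis .
qed

lemma norm_frame_sum:
  fixes u :: "nat \<Rightarrow> 'a::real_inner"
  assumes "orthonormal_upto k u" "finite I" "I \<subseteq> {..<k}"
  shows "(norm (\<Sum>i\<in>I. c i *\<^sub>R u i))\<^sup>2 = (\<Sum>i\<in>I. (c i)\<^sup>2)"
proof -
  have "(norm (\<Sum>i\<in>I. c i *\<^sub>R u i))\<^sup>2 = (\<Sum>l\<in>I. c l * (u l \<bullet> (\<Sum>i\<in>I. c i *\<^sub>R u i)))"
    by (simp add: power2_norm_eq_inner inner_sum_left)
  also have "\<dots> = (\<Sum>l\<in>I. (c l)\<^sup>2)"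
    by (rule sum.cong) (use inner_frame_sum[OF assms] assms(3) in \<open>auto simp: power2_eq_square\<close>)
  finally show ?thesis .
qed

section \<open>Projections onto the span of the first vectors of a frame\<close>

definition coord_proj :: "nat \<Rightarrow> real^'n::finite^'n" where
  "coord_proj j = (\<chi> a b. if a = b \<and> index_nat a < j then 1 else 0)"

text \<open>For an orthonormal frame this is the orthogonal projection onto the span of the first
  \<open>j\<close> vectors, written as a conjugate of the fixed model \<open>coord_proj j\<close>.
  In this form rotations act by conjugation.\<close>

definition frame_proj :: "nat \<Rightarrow> (nat \<Rightarrow> real^'n::finite) \<Rightarrow> real^'n^'n" where
  "frame_proj j u = frame_matrix u ** coord_proj j ** transpose (frame_matrix u)"

lemma frame_proj_mult:
  fixes u :: "nat \<Rightarrow> real^'n::finite"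
  assumes "j \<le> CARD('n)"
  shows "frame_proj j u *v x = (\<Sum>i<j. (u i \<bullet> x) *\<^sub>R u i)"
proof -
  have c: "(coord_proj j *v y) $ b = (if index_nat b < j then y $ b else 0)" for y :: "real^'n" and b
  proof -
    have "(coord_proj j *v y) $ b = (\<Sum>i\<in>UNIV. if b = i then (if index_nat b < j then y $ b else 0) else 0)"
      unfolding coord_proj_def matrix_vector_mult_def vec_lambda_beta by (rule sum.cong) auto
    then show ?thesis by simp
  qed
  have "frame_proj j u *v x
      = (\<Sum>b\<in>(UNIV :: 'n set). (if index_nat b < j then u (index_nat b) \<bullet> x else 0) *\<^sub>R u (index_nat b))"
    unfolding frame_proj_def
    by (simp only: flip: matrix_vector_mul_assoc)
      (simp only: frame_matrix_mult c transpose_frame_matrix_mult)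
  also have "\<dots> = (\<Sum>i<CARD('n). (if i < j then u i \<bullet> x else 0) *\<^sub>R u i)"
    by (rule sum_index_nat[of "\<lambda>i. (if i < j then u i \<bullet> x else 0) *\<^sub>R u i"])
  also have "\<dots> = (\<Sum>i<j. (u i \<bullet> x) *\<^sub>R u i)"
    by (rule sum.mono_neutral_cong_right) (use assms in auto)
  finally show ?thesis .
qed

lemma frame_proj_closest_point:
  fixes u :: "nat \<Rightarrow> real^'n::finite"
  assumes u: "orthonormal_frame u" and j: "j \<le> CARD('n)"
  shows "frame_proj j u = matrix (closest_point (span (u ` {..<j})))"
proof -
  let ?E = "span (u ` {..<j})"
  have "closest_point ?E x = frame_proj j u *v x" for x
    unfolding frame_proj_mult[OF j]
  proof (rule closest_point_subspace_eqI)
    show "(\<Sum>i<j. (u i \<bullet> x) *\<^sub>R u i) \<in> ?E"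
      by (intro span_sum span_scale span_base) auto
    fix e assume "e \<in> ?E"
    then show "(x - (\<Sum>i<j. (u i \<bullet> x) *\<^sub>R u i)) \<bullet> e = 0"
    proof (induction rule: span_induct)
      case base
      show ?case by (simp add: subspace_def inner_add_right)
    next
      case (step y)
      then obtain l where l: "l < j" "y = u l" by auto
      have "u l \<bullet> (\<Sum>i<j. (u i \<bullet> x) *\<^sub>R u i) = u l \<bullet> x"
        using inner_frame_sum[OF u, of "{..<j}" l "\<lambda>i. u i \<bullet> x"] l j by auto
      then show ?case unfolding l(2) inner_commute[of _ "u l"] inner_diff_right by simp
    qed
  qed simp
  then have "frame_proj j u *v x = matrix (closest_point ?E) *v x" for x
    by (simp add: matrix_closest_point_mul)
  then show ?thesis unfolding matrix_eq by blast
qed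

text \<open>Bases come as sets, both from the library and from the choice inside
  \<open>subspace_lborel\<close>. Here such a set becomes the initial segment of a full
  frame.\<close>

lemma orthonormal_set_frame:
  fixes B :: "(real^'n::finite) set"
  assumes B: "pairwise orthogonal B" "\<forall>b\<in>B. norm b = 1"
  obtains u where "orthonormal_frame u" "bij_betw u {..<card B} B" "card B = dim (span B)"
    "card B \<le> CARD('n)"
proof -
  have "0 \<notin> B" using B(2) by force
  then have ind: "independent B" by (rule pairwise_orthogonal_independent[OF B(1)])
  then have fin: "finite B" and cd: "card B = dim (span B)"
    by (auto simp: independent_imp_finite dim_eq_card_independent dim_span)
  have le: "card B \<le> CARD('n)" using cd dim_subset_UNIV[of "span B"] by simp
  obtain h where h: "bij_betw h {..<card B} B"
    using ex_bij_betw_nat_finite[OF fin] by (auto simp: lessThan_atLeast0)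
  have "orthonormal_upto (card B) h"
    unfolding orthonormal_upto_def
  proof (intro allI impI)
    fix i j assume ij: "i < card B" "j < card B"
    then have hB: "h i \<in> B" "h j \<in> B" using h by (auto simp: bij_betw_def)
    show "h i \<bullet> h j = (if i = j then 1 else 0)"
    proof (cases "i = j")
      case True
      then show ?thesis using hB B(2) by (simp add: dot_square_norm)
    next
      case False
      then have "h i \<noteq> h j" using h ij by (auto simp: bij_betw_def inj_on_def)
      then show ?thesis using B(1) hB False by (auto simp: pairwise_def orthogonal_def)
    qed
  qed
  from orthonormal_frame_extend[OF this le] obtain v
    where v: "orthonormal_frame v" "\<forall>i<card B. v i = h i" by blast
  have "bij_betw v {..<card B} B" using h v(2) bij_betw_cong[of "{..<card B}" v h B] by simp
  then show ?thesis using that v(1) cd le by blast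
qed

lemma subspace_frame:
  fixes E :: "(real^'n::finite) set"
  assumes "subspace E"
  obtains u where "orthonormal_frame u" "E = span (u ` {..<dim E})"
    "matrix (closest_point E) = frame_proj (dim E) u"
proof -
  obtain B where B: "pairwise orthogonal B" "\<And>x. x \<in> B \<Longrightarrow> norm x = 1" "span B = E"
    using orthonormal_basis_subspace[OF assms] by metis
  obtain u where u: "orthonormal_frame u" "bij_betw u {..<card B} B" "card B = dim (span B)"
    "card B \<le> CARD('n)" using orthonormal_set_frame[OF B(1)] B(2) by blast
  have "E = span (u ` {..<dim E})" using u B by (simp add: bij_betw_def)
  then show ?thesis using that frame_proj_closest_point[OF u(1)] u B by metis
qed

text \<open>Invariance of the measure is available for determinant 1 only. If the frame matrix has
  determinant -1, the last vector is negated: this flips the sign, and since \<open>j\<close> is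
  less than the dimension it leaves the projection unchanged.\<close>

lemma frame_proj_rotation:
  fixes u :: "nat \<Rightarrow> real^'n::finite"
  assumes u: "orthonormal_frame u" and j: "j < CARD('n)"
  obtains Q where "rotation_matrix Q" "frame_proj j u = Q ** coord_proj j ** transpose Q"
proof (cases "det (frame_matrix u) = 1")
  case True
  then show ?thesis
    using that[of "frame_matrix u"] orthogonal_frame_matrix[OF u]
    by (simp add: rotation_matrix_def frame_proj_def)
next
  case False
  let ?l = "CARD('n) - Suc 0"
  let ?v = "u(?l := - u ?l)"
  have v: "orthonormal_frame ?v" using u by (auto simp: orthonormal_upto_def)
  have "frame_proj j ?v *v x = frame_proj j u *v x" for x
    unfolding frame_proj_mult[OF less_imp_le[OF j]] by (rule sum.cong) (use j in auto)
  then have eq: "frame_proj j ?v = frame_proj j u" unfolding matrix_eq by blast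
  have "?l \<in> range (index_nat :: 'n \<Rightarrow> nat)"
    using bij_index_nat[where 'n='n] by (simp add: bij_betw_def)
  then obtain a :: 'n where a: "index_nat a = ?l" by auto
  have ab: "index_nat b = ?l \<longleftrightarrow> b = a" for b :: 'n by (metis a index_nat_eq_iff)
  have "transpose (frame_matrix ?v) =
      (\<chi> b. if b = a then (-1) *s u (index_nat b) else u (index_nat b))"
    by (auto simp add: frame_matrix_def transpose_def vec_eq_iff ab a)
  then have "det (transpose (frame_matrix ?v))
      = -1 * det (\<chi> b. u (index_nat b))"
    using det_row_mul[of a "-1" "\<lambda>b. u (index_nat b)" "\<lambda>b. u (index_nat b)"] by simp
  also have "(\<chi> b. u (index_nat b)) = transpose (frame_matrix u)"
    by (simp add: frame_matrix_def transpose_def vec_eq_iff)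
  finally have "det (frame_matrix ?v) = - det (frame_matrix u)" by (simp only: det_transpose)
  moreover have "det (frame_matrix u) = 1 \<or> det (frame_matrix u) = -1"
    by (rule det_orthogonal_matrix[OF orthogonal_frame_matrix[OF u]])
  ultimately have "rotation_matrix (frame_matrix ?v)"
    using False orthogonal_frame_matrix[OF v] by (simp add: rotation_matrix_def)
  then show ?thesis using that[of "frame_matrix ?v"] eq by (simp add: frame_proj_def)
qed

subsection \<open>A box comparable to a symmetric convex body\<close>

lemma greedy_axes:
  fixes K :: "(real^'n::finite) set"
  assumes K: "compact K" and e: "e > 0" "cball 0 e \<subseteq> K"
  shows "k \<le> CARD('n) \<Longrightarrow> \<exists>u r. orthonormal_upto k u \<and> (\<forall>i<k. r i > 0 \<and> r i *\<^sub>R u i \<in> K \<and>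
           (\<forall>x\<in>K. (\<forall>l<i. u l \<bullet> x = 0) \<longrightarrow> norm x \<le> r i))"
proof (induction k)
  case 0
  then show ?case by (auto simp: orthonormal_upto_def)
next
  case (Suc k)
  then obtain u r where u: "orthonormal_upto k u" and r: "\<forall>i<k. r i > 0 \<and> r i *\<^sub>R u i \<in> K \<and>
      (\<forall>x\<in>K. (\<forall>l<i. u l \<bullet> x = 0) \<longrightarrow> norm x \<le> r i)"
    by auto
  define W where "W = K \<inter> (\<Inter>l\<in>{..<k}. {x. u l \<bullet> x = 0})"
  have "compact W" unfolding W_def
    by (intro compact_Int_closed K closed_INT ballI closed_hyperplane)
  moreover have "0 \<in> W" using e by (auto simp: W_def)
  moreover have "continuous_on W norm" by (intro continuous_intros)
  ultimately obtain x where x: "x \<in> W" "\<And>y. y \<in> W \<Longrightarrow> norm y \<le> norm x"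
    using continuous_attains_sup[of W norm] by blast
  obtain w where w: "norm w = 1" "\<And>i. i < k \<Longrightarrow> u i \<bullet> w = 0"
    using orthogonal_unit_vector[of k u] Suc.prems by auto
  \<comment> \<open>As \<open>k\<close> is below the dimension, some direction orthogonal to the
    previous axes is left, and the ball in \<open>K\<close> provides a nonzero point there. So the
    maximal norm is positive and its maximiser can be normalised.\<close>
  have "e *\<^sub>R w \<in> W" using e w by (auto simp: W_def)
  from x(2)[OF this] have nx: "norm x > 0" using e(1) w(1) by (simp del: zero_less_norm_iff)
  define u' where "u' = u(k := x /\<^sub>R norm x)"
  define r' where "r' = r(k := norm x)"
  have "orthonormal_upto (Suc k) u'" unfolding u'_def
    by (rule orthonormal_upto_fun_upd[OF u]) (use nx x(1) in \<open>auto simp: W_def\<close>)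
  moreover have "r' i > 0 \<and> r' i *\<^sub>R u' i \<in> K \<and>
      (\<forall>x\<in>K. (\<forall>l<i. u' l \<bullet> x = 0) \<longrightarrow> norm x \<le> r' i)" if "i < Suc k" for i
  proof (cases "i = k")
    case True
    then show ?thesis using nx x by (auto simp: W_def u'_def r'_def)
  next
    case False
    then show ?thesis using that r by (auto simp: u'_def r'_def)
  qed
  ultimately show ?case by blast
qed

text \<open>The axes are chosen greedily: \<open>r i\<close> is the largest norm of a point of \<open>K\<close> orthogonal to the
  previous axes. The factor \<open>2 ^ i\<close> arises because removing one coordinate from a point of \<open>c K\<close>
  gives a point of \<open>2 c K\<close>.\<close>

lemma convex_body_box:
  fixes K :: "(real^'n::finite) set"
  assumes K: "compact K" "convex K" "\<And>x. x \<in> K \<Longrightarrow> - x \<in> K" and e: "e > 0" "cball 0 e \<subseteq> K"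
  obtains u r where "orthonormal_frame u" "\<And>i. i < CARD('n) \<Longrightarrow> r i > 0"
    "\<And>i l. l \<le> i \<Longrightarrow> i < CARD('n) \<Longrightarrow> r i \<le> r l"
    "\<And>i x. i < CARD('n) \<Longrightarrow> x \<in> K \<Longrightarrow> \<bar>u i \<bullet> x\<bar> \<le> 2 ^ i * r i"
    "\<And>x. (\<And>i. i < CARD('n) \<Longrightarrow> \<bar>u i \<bullet> x\<bar> \<le> r i / CARD('n)) \<Longrightarrow> x \<in> K"
proof -
  let ?n = "CARD('n)"
  obtain u r where u: "orthonormal_frame u" and ur: "\<forall>i<?n. r i > 0 \<and> r i *\<^sub>R u i \<in> K \<and>
      (\<forall>x\<in>K. (\<forall>l<i. u l \<bullet> x = 0) \<longrightarrow> norm x \<le> r i)"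
    using greedy_axes[OF K(1) e, of ?n] by auto
  have r: "r i > 0" "r i *\<^sub>R u i \<in> K" "x \<in> K \<Longrightarrow> \<forall>l<i. u l \<bullet> x = 0 \<Longrightarrow> norm x \<le> r i"
    if "i < ?n" for i x
    using ur that by auto
  have z: "0 \<in> K" using e by auto
  have seg: "c *\<^sub>R (r i *\<^sub>R u i) \<in> K" if "i < ?n" "\<bar>c\<bar> \<le> 1" for i c
  proof -
    have *: "s *\<^sub>R y \<in> K" if "y \<in> K" "0 \<le> s" "s \<le> 1" for s y
      using convexD[OF K(2) that(1) z, of s "1 - s"] that by simp
    show ?thesis
      using *[OF r(2)[OF that(1)], of c] *[OF K(3)[OF r(2)[OF that(1)]], of "- c"] that(2)
      by (cases "c \<ge> 0") auto
  qed
  \<comment> \<open>The end point of axis \<open>i\<close> is orthogonal to the axes before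
    \<open>l\<close>, hence was a candidate when axis \<open>l\<close> was chosen.\<close>
  have anti: "r i \<le> r l" if "l \<le> i" "i < ?n" for i l
  proof -
    have "norm (r i *\<^sub>R u i) \<le> r l"
      by (rule r(3)) (use that r(2) orthonormal_uptoD[OF u] in auto)
    then show ?thesis using orthonormal_upto_norm[OF u that(2)] r(1)[OF that(2)] by simp
  qed
  have bound: "\<bar>u i \<bullet> x\<bar> \<le> 2 ^ i * r i" if i: "i < ?n" and x: "x \<in> K" for i x
  proof -
    \<comment> \<open>\<open>y m\<close> is \<open>x\<close> without its first \<open>m\<close>
      frame coordinates. Once a positive multiple of it is known to lie in \<open>K\<close>, the
      maximality of \<open>r m\<close> bounds its norm.\<close>
    define y where "y = (\<lambda>i. x - (\<Sum>l<i. (u l \<bullet> x) *\<^sub>R u l))"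
    have ortho: "u l \<bullet> y m = (if l < m then 0 else u l \<bullet> x)" if "m \<le> ?n" "l < ?n" for m l
      using inner_frame_sum[OF u, of "{..<m}" l "\<lambda>l. u l \<bullet> x"] that
      by (auto simp: y_def inner_diff_right)
    have one: "\<bar>u m \<bullet> x\<bar> \<le> 2 ^ m * r m" if "m < ?n" "(1 / 2 ^ m) *\<^sub>R y m \<in> K" for m
    proof -
      have "norm ((1 / 2 ^ m) *\<^sub>R y m) \<le> r m"
        by (rule r(3)) (use that ortho in auto)
      then have "norm (y m) \<le> 2 ^ m * r m" by (simp add: field_simps)
      moreover have "\<bar>u m \<bullet> y m\<bar> \<le> norm (y m)"
        using Cauchy_Schwarz_ineq2[of "u m" "y m"] orthonormal_upto_norm[OF u that(1)] by simp
      ultimately show ?thesis using ortho[of m m] that by simp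
    qed
    have "m \<le> i \<Longrightarrow> (1 / 2 ^ m) *\<^sub>R y m \<in> K" for m
    proof (induction m)
      case 0
      then show ?case using x by (simp add: y_def)
    next
      case (Suc m)
      then have m: "m < ?n" and IH: "(1 / 2 ^ m) *\<^sub>R y m \<in> K" using i by auto
      have rm: "r m > 0" by (rule r(1)[OF m])
      \<comment> \<open>Chosen so that the midpoint of \<open>(1 / 2 ^ m) *\<^sub>R y m\<close> and
        the point with parameter \<open>c\<close> on axis \<open>m\<close> has no component along
        \<open>u m\<close>. Each midpoint costs a factor 2.\<close>
      define c where "c = - (u m \<bullet> x) / (2 ^ m * r m)"
      have "\<bar>c\<bar> \<le> 1" using one[OF m IH] rm by (simp add: c_def abs_mult)
      note cK = seg[OF m this]
      have "(1 / 2 ^ Suc m) *\<^sub>R y (Suc m)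
          = (1/2) *\<^sub>R ((1 / 2 ^ m) *\<^sub>R y m) + (1/2) *\<^sub>R (c *\<^sub>R (r m *\<^sub>R u m))"
        using rm by (simp add: y_def c_def algebra_simps)
      also have "\<dots> \<in> K" by (rule convexD[OF K(2) IH cK]) auto
      finally show ?case .
    qed
    from one[OF i this[OF order_refl]] show ?thesis .
  qed
  have inner: "x \<in> K" if x: "\<And>i. i < ?n \<Longrightarrow> \<bar>u i \<bullet> x\<bar> \<le> r i / ?n" for x
  proof -
    \<comment> \<open>The factor n turns \<open>x\<close> into the average of n points, one on each
      axis segment; this is why the inner box has half-sides \<open>r i / n\<close>.\<close>
    define c where "c = (\<lambda>i. ?n * (u i \<bullet> x) / r i)"
    have c: "\<bar>c i\<bar> \<le> 1" if "i < ?n" for i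
      using x[OF that] r(1)[OF that] by (simp add: c_def abs_mult field_simps)
    have "x = (\<Sum>i<?n. (u i \<bullet> x) *\<^sub>R u i)" by (rule frame_expansion[OF u])
    also have "\<dots> = (\<Sum>i<?n. (1 / real ?n) *\<^sub>R (c i *\<^sub>R (r i *\<^sub>R u i)))"
    proof (rule sum.cong)
      fix i assume "i \<in> {..<?n}"
      then show "(u i \<bullet> x) *\<^sub>R u i = (1 / real ?n) *\<^sub>R (c i *\<^sub>R (r i *\<^sub>R u i))"
        using r(1)[of i] by (simp add: c_def)
    qed simp
    also have "\<dots> \<in> K"
      by (rule convex_sum[OF _ K(2)]) (use c seg in auto)
    finally show ?thesis .
  qed
  show ?thesis using that[OF u r(1) anti bound inner] by blast
qed

subsection \<open>Homogeneous convex polynomials\<close>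

context
  fixes f :: "real^'n::finite \<Rightarrow> real" and d :: nat
  assumes f: "f \<in> hom_convex_polys d" and d: "d \<ge> 2"
begin

lemma hom_scale: "c > 0 \<Longrightarrow> f (c *\<^sub>R x) = c ^ d * f x"
  using f by (simp add: hom_convex_polys_def)

lemma hom_zero [simp]: "f 0 = 0"
proof -
  have "f 0 = 2 ^ d * f 0" using hom_scale[of 2 0] by simp
  moreover have "(2::real) ^ d > 1" using d by (intro one_less_power) auto
  ultimately show ?thesis by simp
qed

lemma hom_pos: "x \<noteq> 0 \<Longrightarrow> f x > 0"
  using f by (simp add: hom_convex_polys_def)

lemma hom_nonneg: "f x \<ge> 0"
  using hom_pos[of x] by (cases "x = 0") auto

lemma hom_continuous: "continuous_on A f"
  using f by (auto simp: hom_convex_polys_def real_polynomial_function_eq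
      intro: continuous_on_polymonial_function)

lemma hom_borel [measurable]: "f \<in> borel_measurable borel"
  by (rule borel_measurable_continuous_onI[OF hom_continuous])

text \<open>The polynomial \<open>f (t x) - t ^ d * f x\<close> in \<open>t\<close> vanishes for all \<open>t > 0\<close>, hence also for \<open>t = -1\<close>.\<close>

lemma hom_even:
  assumes "even d"
  shows "f (- x) = f x"
proof -
  define q where "q = (\<lambda>t::real. f (t *\<^sub>R x) - f x * t ^ d)"
  have "polynomial_function (\<lambda>t::real. t *\<^sub>R x)"
    by (intro polynomial_function_bounded_linear bounded_linear_scaleR_left)
  then have "real_polynomial_function (f \<circ> (\<lambda>t::real. t *\<^sub>R x))"
    by (rule real_polynomial_function_compose) (use f in \<open>simp add: hom_convex_polys_def\<close>)
  moreover have "real_polynomial_function (\<lambda>t::real. f x * t ^ d)"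
    by (intro real_polynomial_function.intros(4) real_polynomial_function.intros(2)
        real_polynomial_function_power real_polynomial_function.intros(1) bounded_linear_ident)
  ultimately have "real_polynomial_function q"
    unfolding q_def comp_def by (rule real_polynomial_function_diff)
  then obtain a n where q: "q = (\<lambda>t. \<Sum>i\<le>n. a i * t ^ i)"
    unfolding real_polynomial_function_iff_sum by blast
  have "{0<..} \<subseteq> {t. (\<Sum>i\<le>n. a i * t ^ i) = 0}"
    using hom_scale unfolding q[THEN fun_cong, symmetric] by (auto simp: q_def)
  moreover have "infinite {0::real<..}" by (rule infinite_Ioi)
  ultimately have "infinite {t. (\<Sum>i\<le>n. a i * t ^ i) = 0}" using finite_subset by blast
  then have "\<forall>i\<le>n. a i = 0" by (simp add: Transcendental.polyfun_finite_roots)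
  then have "q (-1) = 0" by (simp add: q)
  then show ?thesis using assms by (simp add: q_def)
qed

lemma hom_lower: "\<exists>c>0. \<forall>x. c * norm x ^ d \<le> f x"
proof -
  have "\<exists>z\<in>sphere 0 1. \<forall>y\<in>sphere 0 1. f z \<le> f y"
    by (rule continuous_attains_inf) (simp_all add: hom_continuous)
  then obtain z where z: "z \<in> sphere 0 1" "\<And>y. y \<in> sphere 0 1 \<Longrightarrow> f z \<le> f y" by blast
  have "f z * norm x ^ d \<le> f x" for x
  proof (cases "x = 0")
    case True
    then show ?thesis using d by (simp add: power_0_left)
  next
    case False
    have "f z * norm x ^ d \<le> f (x /\<^sub>R norm x) * norm x ^ d"
      by (intro mult_right_mono z) (use False in auto)
    also have "\<dots> = f (norm x *\<^sub>R (x /\<^sub>R norm x))"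
      using False by (subst hom_scale) auto
    also have "\<dots> = f x" using False by simp
    finally show ?thesis .
  qed
  moreover have "f z > 0" using z(1) by (intro hom_pos) auto
  ultimately show ?thesis by blast
qed

lemma hom_convex:
  "u \<ge> 0 \<Longrightarrow> v \<ge> 0 \<Longrightarrow> u + v = 1 \<Longrightarrow> f (u *\<^sub>R x + v *\<^sub>R y) \<le> u * f x + v * f y"
  using f by (auto simp: hom_convex_polys_def convex_on_def)

lemma hom_le_power_iff: "t > 0 \<Longrightarrow> f x \<le> t ^ d \<longleftrightarrow> f (x /\<^sub>R t) \<le> 1"
  using hom_scale[of t "x /\<^sub>R t"] mult_le_cancel_left_pos[of "t ^ d" "f (x /\<^sub>R t)" 1] by simp

text \<open>For positive a, \<open>f x \<le> a ^ d\<close> says that \<open>x\<close> lies in a K.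
  This is the triangle inequality for the gauge of the convex body K, that is, for the d-th root of
  \<open>f\<close>. Zero radii are separate because the convex combination divides by a and
  b.\<close>

lemma hom_le_add:
  assumes "a \<ge> 0" "b \<ge> 0" "f x \<le> a ^ d" "f y \<le> b ^ d"
  shows "f (x + y) \<le> (a + b) ^ d"
proof -
  have z: "w = 0" if "f w \<le> 0 ^ d" for w
    using hom_pos[of w] that d by (cases "w = 0") (auto simp: power_0_left)
  consider "a = 0" | "b = 0" | "a > 0" "b > 0" using assms by linarith
  then show ?thesis
  proof cases
    case 1
    with assms z[of x] show ?thesis by simp
  next
    case 2
    with assms z[of y] show ?thesis by simp
  next
    case 3
    have "f ((a / (a + b)) *\<^sub>R (x /\<^sub>R a) + (b / (a + b)) *\<^sub>R (y /\<^sub>R b))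
        \<le> (a / (a + b)) * f (x /\<^sub>R a) + (b / (a + b)) * f (y /\<^sub>R b)"
      by (rule hom_convex) (use 3 in \<open>auto simp flip: add_divide_distrib\<close>)
    also have "\<dots> \<le> (a / (a + b)) * 1 + (b / (a + b)) * 1"
      using 3 assms by (intro add_mono mult_left_mono) (auto simp: hom_le_power_iff)
    also have "\<dots> = 1" using 3 by (simp flip: add_divide_distrib)
    also have "(a / (a + b)) *\<^sub>R (x /\<^sub>R a) + (b / (a + b)) *\<^sub>R (y /\<^sub>R b) = (x + y) /\<^sub>R (a + b)"
    proof -
      have "(a / (a + b)) *\<^sub>R (x /\<^sub>R a) = x /\<^sub>R (a + b)" "(b / (a + b)) *\<^sub>R (y /\<^sub>R b) = y /\<^sub>R (a + b)"
        using 3 by (simp_all add: divide_simps)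
      then show ?thesis by (simp only: scaleR_right_distrib)
    qed
    finally show ?thesis using 3 by (simp add: hom_le_power_iff)
  qed
qed

lemma sublevel_bounded: "bounded {x. f x \<le> a}"
proof -
  obtain c where c: "c > 0" "\<And>x. c * norm x ^ d \<le> f x" using hom_lower by blast
  have "norm x \<le> 1 + a / c" if "f x \<le> a" for x
  proof (cases "norm x \<le> 1")
    case True
    then show ?thesis using that hom_nonneg[of x] c(1) by (simp add: add_increasing2)
  next
    case False
    have "norm x ^ 1 \<le> norm x ^ d" by (rule power_increasing) (use False d in auto)
    then have "c * norm x \<le> c * norm x ^ d" using c(1) by simp
    then have "c * norm x \<le> a" using c(2)[of x] that by linarith
    then show ?thesis using c(1) by (simp add: field_simps)
  qed
  then show ?thesis by (intro boundedI[of _ "1 + a / c"]) auto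
qed

lemma sublevel_compact: "compact {x. f x \<le> a}"
  using sublevel_bounded closed_Collect_le[OF hom_continuous continuous_on_const, of a]
  by (simp add: compact_eq_bounded_closed)

lemma sublevel_convex: "convex {x. f x \<le> a}"
proof (rule convexI)
  fix x y and u v :: real
  assume *: "x \<in> {x. f x \<le> a}" "y \<in> {x. f x \<le> a}" "0 \<le> u" "0 \<le> v" "u + v = 1"
  then have "f (u *\<^sub>R x + v *\<^sub>R y) \<le> u * f x + v * f y"
    by (intro hom_convex)
  also have "\<dots> \<le> u * a + v * a" using * by (intro add_mono mult_left_mono) auto
  also have "\<dots> = a" using *(5) by (simp flip: distrib_right)
  finally show "u *\<^sub>R x + v *\<^sub>R y \<in> {x. f x \<le> a}" by simp
qed

lemma sublevel_ball: "\<exists>e>0. cball 0 e \<subseteq> {x. f x \<le> 1}"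
proof -
  have "isCont f 0" using hom_continuous[of UNIV] by (simp add: continuous_on_eq_continuous_at)
  then obtain e where e: "e > 0" "\<And>x. norm x < e \<Longrightarrow> \<bar>f x\<bar> < 1"
    unfolding continuous_at_eps_delta by (auto simp: dist_norm dest!: spec[of _ "1::real"])
  have "cball 0 (e/2) \<subseteq> {x. f x \<le> 1}" 
  proof
    fix x :: "real^'n" assume "x \<in> cball 0 (e / 2)"
    then have "norm x < e" using e(1) by simp
    then show "x \<in> {x. f x \<le> 1}" using e(2)[of x] by simp
  qed
  then show ?thesis using e(1) by (intro exI[of _ "e/2"]) auto
qed

lemma sublevel_sets [measurable]: "{x. f x \<le> a} \<in> sets borel"
  by (intro borel_closed closed_Collect_le hom_continuous continuous_on_const)

lemma sublevel_emeasure_finite: "emeasure lborel {x. f x \<le> a} < \<infinity>"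
  by (rule emeasure_bounded_finite[OF sublevel_bounded])

lemma sublevel_measure_scale:
  assumes "t \<ge> 0"
  shows "measure lborel {x. f x \<le> t ^ d} = t ^ CARD('n) * measure lborel {x. f x \<le> 1}"
proof (cases "t = 0")
  case True
  have "f x \<le> 0 \<longleftrightarrow> x = 0" for x using hom_pos[of x] by (cases "x = 0") auto
  then have "{x. f x \<le> 0} = {0}" by auto
  then show ?thesis using True d by (simp add: power_0_left)
next
  case False
  with assms have t: "t > 0" by simp
  let ?A = "{x. f x \<le> t ^ d}"
  have "emeasure lborel ?A = emeasure (density (distr lborel borel (\<lambda>x. 0 + t *\<^sub>R x)) (\<lambda>_. \<bar>t\<bar> ^ DIM(real^'n))) ?A"
    using lborel_affine[of t "0 :: real^'n"] t by simp
  also have "\<dots> = ennreal (t ^ CARD('n)) * emeasure (distr lborel borel (\<lambda>x. 0 + t *\<^sub>R x)) ?A"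
    using t by (subst emeasure_density) (auto simp: nn_integral_cmult_indicator ennreal_power)
  also have "emeasure (distr lborel borel (\<lambda>x. 0 + t *\<^sub>R x)) ?A = emeasure lborel {x. f x \<le> 1}"
    using t by (subst emeasure_distr) (auto simp: hom_scale vimage_def)
  finally show ?thesis using t by (simp add: measure_def enn2real_mult)
qed

text \<open>Layer-cake representation of \<open>exp (- f x)\<close> as the integral of \<open>exp (- s)\<close> over \<open>s \<ge> f x\<close>.\<close>

lemma integral_exp_hom:
  "(LINT x|lborel. exp (- f x)) = Gamma (1 + CARD('n) / d) * measure lborel {x. f x \<le> 1}"
proof -
  let ?n = "CARD('n)"
  let ?V = "measure lborel {x. f x \<le> 1}"
  have d0: "real d > 0" using d by simp
  have layer: "ennreal (exp (- a)) = (\<integral>\<^sup>+s. ennreal (exp (- s)) * indicator {a..} s \<partial>lborel)" for a :: real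
  proof -
    have "(\<integral>\<^sup>+s. ennreal (exp (- s)) * indicator {a..} s \<partial>lborel) = ennreal (0 - (- exp (- a)))"
    proof (rule nn_integral_FTC_atLeast)
      have "((\<lambda>x::real. exp (- x)) \<longlongrightarrow> 0) at_top"
        using filterlim_compose[OF exp_at_bot filterlim_uminus_at_bot_at_top] .
      from tendsto_minus[OF this] show "((\<lambda>x::real. - exp (- x)) \<longlongrightarrow> 0) at_top" by simp
    qed (auto intro!: derivative_eq_intros)
    then show ?thesis by simp
  qed
  \<comment> \<open>The level set of height \<open>s\<close> is K scaled by
    \<open>s powr (1 / d)\<close>, so the inner integral is the volume of K times the integrand of
    the Gamma integral at 1 + n/d. For negative \<open>s\<close> both sides vanish.\<close>
  have level: "(\<integral>\<^sup>+x. ennreal (exp (- s)) * indicator {f x..} s \<partial>lborel)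
      = ennreal ?V * ennreal (indicator {0..} s * s powr (?n / d) / exp s)" for s
  proof (cases "s \<ge> 0")
    case True
    have "s = (s powr (1 / d)) ^ d"
      using True d0 by (cases "s = 0") (auto simp: powr_powr simp flip: powr_realpow)
    then have "measure lborel {x. f x \<le> s} = (s powr (1 / d)) ^ ?n * ?V"
      using sublevel_measure_scale[of "s powr (1 / d)"] by simp
    also have "(s powr (1 / d)) ^ ?n = s powr (?n / d)"
      using True by (cases "s = 0") (auto simp: powr_powr power_0_left simp flip: powr_realpow)
    finally have m: "measure lborel {x. f x \<le> s} = s powr (?n / d) * ?V" .
    have "(\<integral>\<^sup>+x. ennreal (exp (- s)) * indicator {f x..} s \<partial>lborel)
        = (\<integral>\<^sup>+x. ennreal (exp (- s)) * indicator {x. f x \<le> s} x \<partial>lborel)"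
      by (rule nn_integral_cong) (auto simp: indicator_def)
    also have "\<dots> = ennreal (exp (- s)) * emeasure lborel {x. f x \<le> s}"
      by (rule nn_integral_cmult_indicator) simp
    also have "emeasure lborel {x. f x \<le> s} = ennreal (s powr (?n / d) * ?V)"
      using sublevel_emeasure_finite[of s] by (simp add: emeasure_eq_ennreal_measure flip: m)
    finally show ?thesis using True
      by (simp add: exp_minus divide_inverse mult_ac flip: ennreal_mult)
  next
    case False
    have "indicator {f x..} s = (0::ennreal)" for x using hom_nonneg[of x] False by auto
    then show ?thesis using False by simp
  qed
  have "(\<integral>\<^sup>+x. ennreal (exp (- f x)) \<partial>lborel)
      = (\<integral>\<^sup>+x. \<integral>\<^sup>+s. ennreal (exp (- s)) * indicator {f x..} s \<partial>lborel \<partial>lborel)"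
    by (rule nn_integral_cong) (rule layer)
  also have "\<dots> = (\<integral>\<^sup>+s. \<integral>\<^sup>+x. ennreal (exp (- s)) * indicator {f x..} s \<partial>lborel \<partial>lborel)"
  proof (rule lborel_pair.Fubini')
    have *: "(\<lambda>(s, x). ennreal (exp (- s)) * indicator {f x..} s)
        = (\<lambda>p. ennreal (exp (- fst p)) * indicator {p. f (snd p) \<le> fst p} p)"
      by (auto simp: indicator_def)
    show "(\<lambda>(s, x). ennreal (exp (- s)) * indicator {f x..} s)
        \<in> borel_measurable (lborel \<Otimes>\<^sub>M lborel)"
      unfolding * by measurable
  qed
  also have "\<dots> = (\<integral>\<^sup>+s. ennreal ?V * ennreal (indicator {0..} s * s powr (?n / d) / exp s) \<partial>lborel)"
    by (simp only: level)
  also have "\<dots> = ennreal ?V * (\<integral>\<^sup>+s. ennreal (indicator {0..} s * s powr (?n / d) / exp s) \<partial>lborel)"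
    by (rule nn_integral_cmult) measurable
  also have "(\<integral>\<^sup>+s. ennreal (indicator {0..} s * s powr (?n / d) / exp s) \<partial>lborel) = Gamma (1 + ?n / d)"
    using Gamma_conv_nn_integral_real[of "1 + ?n / d"] d0 by (simp add: add_pos_nonneg)
  also have "ennreal ?V * ennreal (Gamma (1 + ?n / d)) = ennreal (Gamma (1 + ?n / d) * ?V)"
    using d0 by (simp add: ennreal_mult' mult.commute)
  finally have "(\<integral>\<^sup>+x. ennreal (exp (- f x)) \<partial>lborel) = ennreal (Gamma (1 + ?n / d) * ?V)" .
  moreover have "Gamma (1 + ?n / d) > 0" using d0 by (intro Gamma_real_pos) (simp add: add_pos_nonneg)
  ultimately show ?thesis by (subst integral_eq_nn_integral) auto
qed

end

subsection \<open>Lattice points\<close>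

lemma emeasure_lborel_cbox_cart:
  fixes l u :: "real^'n::finite"
  assumes "\<And>i. l $ i \<le> u $ i"
  shows "emeasure lborel (cbox l u) = ennreal (\<Prod>i\<in>UNIV. u $ i - l $ i)"
proof -
  have B: "(Basis :: (real^'n) set) = range (\<lambda>i. axis i 1)" by (auto simp: Basis_vec_def)
  have "inj (\<lambda>i::'n. axis i (1::real))" by (simp add: inj_on_def axis_eq_axis)
  then have "(\<Prod>b\<in>(Basis :: (real^'n) set). (u - l) \<bullet> b) = (\<Prod>i\<in>UNIV. u $ i - l $ i)"
    unfolding B by (subst prod.reindex) (simp_all add: inner_axis)
  moreover have "\<forall>b\<in>(Basis :: (real^'n) set). l \<bullet> b \<le> u \<bullet> b" using assms by (auto simp: B inner_axis)
  ultimately show ?thesis by (simp add: emeasure_lborel_cbox_eq)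
qed

lemma matrix_vector_mult_borel [measurable]:
  "(*v) A \<in> borel_measurable borel" for A :: "real^'n::finite^'m::finite"
  by (intro borel_measurable_continuous_onI linear_continuous_on matrix_vector_mul_bounded_linear)

text \<open>The transposed frame matrix maps \<open>B\<close> onto a coordinate box, and orthogonal
  maps preserve Lebesgue measure.\<close>

lemma frame_box_emeasure:
  fixes u :: "nat \<Rightarrow> real^'n::finite"
  assumes u: "orthonormal_frame u" and a: "\<And>i. i < CARD('n) \<Longrightarrow> a i \<ge> 0"
  defines "B \<equiv> {x. \<forall>i<CARD('n). \<bar>u i \<bullet> x\<bar> \<le> a i}"
  shows "B \<in> sets borel" "emeasure lborel B = ennreal (\<Prod>i<CARD('n). 2 * a i)"
proof -
  define T where "T = transpose (frame_matrix u)"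
  have Tn: "(T *v x) $ b = u (index_nat b) \<bullet> x" for x b
    unfolding T_def by (rule transpose_frame_matrix_mult)
  let ?v = "(\<chi> b. a (index_nat b)) :: real^'n"
  have T: "orthogonal_matrix T"
    unfolding T_def using orthogonal_frame_matrix[OF u] by (simp add: orthogonal_matrix_transpose)
  have mT: "(*v) T \<in> borel_measurable borel" by (rule matrix_vector_mult_borel)
  have "x \<in> B \<longleftrightarrow> (\<forall>b::'n. \<bar>u (index_nat b) \<bullet> x\<bar> \<le> a (index_nat b))" for x
    unfolding B_def ball_index_nat[where Q="\<lambda>i. \<bar>u i \<bullet> x\<bar> \<le> a i"] by simp
  then have B: "B = (*v) T -` cbox (- ?v) ?v"
    by (auto simp: mem_box_cart Tn abs_le_iff minus_le_iff)
  show "B \<in> sets borel" unfolding B by (rule measurable_sets_borel[OF mT]) simp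
  have "emeasure lborel B = emeasure (distr lborel borel ((*v) T)) (cbox (- ?v) ?v)"
    unfolding B using mT by (subst emeasure_distr) auto
  also have "\<dots> = emeasure lborel (cbox (- ?v) ?v)" by (simp add: lborel_rotate[OF T])
  also have "\<dots> = ennreal (\<Prod>b\<in>UNIV. ?v $ b - (- ?v) $ b)"
    by (rule emeasure_lborel_cbox_cart) (use a in \<open>simp add: add_nonneg_nonneg\<close>)
  also have "(\<Prod>b\<in>UNIV. ?v $ b - (- ?v) $ b) = (\<Prod>b\<in>(UNIV :: 'n set). 2 * a (index_nat b))"
    by (rule prod.cong) auto
  also have "\<dots> = (\<Prod>i<CARD('n). 2 * a i)" by (rule prod_index_nat[of "\<lambda>i. 2 * a i"])
  finally show "emeasure lborel B = ennreal (\<Prod>i<CARD('n). 2 * a i)" .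
qed

text \<open>Sends a point to the lower corner of its half-open unit cell, so
  \<open>{y. floor_vec y \<in> K}\<close> is the union of the cells attached to the lattice points
  of \<open>K\<close>.\<close>

definition floor_vec :: "real^'n::finite \<Rightarrow> real^'n" where
  "floor_vec y = (\<chi> i. of_int \<lfloor>y $ i\<rfloor>)"

lemma norm_frac_vec_le: "norm (y - floor_vec y) \<le> sqrt CARD('n)" for y :: "real^'n::finite"
proof -
  have "(y $ i - of_int \<lfloor>y $ i\<rfloor>)\<^sup>2 \<le> 1" for i
    by (rule power_le_one) (use floor_correct[of "y $ i"] in linarith)+
  then have "(\<Sum>i\<in>UNIV. (y $ i - of_int \<lfloor>y $ i\<rfloor>)\<^sup>2) \<le> (\<Sum>i\<in>(UNIV :: 'n set). 1)"
    by (intro sum_mono)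
  then show ?thesis by (simp add: norm_vec_def L2_set_def floor_vec_def)
qed

lemma finite_integer_points:
  fixes K :: "(real^'n::finite) set"
  assumes "bounded K"
  shows "finite {x. (\<forall>i. x $ i \<in> \<int>) \<and> x \<in> K}"
proof -
  obtain b where b: "\<And>x. x \<in> K \<Longrightarrow> norm x \<le> b" using assms by (auto simp: bounded_iff)
  have "{x. (\<forall>i. x $ i \<in> \<int>) \<and> x \<in> K}
      \<subseteq> (\<lambda>g. \<chi> i. of_int (g i)) ` (UNIV \<rightarrow>\<^sub>E {- \<lceil>b\<rceil>..\<lceil>b\<rceil>})"
  proof safe
    fix x :: "real^'n" assume x: "\<forall>i. x $ i \<in> \<int>" "x \<in> K"
    have fl: "of_int \<lfloor>x $ i\<rfloor> = x $ i" for i using x(1) by (auto elim!: allE[of _ i] Ints_cases)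
    have "\<bar>x $ i\<bar> \<le> b" for i using component_le_norm_cart[of x i] b[OF x(2)] by linarith
    then have "\<lfloor>x $ i\<rfloor> \<in> {- \<lceil>b\<rceil>..\<lceil>b\<rceil>}" for i
      using fl[of i] by (smt (verit, best) atLeastAtMost_iff ceiling_mono ceiling_of_int
        floor_mono floor_of_int floor_minus le_floor_iff of_int_le_iff le_of_int_ceiling of_int_minus)
    then show "x \<in> (\<lambda>g. \<chi> i. of_int (g i)) ` (UNIV \<rightarrow>\<^sub>E {- \<lceil>b\<rceil>..\<lceil>b\<rceil>})"
      by (intro image_eqI[of _ _ "\<lambda>i. \<lfloor>x $ i\<rfloor>"]) (auto simp: vec_eq_iff fl)
  qed
  then show ?thesis by (rule finite_subset) (intro finite_imageI finite_PiE; simp)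
qed

text \<open>The cells are disjoint, and each has measure 1 because it lies between the open and the
  closed unit box at its corner. Boundedness makes the lattice points finite in number, so that
  \<open>card\<close> is their true number.\<close>

lemma card_integer_points:
  fixes K :: "(real^'n::finite) set"
  assumes "bounded K"
  shows "{y. floor_vec y \<in> K} \<in> sets borel"
    "emeasure lborel {y. floor_vec y \<in> K} = of_nat (card {x. (\<forall>i. x $ i \<in> \<int>) \<and> x \<in> K})"
proof -
  let ?S = "{x. (\<forall>i. x $ i \<in> \<int>) \<and> x \<in> K}"
  note fin = finite_integer_points[OF assms]
  have int: "floor_vec y $ i \<in> \<int>" for y :: "real^'n" and i by (simp add: floor_vec_def)
  have cell: "floor_vec -` {x} \<in> sets borel \<and> emeasure lborel (floor_vec -` {x}) = 1"
    if x: "\<forall>i. x $ i \<in> \<int>" for x :: "real^'n"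
  proof -
    have "of_int \<lfloor>a\<rfloor> = b \<longleftrightarrow> b \<le> a \<and> a < b + 1" if "b \<in> \<int>" for a b :: real
      using that by (auto elim!: Ints_cases simp: floor_eq_iff)
    then have eq: "floor_vec -` {x} = {y. \<forall>i. x $ i \<le> y $ i \<and> y $ i < x $ i + 1}"
      using x by (auto simp: floor_vec_def vec_eq_iff)
    have m: "{y. \<forall>i. x $ i \<le> y $ i \<and> y $ i < x $ i + 1} \<in> sets borel" by measurable
    have "{y. \<forall>i. x $ i \<le> y $ i \<and> y $ i < x $ i + 1} \<subseteq> cbox x (x + (\<chi> i. 1))"
      "box x (x + (\<chi> i. 1)) \<subseteq> {y. \<forall>i. x $ i \<le> y $ i \<and> y $ i < x $ i + 1}"
      by (auto simp: mem_box_cart less_imp_le)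
    then have le: "emeasure lborel (floor_vec -` {x}) \<le> emeasure lborel (cbox x (x + (\<chi> i. 1)))"
      and ge: "emeasure lborel (box x (x + (\<chi> i. 1))) \<le> emeasure lborel (floor_vec -` {x})"
      unfolding eq using m by (auto intro!: emeasure_mono)
    have c: "emeasure lborel (cbox x (x + (\<chi> i. 1))) = 1"
      using emeasure_lborel_cbox_cart[of x "x + (\<chi> i. 1)"] by simp
    moreover have "emeasure lborel (box x (x + (\<chi> i. 1))) = emeasure lborel (cbox x (x + (\<chi> i. 1)))"
      unfolding emeasure_lborel_cbox_eq emeasure_lborel_box_eq ..
    ultimately show ?thesis using le ge m eq by (metis antisym)
  qed
  have U: "{y. floor_vec y \<in> K} = (\<Union>x\<in>?S. floor_vec -` {x})" using int by auto
  show "{y. floor_vec y \<in> K} \<in> sets borel"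
    unfolding U using cell fin by (intro sets.finite_UN) auto
  have "emeasure lborel {y. floor_vec y \<in> K} = (\<Sum>x\<in>?S. emeasure lborel (floor_vec -` {x}))"
    unfolding U
    by (rule sum_emeasure[symmetric]) (use cell fin in \<open>auto simp: disjoint_family_on_def\<close>)
  also have "\<dots> = (\<Sum>x\<in>?S. 1)" using cell by (intro sum.cong) auto
  finally show "emeasure lborel {y. floor_vec y \<in> K} = of_nat (card ?S)" by simp
qed

section \<open>Discrepancy between lattice count and volume\<close>

lemma power_diff_le:
  fixes a b :: real
  assumes "0 \<le> a" "a \<le> b"
  shows "b ^ Suc m - a ^ Suc m \<le> Suc m * (b - a) * b ^ m"
proof -
  have "b ^ Suc m - a ^ Suc m = (b - a) * (\<Sum>p<Suc m. b ^ p * a ^ (m - p))"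
    by (rule diff_power_eq_sum)
  also have "\<dots> \<le> (b - a) * (\<Sum>p<Suc m. b ^ m)"
  proof (intro mult_left_mono sum_mono)
    fix p assume "p \<in> {..<Suc m}"
    then have "b ^ p * b ^ (m - p) = b ^ m" by (simp flip: power_add)
    moreover have "b ^ p * a ^ (m - p) \<le> b ^ p * b ^ (m - p)"
      using assms by (intro mult_left_mono power_mono) auto
    ultimately show "b ^ p * a ^ (m - p) \<le> b ^ m" by linarith
  qed (use assms in auto)
  finally show ?thesis by (simp add: algebra_simps)
qed

text \<open>Expanding the left side gives one product for each subset of the indices. As
  \<open>a\<close> is decreasing, a product of j factors is at most that of the first j, and there
  are \<open>2 ^ m\<close> subsets. The induction uses only that \<open>a m\<close> times the first
  j factors is at most the first j + 1 factors.\<close>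

lemma prod_one_plus_le:
  fixes a :: "nat \<Rightarrow> real"
  assumes "\<And>i. i < m \<Longrightarrow> a i \<ge> 0" "\<And>i l. l \<le> i \<Longrightarrow> i < m \<Longrightarrow> a i \<le> a l"
  shows "(\<Prod>i<m. 1 + a i) \<le> 2 ^ m * (\<Sum>j\<le>m. \<Prod>i<j. a i)"
  using assms
proof (induction m)
  case 0
  then show ?case by simp
next
  case (Suc m)
  let ?P = "\<lambda>j. \<Prod>i<j. a i"
  have P: "?P j \<ge> 0" if "j \<le> Suc m" for j using that Suc.prems(1) by (intro prod_nonneg) auto
  have am: "a m \<ge> 0" using Suc.prems(1) by simp
  have "(\<Prod>i<Suc m. 1 + a i) = (1 + a m) * (\<Prod>i<m. 1 + a i)" by simp
  also have "\<dots> \<le> (1 + a m) * (2 ^ m * (\<Sum>j\<le>m. ?P j))"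
    using Suc.IH Suc.prems am by (intro mult_left_mono) auto
  also have "\<dots> = 2 ^ m * ((\<Sum>j\<le>m. ?P j) + (\<Sum>j\<le>m. a m * ?P j))"
    by (simp add: algebra_simps sum_distrib_left sum.distrib)
  also have "\<dots> \<le> 2 ^ m * (2 * (\<Sum>j\<le>Suc m. ?P j))"
  proof (rule mult_left_mono)
    have "a m * ?P j \<le> ?P (Suc j)" if "j \<le> m" for j
      using mult_right_mono[OF Suc.prems(2)[OF that] P[of j]] that by (simp add: mult.commute)
    then have "(\<Sum>j\<le>m. a m * ?P j) \<le> (\<Sum>j\<le>m. ?P (Suc j))" by (intro sum_mono) auto
    also have "\<dots> \<le> (\<Sum>j\<le>Suc m. ?P j)" unfolding sum.atMost_Suc_shift[of ?P m] by simp
    finally show "(\<Sum>j\<le>m. ?P j) + (\<Sum>j\<le>m. a m * ?P j) \<le> 2 * (\<Sum>j\<le>Suc m. ?P j)"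
      using P[of "Suc m"] by simp
  qed simp
  finally show ?case by (simp add: algebra_simps)
qed

text \<open>The conclusion of \<open>convex_body_box\<close> as one predicate, so that the
  discrepancy bound and the lower bounds for \<open>intrinsic_V\<close> refer to the same
  axes.\<close>

definition frame_box :: "(real^'n::finite) set \<Rightarrow> (nat \<Rightarrow> real^'n) \<Rightarrow> (nat \<Rightarrow> real) \<Rightarrow> bool" where
  "frame_box K u r \<longleftrightarrow> orthonormal_frame u \<and> (\<forall>i<CARD('n). r i > 0) \<and>
     (\<forall>i<CARD('n). \<forall>l\<le>i. r i \<le> r l) \<and>
     (\<forall>i<CARD('n). \<forall>x\<in>K. \<bar>u i \<bullet> x\<bar> \<le> 2 ^ i * r i) \<and>
     (\<forall>x. (\<forall>i<CARD('n). \<bar>u i \<bullet> x\<bar> \<le> r i / CARD('n)) \<longrightarrow> x \<in> K)"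

lemma hom_frame_box:
  fixes f :: "real^'n::finite \<Rightarrow> real"
  assumes f: "f \<in> hom_convex_polys d" "d \<ge> 2" "even d"
  obtains u r where "frame_box {x. f x \<le> 1} u r"
proof -
  obtain e where e: "e > 0" "cball 0 e \<subseteq> {x. f x \<le> 1}" using sublevel_ball[OF f(1,2)] by blast
  have neg: "- x \<in> {x. f x \<le> 1}" if "x \<in> {x. f x \<le> 1}" for x using that hom_even[OF f] by simp
  show ?thesis
  proof (rule convex_body_box[OF sublevel_compact[OF f(1,2), of 1] sublevel_convex[OF f(1,2)] neg e])
    fix u :: "nat \<Rightarrow> real^'n" and r
    assume *: "orthonormal_frame u" "\<And>i. i < CARD('n) \<Longrightarrow> r i > 0"
      "\<And>i l. l \<le> i \<Longrightarrow> i < CARD('n) \<Longrightarrow> r i \<le> r l"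
      "\<And>i x. i < CARD('n) \<Longrightarrow> x \<in> {x. f x \<le> 1} \<Longrightarrow> \<bar>u i \<bullet> x\<bar> \<le> 2 ^ i * r i"
      "\<And>x. (\<And>i. i < CARD('n) \<Longrightarrow> \<bar>u i \<bullet> x\<bar> \<le> r i / CARD('n)) \<Longrightarrow> x \<in> {x. f x \<le> 1}"
    show ?thesis by (rule that[of u r]) (unfold frame_box_def, use * in blast)
  qed
qed

lemma prod_two_power_le: 
  assumes "\<And>i. i < n \<Longrightarrow> r i \<ge> (0::real)"
  shows "(\<Prod>i<n. 2 * (2 ^ i * r i)) \<le> (2 ^ n) ^ n * (\<Prod>i<n. r i)"
proof -
  have "(\<Prod>i<n. 2 * (2 ^ i * r i)) \<le> (\<Prod>i<n. 2 ^ n * r i)"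
  proof (rule prod_mono)
    fix i assume i: "i \<in> {..<n}"
    have "(2::real) ^ Suc i \<le> 2 ^ n" by (rule power_increasing) (use i in auto)
    from mult_right_mono[OF this assms[of i]] i assms[of i]
    show "0 \<le> 2 * (2 ^ i * r i) \<and> 2 * (2 ^ i * r i) \<le> 2 ^ n * r i" by (simp add: mult.assoc)
  qed
  then show ?thesis by (simp add: prod.distrib)
qed

text \<open>With m = n - 1, the body K contains the ball of radius \<open>r m / n\<close>, so a
  vector no longer than the cell diameter sqrt n lies in \<open>(s / r m)\<close> K; this is the
  origin of \<open>s\<close>. The cases compare \<open>s\<close> with the shortest half-axis
  \<open>t * r m\<close> of t K. The three summands of \<open>C\<close> stem from the thick case,
  from the volume in the thin case and from the count in the thin case.\<close>

lemma lattice_discrepancy: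
  fixes f :: "real^'n::finite \<Rightarrow> real"
  assumes f: "f \<in> hom_convex_polys d" "d \<ge> 2" and t: "t > 0"
    and box: "frame_box {x. f x \<le> 1} u r"
  defines "n \<equiv> CARD('n)"
  defines "s \<equiv> real n * sqrt n"
  defines "C \<equiv> (2 ^ n) ^ n * (s * real n * 2 ^ n + s + sqrt n ^ n * (1 + s) * 2 ^ n)"
  shows "\<bar>real (lattice_count f (t ^ d)) - t ^ n * measure lborel {x. f x \<le> 1}\<bar>
    \<le> C * (\<Sum>j<n. t ^ j * (\<Prod>i<j. r i))"
proof -
  obtain m where m: "n = Suc m" unfolding n_def using not0_implies_Suc[of "CARD('n)"] by auto
  let ?P = "\<lambda>j. \<Prod>i<j. r i"
  let ?S = "\<Sum>j<n. t ^ j * ?P j"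
  define V where "V = measure lborel {x. f x \<le> 1}"
  define N where "N = real (lattice_count f (t ^ d))"
  define U where "U = {y. f (floor_vec y) \<le> t ^ d}"
  have u: "orthonormal_frame u" and r: "\<And>i. i < n \<Longrightarrow> r i > 0" "\<And>i l. l \<le> i \<Longrightarrow> i < n \<Longrightarrow> r i \<le> r l"
    and outer: "\<And>i x. i < n \<Longrightarrow> f x \<le> 1 \<Longrightarrow> \<bar>u i \<bullet> x\<bar> \<le> 2 ^ i * r i"
    and inner: "\<And>x. (\<And>i. i < n \<Longrightarrow> \<bar>u i \<bullet> x\<bar> \<le> r i / n) \<Longrightarrow> f x \<le> 1"
    using box unfolding frame_box_def n_def by auto
  have V0: "V \<ge> 0" and N0: "N \<ge> 0" by (simp_all add: V_def N_def)
  have n1: "real n \<ge> 1" using m by simp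
  then have sq: "sqrt n \<ge> 1" by simp
  then have s1: "s \<ge> 1" using n1 mult_mono[of 1 "real n" 1 "sqrt n"] by (simp add: s_def)
  have P0: "?P j \<ge> 0" if "j \<le> n" for j using that r(1) by (intro prod_nonneg) (auto simp: less_imp_le)
  have term_le: "t ^ j * ?P j \<le> ?S" if "j < n" for j
    using that t P0 by (intro member_le_sum) auto
  have S0: "?S \<ge> 0" using t P0 by (intro sum_nonneg) auto
  have U: "U \<in> sets borel" "emeasure lborel U = ennreal N"
    using card_integer_points[OF sublevel_bounded[OF f, of "t ^ d"]]
    by (simp_all add: U_def N_def lattice_count_def ennreal_of_nat_eq_real_of_nat)
  have scaled: "emeasure lborel {x. f x \<le> a ^ d} = ennreal (a ^ n * V)" if "a \<ge> 0" for a
    using sublevel_measure_scale[OF f that] sublevel_emeasure_finite[OF f, of "a ^ d"]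
    by (simp add: emeasure_eq_ennreal_measure n_def V_def)
  have rm: "r m > 0" using r(1) m by simp
  have V_le: "V \<le> (2 ^ n) ^ n * (r m * ?P m)"
  proof -
    have "{x. f x \<le> 1} \<subseteq> {x. \<forall>i<CARD('n). \<bar>u i \<bullet> x\<bar> \<le> 2 ^ i * r i}" using outer by (auto simp: n_def)
    then have "emeasure lborel {x. f x \<le> 1} \<le> ennreal (\<Prod>i<n. 2 * (2 ^ i * r i))"
      using frame_box_emeasure[OF u, of "\<lambda>i. 2 ^ i * r i"] r(1)
      by (metis (mono_tags, lifting) emeasure_mono less_imp_le mult_nonneg_nonneg n_def
          sets_lborel zero_le_numeral zero_le_power)
    also have "emeasure lborel {x. f x \<le> 1} = ennreal V" using scaled[of 1] by simp
    finally have "ennreal V \<le> ennreal (\<Prod>i<n. 2 * (2 ^ i * r i))" .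
    moreover have "0 \<le> (\<Prod>i<n. 2 * (2 ^ i * r i))"
      by (rule prod_nonneg) (use r(1) in \<open>auto simp: less_imp_le\<close>)
    ultimately have "V \<le> (\<Prod>i<n. 2 * (2 ^ i * r i))" by simp
    also have "\<dots> \<le> (2 ^ n) ^ n * ?P n" by (rule prod_two_power_le) (use r(1) in \<open>simp add: less_imp_le\<close>)
    finally show ?thesis using m by (simp add: mult.commute)
  qed
  show ?thesis
  proof (cases "s \<le> t * r m")
    case True
    \<comment> \<open>Thick case: moving a point by at most a cell diameter changes its gauge by at
      most \<open>\<sigma>\<close>, so \<open>U\<close> lies between the dilates of K by
      \<open>t - \<sigma>\<close> and \<open>t + \<sigma>\<close>.\<close>
    define \<sigma> where "\<sigma> = s / r m"
    have \<sigma>: "\<sigma> > 0" "\<sigma> \<le> t" using True rm s1 by (simp_all add: \<sigma>_def field_simps)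
    have small: "f w \<le> \<sigma> ^ d" if w: "norm w \<le> sqrt n" for w
    proof -
      have "\<bar>u i \<bullet> (w /\<^sub>R \<sigma>)\<bar> \<le> r i / n" if i: "i < n" for i
      proof -
        have "\<bar>u i \<bullet> w\<bar> \<le> sqrt n"
          using Cauchy_Schwarz_ineq2[of "u i" w] orthonormal_upto_norm[OF u, of i] i w by (simp add: n_def)
        then have "\<bar>u i \<bullet> (w /\<^sub>R \<sigma>)\<bar> \<le> sqrt n / \<sigma>"
          using \<sigma>(1) by (simp add: abs_mult field_simps)
        also have "\<dots> = r m / n" using rm n1 sq by (simp add: \<sigma>_def s_def)
        also have "\<dots> \<le> r i / n" using r(2)[of i m] i m by (simp add: divide_right_mono)
        finally show ?thesis .
      qed
      then show ?thesis using inner hom_le_power_iff[OF f \<sigma>(1)] by blast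
    qed
    have "U \<subseteq> {x. f x \<le> (t + \<sigma>) ^ d}"
    proof
      fix y assume "y \<in> U"
      then have "f (floor_vec y + (y - floor_vec y)) \<le> (t + \<sigma>) ^ d"
        using small norm_frac_vec_le[of y] t \<sigma> by (intro hom_le_add[OF f]) (auto simp: U_def n_def)
      then show "y \<in> {x. f x \<le> (t + \<sigma>) ^ d}" by simp
    qed
    then have "emeasure lborel U \<le> emeasure lborel {x. f x \<le> (t + \<sigma>) ^ d}"
      by (intro emeasure_mono) (simp_all add: sublevel_sets[OF f])
    then have "N \<le> (t + \<sigma>) ^ n * V" using U scaled[of "t + \<sigma>"] t \<sigma> V0 by simp
    then have up: "N - t ^ n * V \<le> ((t + \<sigma>) ^ n - t ^ n) * V" by (simp add: algebra_simps)
    have "{x. f x \<le> (t - \<sigma>) ^ d} \<subseteq> U"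
    proof
      fix y assume "y \<in> {x. f x \<le> (t - \<sigma>) ^ d}"
      moreover have "norm (floor_vec y - y) \<le> sqrt n"
        using norm_frac_vec_le[of y] by (simp add: norm_minus_commute n_def)
      ultimately have "f (y + (floor_vec y - y)) \<le> ((t - \<sigma>) + \<sigma>) ^ d"
        using small t \<sigma> by (intro hom_le_add[OF f]) auto
      then show "y \<in> U" by (simp add: U_def)
    qed
    then have "emeasure lborel {x. f x \<le> (t - \<sigma>) ^ d} \<le> emeasure lborel U"
      using U(1) by (intro emeasure_mono) simp_all
    then have "(t - \<sigma>) ^ n * V \<le> N" using U scaled[of "t - \<sigma>"] t \<sigma> V0 N0 by simp
    then have lo: "t ^ n * V - N \<le> (t ^ n - (t - \<sigma>) ^ n) * V" by (simp add: algebra_simps)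
    have bound: "b * V \<le> C * ?S" if "b \<le> real n * \<sigma> * (2 * t) ^ m" for b
    proof -
      have "b * V \<le> (real n * \<sigma> * (2 * t) ^ m) * ((2 ^ n) ^ n * (r m * ?P m))"
        by (rule mult_mono[OF that V_le]) (use \<sigma> t V0 in auto)
      \<comment> \<open>The factor \<open>1 / r m\<close> in \<open>\<sigma>\<close> cancels the
        \<open>r m\<close> in the volume bound, which leaves exactly the summand j = n - 1.\<close>
      also have "\<dots> = (2 ^ n) ^ n * (s * real n * 2 ^ m) * (t ^ m * ?P m)"
        using rm by (simp add: \<sigma>_def power_mult_distrib)
      also have "\<dots> \<le> (2 ^ n) ^ n * (s * real n * 2 ^ m) * ?S"
        using term_le[of m] m s1 by (intro mult_left_mono) auto
      also have "\<dots> \<le> C * ?S"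
        unfolding C_def using s1 sq m by (intro mult_right_mono mult_left_mono S0) (simp_all add: add_nonneg_nonneg)
      finally show ?thesis .
    qed
    have "(t + \<sigma>) ^ n - t ^ n \<le> real n * \<sigma> * (t + \<sigma>) ^ m"
      using power_diff_le[of t "t + \<sigma>" m] t \<sigma> m by simp
    also have "\<dots> \<le> real n * \<sigma> * (2 * t) ^ m"
      using \<sigma> t by (intro mult_left_mono power_mono) auto
    finally have "N - t ^ n * V \<le> C * ?S" using bound up by fastforce
    moreover have "t ^ n - (t - \<sigma>) ^ n \<le> real n * \<sigma> * t ^ m"
      using power_diff_le[of "t - \<sigma>" t m] t \<sigma> m by simp
    then have "t ^ n - (t - \<sigma>) ^ n \<le> real n * \<sigma> * (2 * t) ^ m"
      by (rule order_trans) (use \<sigma> t in \<open>auto intro!: mult_left_mono power_mono\<close>)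
    then have "t ^ n * V - N \<le> C * ?S" using bound lo by fastforce
    ultimately show ?thesis unfolding V_def N_def by (simp add: abs_le_iff)
  next
    case False
    define a where "a = (\<lambda>i. t * r i)"
    have a0: "a i \<ge> 0" if "i < n" for i using r(1)[OF that] t by (simp add: a_def)
    have aP: "(\<Prod>i<j. a i) = t ^ j * ?P j" for j by (simp add: a_def prod.distrib)
    have "t ^ n * V \<le> t ^ n * ((2 ^ n) ^ n * (r m * ?P m))" using V_le t by (intro mult_left_mono) auto
    also have "\<dots> = (2 ^ n) ^ n * (t * r m) * (t ^ m * ?P m)" using m by simp
    \<comment> \<open>Thin case: \<open>t * r m < s\<close> absorbs one of the n powers of
      \<open>t\<close>, so the volume itself is of the order of the error term.\<close>
    also have "\<dots> \<le> (2 ^ n) ^ n * s * ?S"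
      using False term_le[of m] m t rm s1 P0[of m] by (intro mult_mono) auto
    finally have v: "t ^ n * V \<le> (2 ^ n) ^ n * s * ?S" .
    \<comment> \<open>The outer box of t K, enlarged by the cell diameter, contains all cells of the
      lattice points.\<close>
    let ?B = "{y. \<forall>i<CARD('n). \<bar>u i \<bullet> y\<bar> \<le> 2 ^ i * a i + sqrt n}"
    have "U \<subseteq> ?B"
    proof safe
      fix y i assume "y \<in> U" and i: "i < CARD('n)"
      then have "f (floor_vec y /\<^sub>R t) \<le> 1" using hom_le_power_iff[OF f t] by (simp add: U_def)
      then have "\<bar>u i \<bullet> (floor_vec y /\<^sub>R t)\<bar> \<le> 2 ^ i * r i" using i outer by (simp only: n_def)
      then have "\<bar>u i \<bullet> floor_vec y\<bar> \<le> 2 ^ i * a i"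
        using t by (simp add: a_def abs_mult field_simps)
      moreover have "\<bar>u i \<bullet> (y - floor_vec y)\<bar> \<le> sqrt n"
        using Cauchy_Schwarz_ineq2[of "u i" "y - floor_vec y"] orthonormal_upto_norm[OF u i]
          norm_frac_vec_le[of y] by (simp add: n_def)
      ultimately show "\<bar>u i \<bullet> y\<bar> \<le> 2 ^ i * a i + sqrt n" by (simp add: inner_diff_right)
    qed
    moreover have nn: "2 ^ i * a i + sqrt n \<ge> 0" if "i < n" for i using a0[OF that] by simp
    ultimately have "emeasure lborel U \<le> ennreal (\<Prod>i<n. 2 * (2 ^ i * a i + sqrt n))"
      using frame_box_emeasure[OF u, of "\<lambda>i. 2 ^ i * a i + sqrt n"] emeasure_mono[of U ?B lborel]
      by (simp add: n_def)
    moreover have "0 \<le> (\<Prod>i<n. 2 * (2 ^ i * a i + sqrt n))"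
      by (intro prod_nonneg mult_nonneg_nonneg nn) auto
    ultimately have "N \<le> (\<Prod>i<n. 2 * (2 ^ i * a i + sqrt n))" unfolding U(2) by simp
    also have "\<dots> \<le> (\<Prod>i<n. 2 ^ n * sqrt n * (1 + a i))"
    proof (rule prod_mono)
      fix i assume i: "i \<in> {..<n}"
      then have p: "(2::real) * 2 ^ i \<le> 2 ^ n" using power_increasing[of "Suc i" n "2::real"] by simp
      have "2 * 2 ^ i * a i \<le> 2 ^ n * sqrt n * a i"
        using p sq a0[of i] i mult_mono[of "2 * 2 ^ i" "2 ^ n" 1 "sqrt n"] by (intro mult_right_mono) auto
      moreover have "(2::real) \<le> 2 ^ n" using m by simp
      then have "2 * sqrt n \<le> 2 ^ n * sqrt n" by (intro mult_right_mono) auto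
      ultimately have "2 * 2 ^ i * a i + 2 * sqrt n \<le> 2 ^ n * sqrt n * a i + 2 ^ n * sqrt n"
        by (rule add_mono)
      moreover have "2 * (2 ^ i * a i + sqrt n) = 2 * 2 ^ i * a i + 2 * sqrt n"
        "2 ^ n * sqrt n * (1 + a i) = 2 ^ n * sqrt n * a i + 2 ^ n * sqrt n"
        by (simp_all add: algebra_simps)
      ultimately show "0 \<le> 2 * (2 ^ i * a i + sqrt n) \<and>
          2 * (2 ^ i * a i + sqrt n) \<le> 2 ^ n * sqrt n * (1 + a i)"
        using nn[of i] i by simp
    qed
    also have "\<dots> = (2 ^ n) ^ n * sqrt n ^ n * ((\<Prod>i<m. 1 + a i) * (1 + a m))"
      unfolding prod.distrib by (simp add: m power_mult_distrib)
    \<comment> \<open>The last factor is bounded by \<open>1 + s\<close> instead of being expanded.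
      So the sum of initial products stops at j = n - 1 and contains no term with
      \<open>t ^ n\<close>.\<close>
    also have "\<dots> \<le> (2 ^ n) ^ n * sqrt n ^ n * ((2 ^ m * (\<Sum>j\<le>m. \<Prod>i<j. a i)) * (1 + s))"
    proof (intro mult_left_mono mult_mono prod_one_plus_le)
      show "a i \<le> a l" if "l \<le> i" "i < m" for i l
        using r(2)[of l i] that m t by (simp add: a_def)
      show "1 + a m \<le> 1 + s" using False by (simp add: a_def)
    qed (use a0 m in \<open>auto intro!: mult_nonneg_nonneg sum_nonneg prod_nonneg add_nonneg_nonneg\<close>)
    also have "(\<Sum>j\<le>m. \<Prod>i<j. a i) = ?S" unfolding aP m lessThan_Suc_atMost ..
    also have "(2 ^ n) ^ n * sqrt n ^ n * ((2 ^ m * ?S) * (1 + s))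
        = (2 ^ n) ^ n * (sqrt n ^ n * (1 + s) * 2 ^ m) * ?S" by simp
    also have "\<dots> \<le> (2 ^ n) ^ n * (sqrt n ^ n * (1 + s) * 2 ^ n) * ?S"
      using s1 sq m by (intro mult_right_mono mult_left_mono S0) auto
    finally have "N \<le> (2 ^ n) ^ n * (sqrt n ^ n * (1 + s) * 2 ^ n) * ?S" .
    moreover have "(2 ^ n) ^ n * (s * real n * 2 ^ n) * ?S \<ge> 0" using s1 S0 by simp
    moreover have "(2 ^ n) ^ n * s * ?S \<ge> 0" using s1 S0 by simp
    moreover have "(2 ^ n) ^ n * (sqrt n ^ n * (1 + s) * 2 ^ n) * ?S \<ge> 0" using s1 S0 by simp
    moreover have "C * ?S = (2 ^ n) ^ n * (s * real n * 2 ^ n) * ?S + (2 ^ n) ^ n * s * ?S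
        + (2 ^ n) ^ n * (sqrt n ^ n * (1 + s) * 2 ^ n) * ?S"
      unfolding C_def by (simp only: distrib_left distrib_right)
    moreover have "t ^ n * V \<ge> 0" using t V0 by simp
    ultimately show ?thesis using v N0 unfolding V_def[symmetric] N_def[symmetric] abs_le_iff by linarith
  qed
qed

subsection \<open>Integration over a subspace\<close>

lemma frame_sum_borel [measurable]:
  "(\<lambda>c. \<Sum>i\<in>I. c i *\<^sub>R u i) \<in> borel_measurable (Pi\<^sub>M I (\<lambda>_. lborel))"
  for u :: "'i \<Rightarrow> 'a::{real_normed_vector, second_countable_topology}"
  by (intro borel_measurable_sum borel_measurable_scaleR borel_measurable_const)
    (use measurable_component_singleton in force)

text \<open>\<open>subspace_lborel\<close> indexes coordinates by the basis vectors themselves; this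
  relabels them by the indices of a frame.\<close>

lemma distr_PiM_lborel_reindex:
  fixes u :: "'i \<Rightarrow> 'a"
  assumes u: "inj_on u I" and I: "finite I"
  shows "distr (Pi\<^sub>M (u ` I) (\<lambda>_. lborel :: real measure)) (Pi\<^sub>M I (\<lambda>_. lborel)) (\<lambda>c. \<lambda>i\<in>I. c (u i))
    = Pi\<^sub>M I (\<lambda>_. lborel)"
proof -
  interpret P: product_sigma_finite "\<lambda>_::'a. lborel :: real measure" ..
  have m: "(\<lambda>c. \<lambda>i\<in>I. c (u i)) \<in> Pi\<^sub>M (u ` I) (\<lambda>_. lborel :: real measure) \<rightarrow>\<^sub>M Pi\<^sub>M I (\<lambda>_. lborel)"
    by (intro measurable_restrict measurable_component_singleton) auto
  show ?thesis
  proof (rule product_sigma_finite.PiM_eqI)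
    show "product_sigma_finite (\<lambda>_::'i. lborel :: real measure)" ..
    fix A :: "'i \<Rightarrow> real set" assume A: "\<And>i. i \<in> I \<Longrightarrow> A i \<in> sets lborel"
    let ?A = "\<lambda>b. A (the_inv_into I u b)"
    have "(\<lambda>c. \<lambda>i\<in>I. c (u i)) -` Pi\<^sub>E I A \<inter> space (Pi\<^sub>M (u ` I) (\<lambda>_. lborel :: real measure))
        = Pi\<^sub>E (u ` I) ?A"
      using u by (auto simp: space_PiM PiE_def Pi_def extensional_def the_inv_into_f_f)
    moreover have "Pi\<^sub>E I A \<in> sets (Pi\<^sub>M I (\<lambda>_. lborel))"
      by (rule sets_PiM_I_finite[OF I]) (use A in auto)
    ultimately have "emeasure (distr (Pi\<^sub>M (u ` I) (\<lambda>_. lborel)) (Pi\<^sub>M I (\<lambda>_. lborel)) (\<lambda>c. \<lambda>i\<in>I. c (u i))) (Pi\<^sub>E I A)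
        = emeasure (Pi\<^sub>M (u ` I) (\<lambda>_. lborel)) (Pi\<^sub>E (u ` I) ?A)"
      using m by (simp add: emeasure_distr)
    also have "\<dots> = (\<Prod>b\<in>u ` I. emeasure lborel (?A b))"
      by (rule P.emeasure_PiM) (use A I u in \<open>auto simp: the_inv_into_f_f\<close>)
    also have "\<dots> = (\<Prod>i\<in>I. emeasure lborel (A i))"
      using u by (simp add: prod.reindex the_inv_into_f_f)
    finally show "emeasure (distr (Pi\<^sub>M (u ` I) (\<lambda>_. lborel)) (Pi\<^sub>M I (\<lambda>_. lborel)) (\<lambda>c. \<lambda>i\<in>I. c (u i))) (Pi\<^sub>E I A)
        = (\<Prod>i\<in>I. emeasure lborel (A i))" .
  qed (use I in auto)
qed

lemma distr_frame_sum:
  fixes u :: "'i \<Rightarrow> 'a::euclidean_space"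
  assumes u: "inj_on u I" and I: "finite I"
  shows "distr (Pi\<^sub>M (u ` I) (\<lambda>_. lborel)) borel (\<lambda>c. \<Sum>b\<in>u ` I. c b *\<^sub>R b)
    = distr (Pi\<^sub>M I (\<lambda>_. lborel)) borel (\<lambda>c. \<Sum>i\<in>I. c i *\<^sub>R u i)"
proof -
  have m: "(\<lambda>c. \<lambda>i\<in>I. c (u i)) \<in> Pi\<^sub>M (u ` I) (\<lambda>_. lborel :: real measure) \<rightarrow>\<^sub>M Pi\<^sub>M I (\<lambda>_. lborel)"
    by (intro measurable_restrict measurable_component_singleton) auto
  have "distr (Pi\<^sub>M I (\<lambda>_. lborel)) borel (\<lambda>c. \<Sum>i\<in>I. c i *\<^sub>R u i)
      = distr (distr (Pi\<^sub>M (u ` I) (\<lambda>_. lborel)) (Pi\<^sub>M I (\<lambda>_. lborel)) (\<lambda>c. \<lambda>i\<in>I. c (u i))) borel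
          (\<lambda>c. \<Sum>i\<in>I. c i *\<^sub>R u i)"
    by (simp only: distr_PiM_lborel_reindex[OF u I])
  also have "\<dots> = distr (Pi\<^sub>M (u ` I) (\<lambda>_. lborel)) borel
      ((\<lambda>c. \<Sum>i\<in>I. c i *\<^sub>R u i) \<circ> (\<lambda>c. \<lambda>i\<in>I. c (u i)))"
    by (rule distr_distr[OF frame_sum_borel m])
  also have "(\<lambda>c. \<Sum>i\<in>I. c i *\<^sub>R u i) \<circ> (\<lambda>c. \<lambda>i\<in>I. c (u i)) = (\<lambda>c. \<Sum>b\<in>u ` I. c b *\<^sub>R b)"
    using u by (simp add: fun_eq_iff sum.reindex)
  finally show ?thesis ..
qed

text \<open>For the standard basis this is the construction of \<open>lborel\<close>. The frame
  matrix carries that basis to \<open>u\<close> and preserves Lebesgue measure.\<close>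

lemma lborel_frame:
  fixes u :: "nat \<Rightarrow> real^'n::finite"
  assumes u: "orthonormal_frame u"
  shows "(lborel :: (real^'n) measure)
    = distr (Pi\<^sub>M {..<CARD('n)} (\<lambda>_. lborel)) borel (\<lambda>c. \<Sum>i<CARD('n). c i *\<^sub>R u i)"
proof -
  let ?I = "{..<CARD('n)}" and ?Q = "frame_matrix u"
  define v where "v = (\<lambda>i. axis (the_inv_into UNIV (index_nat :: 'n \<Rightarrow> nat) i) 1 :: real^'n)"
  have inj: "inj (index_nat :: 'n \<Rightarrow> nat)" by (simp add: inj_on_def)
  have v_idx: "v (index_nat a) = axis a 1" for a by (simp add: v_def the_inv_into_f_f[OF inj])
  have I: "?I = range (index_nat :: 'n \<Rightarrow> nat)"
    using bij_index_nat[where 'n='n] by (simp add: bij_betw_def)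
  have vB: "v ` ?I = Basis" unfolding I by (auto simp: Basis_vec_def v_idx image_image)
  have vi: "inj_on v ?I" unfolding I by (auto simp: inj_on_def v_idx axis_eq_axis)
  have Qv: "?Q *v v i = u i" if "i \<in> ?I" for i
    using that unfolding I by (auto simp: v_idx matrix_vector_mult_basis column_def frame_matrix_def vec_eq_iff)
  have "(lborel :: (real^'n) measure) = distr (Pi\<^sub>M ?I (\<lambda>_. lborel)) borel (\<lambda>c. \<Sum>i\<in>?I. c i *\<^sub>R v i)"
    by (subst lborel_eq) (simp only: distr_frame_sum[OF vi finite_lessThan] flip: vB)
  then have "distr lborel borel ((*v) ?Q)
      = distr (distr (Pi\<^sub>M ?I (\<lambda>_. lborel)) borel (\<lambda>c. \<Sum>i\<in>?I. c i *\<^sub>R v i)) borel ((*v) ?Q)"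
    by simp
  also have "\<dots> = distr (Pi\<^sub>M ?I (\<lambda>_. lborel)) borel ((*v) ?Q \<circ> (\<lambda>c. \<Sum>i\<in>?I. c i *\<^sub>R v i))"
    by (rule distr_distr[OF matrix_vector_mult_borel frame_sum_borel])
  also have "(*v) ?Q \<circ> (\<lambda>c. \<Sum>i\<in>?I. c i *\<^sub>R v i) = (\<lambda>c. \<Sum>i\<in>?I. c i *\<^sub>R u i)"
    using Qv by (auto simp: fun_eq_iff linear_sum[OF matrix_vector_mul_linear] matrix_vector_mult_scaleR
        intro!: sum.cong)
  finally show ?thesis using lborel_rotate[OF orthogonal_frame_matrix[OF u]] by simp
qed

text \<open>The value of \<open>std_normal_density\<close> at 0.\<close>

definition gauss_const :: real where "gauss_const = 1 / sqrt (2 * pi)"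

lemma gauss_const_pos: "gauss_const > 0" by (simp add: gauss_const_def)

lemma prod_std_normal_density:
  "(\<Prod>i\<in>I. std_normal_density (c i)) = gauss_const ^ card I * exp (- (\<Sum>i\<in>I. (c i)\<^sup>2) / 2)"
  by (cases "finite I")
    (simp_all add: std_normal_density_def gauss_const_def prod_dividef power_divide exp_sum sum_divide_distrib flip: sum_negf)

text \<open>A single frame describes the measure on \<open>E\<close> by its first coordinates, the
  projection onto \<open>E\<close>, and by the remaining coordinates the complement.\<close>

lemma subspace_lborel_frame:
  fixes E :: "(real^'n::finite) set"
  assumes "subspace E"
  obtains u where "orthonormal_frame u" "matrix (closest_point E) = frame_proj (dim E) u"
    "dim E \<le> CARD('n)"
    "subspace_lborel E = distr (Pi\<^sub>M {..<dim E} (\<lambda>_. lborel)) borel (\<lambda>c. \<Sum>i<dim E. c i *\<^sub>R u i)"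
proof -
  let ?R = "\<lambda>B. pairwise orthogonal B \<and> (\<forall>b\<in>B. norm b = 1) \<and> span B = E"
  obtain B0 where "pairwise orthogonal B0" "\<And>x. x \<in> B0 \<Longrightarrow> norm x = 1" "span B0 = E"
    using orthonormal_basis_subspace[OF assms] by metis
  then have "?R B0" by blast
  then have R: "?R (SOME B. ?R B)" by (rule someI)
  define B where "B = (SOME B. ?R B)"
  have B: "pairwise orthogonal B" "\<forall>b\<in>B. norm b = 1" "span B = E" using R by (simp_all add: B_def)
  obtain u where u: "orthonormal_frame u" "bij_betw u {..<card B} B" "card B = dim (span B)"
    "card B \<le> CARD('n)" using orthonormal_set_frame[OF B(1,2)] by blast
  let ?j = "dim E"
  have uB: "u ` {..<?j} = B" "inj_on u {..<?j}" using u B(3) by (simp_all add: bij_betw_def)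
  have "subspace_lborel E = distr (Pi\<^sub>M B (\<lambda>_. lborel)) borel (\<lambda>c. \<Sum>b\<in>B. c b *\<^sub>R b)"
    unfolding subspace_lborel_def Let_def B_def ..
  also have "\<dots> = distr (Pi\<^sub>M {..<?j} (\<lambda>_. lborel)) borel (\<lambda>c. \<Sum>i<?j. c i *\<^sub>R u i)"
    using distr_frame_sum[OF uB(2)] uB(1) by simp
  finally show ?thesis
    using that[OF u(1)] frame_proj_closest_point[OF u(1), of ?j] u(3,4) B(3) uB(1) by simp
qed

text \<open>Integrating against a Gaussian on the orthogonal complement replaces an integral over a
  varying subspace by one over the whole space, which no longer involves a choice of basis.\<close>

lemma nn_integral_subspace_lborel:
  fixes E :: "(real^'n::finite) set" and h :: "real^'n \<Rightarrow> ennreal"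
  assumes E: "subspace E" and [measurable]: "h \<in> borel_measurable borel"
  defines "P \<equiv> matrix (closest_point E)"
  shows "(\<integral>\<^sup>+y. h y \<partial>subspace_lborel E)
    = (\<integral>\<^sup>+x. h (P *v x) * ennreal (gauss_const ^ (CARD('n) - dim E) * exp (- (norm (x - P *v x))\<^sup>2 / 2)) \<partial>lborel)"
proof -
  let ?n = "CARD('n)" and ?j = "dim E"
  obtain u where u: "orthonormal_frame u" and P: "P = frame_proj ?j u" and jn: "?j \<le> ?n"
    and sl: "subspace_lborel E = distr (Pi\<^sub>M {..<?j} (\<lambda>_. lborel)) borel (\<lambda>c. \<Sum>i<?j. c i *\<^sub>R u i)"
    using subspace_lborel_frame[OF E] unfolding P_def by blast
  let ?x = "\<lambda>c. \<Sum>i<?n. c i *\<^sub>R u i" and ?y = "\<lambda>c. \<Sum>i<?j. c i *\<^sub>R u i"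
  let ?W = "\<lambda>c. \<Prod>i\<in>{?j..<?n}. ennreal (std_normal_density (c i))"
  interpret product_sigma_finite "\<lambda>_::nat. lborel :: real measure" ..
  have Px: "P *v ?x c = ?y c" for c
    unfolding P frame_proj_mult[OF jn]
    by (rule sum.cong) (use inner_frame_sum[OF u, of "{..<?n}" _ c] jn in auto)
  have split: "{..<?n} = {..<?j} \<union> {?j..<?n}" "{..<?j} \<inter> {?j..<?n} = {}" using jn by auto
  have "?x c - ?y c = (\<Sum>i\<in>{?j..<?n}. c i *\<^sub>R u i)" for c
    by (subst split(1), subst sum.union_disjoint) auto
  then have nrm: "(norm (?x c - P *v ?x c))\<^sup>2 = (\<Sum>i\<in>{?j..<?n}. (c i)\<^sup>2)" for c
    using norm_frame_sum[OF u, of "{?j..<?n}" c] by (simp add: Px subset_eq)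
  \<comment> \<open>The weight is the product of standard normal densities in the complement
    coordinates. Its total mass is 1, so it disappears once Fubini separates those
    coordinates.\<close>
  have W: "ennreal (gauss_const ^ (?n - ?j) * exp (- (norm (?x c - P *v ?x c))\<^sup>2 / 2)) = ?W c" for c
    unfolding nrm using prod_std_normal_density[of c "{?j..<?n}"] by (simp add: prod_ennreal)
  have mP [measurable]: "(\<lambda>x. P *v x) \<in> borel_measurable borel" by (rule matrix_vector_mult_borel)
  have [measurable]: "?W \<in> borel_measurable (Pi\<^sub>M {?j..<?n} (\<lambda>_. lborel))"
    by (rule borel_measurable_prod_ennreal) measurable
  have 1: "(\<integral>\<^sup>+c. ?W c \<partial>Pi\<^sub>M {?j..<?n} (\<lambda>_. lborel)) = 1"
  proof -
    interpret N: prob_space "density lborel std_normal_density"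
      by (rule prob_space_normal_density) simp
    have "(\<integral>\<^sup>+x. ennreal (std_normal_density x) \<partial>lborel) = 1"
      using N.emeasure_space_1 by (simp add: emeasure_density)
    then show ?thesis by (subst product_nn_integral_prod) auto
  qed
  have m2: "(\<lambda>c. h (?y c) * ?W c) \<in> borel_measurable (Pi\<^sub>M ({..<?j} \<union> {?j..<?n}) (\<lambda>_. lborel))"
  proof (rule borel_measurable_times_ennreal)
    have "?y \<in> borel_measurable (Pi\<^sub>M ({..<?j} \<union> {?j..<?n}) (\<lambda>_. lborel))"
      by (intro borel_measurable_sum borel_measurable_scaleR borel_measurable_const)
        (use measurable_component_singleton in force)
    then show "(\<lambda>c. h (?y c)) \<in> borel_measurable (Pi\<^sub>M ({..<?j} \<union> {?j..<?n}) (\<lambda>_. lborel))"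
      by measurable
    show "?W \<in> borel_measurable (Pi\<^sub>M ({..<?j} \<union> {?j..<?n}) (\<lambda>_. lborel))"
      by (rule borel_measurable_prod_ennreal) measurable
  qed
  have "(\<integral>\<^sup>+x. h (P *v x) * ennreal (gauss_const ^ (?n - ?j) * exp (- (norm (x - P *v x))\<^sup>2 / 2)) \<partial>lborel)
      = (\<integral>\<^sup>+c. h (P *v ?x c) * ennreal (gauss_const ^ (?n - ?j) * exp (- (norm (?x c - P *v ?x c))\<^sup>2 / 2))
          \<partial>Pi\<^sub>M {..<?n} (\<lambda>_. lborel))"
    by (subst lborel_frame[OF u], subst nn_integral_distr) measurable
  also have "\<dots> = (\<integral>\<^sup>+c. h (?y c) * ?W c \<partial>Pi\<^sub>M {..<?n} (\<lambda>_. lborel))"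
    by (intro nn_integral_cong) (subst W, subst Px, rule refl)
  also have "\<dots> = (\<integral>\<^sup>+c. \<integral>\<^sup>+c'. h (?y (merge {..<?j} {?j..<?n} (c, c'))) * ?W (merge {..<?j} {?j..<?n} (c, c'))
      \<partial>Pi\<^sub>M {?j..<?n} (\<lambda>_. lborel) \<partial>Pi\<^sub>M {..<?j} (\<lambda>_. lborel))"
    unfolding split(1) by (rule product_nn_integral_fold[OF split(2)]) (use m2 in auto)
  also have "\<dots> = (\<integral>\<^sup>+c. \<integral>\<^sup>+c'. h (?y c) * ?W c'
      \<partial>Pi\<^sub>M {?j..<?n} (\<lambda>_. lborel) \<partial>Pi\<^sub>M {..<?j} (\<lambda>_. lborel))"
    by (intro nn_integral_cong arg_cong2[where f="(*)"] arg_cong[where f=h] sum.cong prod.cong)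
      (auto simp: merge_def)
  also have "\<dots> = (\<integral>\<^sup>+c. h (?y c) \<partial>Pi\<^sub>M {..<?j} (\<lambda>_. lborel))"
    by (simp add: nn_integral_cmult 1)
  also have "\<dots> = (\<integral>\<^sup>+y. h y \<partial>subspace_lborel E)"
    unfolding sl by (subst nn_integral_distr) auto
  finally show ?thesis ..
qed

section \<open>The projected integral as a function of the projection matrix\<close>

lemma subspace_proj_facts:
  fixes E :: "(real^'n::finite) set"
  assumes E: "subspace E"
  defines "P \<equiv> matrix (closest_point E)"
  shows "P *v x \<in> E" "x - P *v x \<in> E\<^sup>\<bottom>" "P *v (P *v x) = P *v x" "z \<in> E\<^sup>\<bottom> \<Longrightarrow> P *v z = 0"
    "(P *v x) \<bullet> (z - P *v z) = 0"
    "norm (P *v x) \<le> norm x" "norm (x - P *v x) \<le> norm x"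
    "(norm (P *v x + (z - P *v z)))\<^sup>2 = (norm (P *v x))\<^sup>2 + (norm (z - P *v z))\<^sup>2"
proof -
  have Pv: "P *v x = closest_point E x" for x unfolding P_def by (rule matrix_closest_point_mul[OF E])
  note c = closest_point_subspace[OF E]
  show 1: "P *v x \<in> E" for x unfolding Pv by (rule c)
  show "x - P *v x \<in> E\<^sup>\<bottom>" for x
    unfolding Pv orthogonal_comp_def orthogonal_def using c(2)[of _ x] by (simp add: inner_commute)
  show PP: "P *v (P *v x) = P *v x" for x unfolding Pv using closest_point_refl[OF closed_subspace[OF E]] c(1) by auto
  show "P *v z = 0" if "z \<in> E\<^sup>\<bottom>" for z
    unfolding Pv using that subspace_0[OF E]
    by (intro closest_point_subspace_eqI[OF E]) (auto simp: orthogonal_comp_def orthogonal_def inner_commute)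
  show o: "(P *v x) \<bullet> (z - P *v z) = 0" for x z
    using c(2)[OF 1[of x], of z] unfolding Pv by (simp add: inner_commute)
  show py: "(norm (P *v x + (z - P *v z)))\<^sup>2 = (norm (P *v x))\<^sup>2 + (norm (z - P *v z))\<^sup>2" for x z
    using o[of x z] by (simp add: power2_norm_eq_inner inner_add_left inner_add_right inner_commute)
  have "(norm x)\<^sup>2 = (norm (P *v x))\<^sup>2 + (norm (x - P *v x))\<^sup>2" using py[of x x] by simp
  then have "(norm (P *v x))\<^sup>2 \<le> (norm x)\<^sup>2" "(norm (x - P *v x))\<^sup>2 \<le> (norm x)\<^sup>2"
    using zero_le_power2[of "norm (P *v x)"] zero_le_power2[of "norm (x - P *v x)"] by linarith+
  then show "norm (P *v x) \<le> norm x" "norm (x - P *v x) \<le> norm x"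
    using power2_le_imp_le norm_ge_zero by blast+
qed

text \<open>Here \<open>z\<close> ranges over the whole space and \<open>z - P *v z\<close> over the
  complement. The index set no longer depends on the subspace, and the formula makes sense for every
  matrix, so joint measurability in \<open>P\<close> and \<open>x\<close> can be stated.\<close>

definition proj_inf :: "(real^'n::finite \<Rightarrow> real) \<Rightarrow> real^'n^'n \<Rightarrow> real^'n \<Rightarrow> real" where
  "proj_inf f P x = (INF z. f (P *v x + (z - P *v z)))"

lemma proj_fun_eq_proj_inf:
  assumes E: "subspace E" and P: "P = matrix (closest_point E)"
  shows "proj_fun E f (P *v x) = proj_inf f P x"
proof -
  have "E\<^sup>\<bottom> = range (\<lambda>z. z - P *v z)"
  proof safe
    fix z assume "z \<in> E\<^sup>\<bottom>"
    then have "z = z - P *v z" using subspace_proj_facts(4)[OF E] P by simp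
    then show "z \<in> range (\<lambda>z. z - P *v z)" by (rule range_eqI)
  next
    fix z show "z - P *v z \<in> E\<^sup>\<bottom>" unfolding P by (rule subspace_proj_facts(2)[OF E])
  qed
  then show ?thesis by (simp add: proj_fun_def proj_inf_def image_image)
qed

lemma inf_nonneg_less_iff:
  fixes g :: "'a \<Rightarrow> real"
  assumes "\<And>z. g z \<ge> 0" "A \<noteq> {}"
  shows "(INF z\<in>A. g z) < a \<longleftrightarrow> (\<exists>z\<in>A. g z < a)"
  by (rule cINF_less_iff) (use assms in \<open>auto intro!: bdd_belowI[of _ 0]\<close>)

text \<open>An infimum of continuous functions is upper semicontinuous: its strict sublevel sets are
  unions of open sets, and such unions may be uncountable.\<close>

lemma proj_fun_borel:
  fixes f :: "real^'n::finite \<Rightarrow> real"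
  assumes "continuous_on UNIV f" "\<And>x. f x \<ge> 0"
  shows "proj_fun E f \<in> borel_measurable borel"
proof (subst borel_measurable_iff_less, rule allI)
  fix a
  have "0 \<in> E\<^sup>\<bottom>" by (simp add: orthogonal_comp_def orthogonal_def)
  then have "{y \<in> space borel. proj_fun E f y < a} = (\<Union>z\<in>E\<^sup>\<bottom>. {y. f (y + z) < a})"
    unfolding proj_fun_def using assms(2) by (subst inf_nonneg_less_iff) auto
  moreover have "open (\<Union>z\<in>E\<^sup>\<bottom>. {y. f (y + z) < a})"
    by (intro open_UN ballI open_Collect_less continuous_on_const continuous_on_compose2[OF assms(1)] continuous_intros) auto
  ultimately show "{y \<in> space borel. proj_fun E f y < a} \<in> sets borel"
    by (simp only: borel_open)
qed

lemma continuous_matrix_vector_mult [continuous_intros]: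
  fixes A :: "'a::topological_space \<Rightarrow> real^'n::finite^'m::finite"
  assumes "continuous_on S A" "continuous_on S v"
  shows "continuous_on S (\<lambda>q. A q *v v q)"
  unfolding matrix_vector_mult_def
  by (intro continuous_on_vec_lambda continuous_on_sum continuous_on_mult continuous_on_component assms)

lemma continuous_matrix_matrix_mult [continuous_intros]:
  fixes A :: "'a::topological_space \<Rightarrow> real^'n::finite^'m::finite" and B :: "'a \<Rightarrow> real^'k::finite^'n"
  assumes "continuous_on S A" "continuous_on S B"
  shows "continuous_on S (\<lambda>q. A q ** B q)"
  unfolding matrix_matrix_mult_def
  by (intro continuous_on_vec_lambda continuous_on_sum continuous_on_mult continuous_on_component assms)

text \<open>Upper semicontinuity again, now jointly in the matrix and the point.\<close>

lemma proj_inf_borel: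
  fixes f :: "real^'n::finite \<Rightarrow> real"
  assumes "continuous_on UNIV f" "\<And>x. f x \<ge> 0"
  shows "(\<lambda>q. proj_inf f (fst q) (snd q)) \<in> borel_measurable borel"
proof (subst borel_measurable_iff_less, rule allI)
  fix a
  have "{q \<in> space borel. proj_inf f (fst q) (snd q) < a}
      = (\<Union>z. {q. f (fst q *v snd q + (z - fst q *v z)) < a})"
    unfolding proj_inf_def using assms(2) by (subst inf_nonneg_less_iff) auto
  moreover have "open (\<Union>z. {q. f (fst q *v snd q + (z - fst q *v z)) < a})"
    by (intro open_UN ballI open_Collect_less continuous_on_const continuous_on_compose2[OF assms(1)] continuous_intros) auto
  ultimately show "{q \<in> space borel. proj_inf f (fst q) (snd q) < a} \<in> sets borel"
    by (simp only: borel_open)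
qed

text \<open>The inner integral of \<open>intrinsic_V\<close> in its Gaussian form. Being an integral
  over a fixed space with jointly measurable integrand, it is Borel in \<open>P\<close>.\<close>

definition proj_integral :: "nat \<Rightarrow> (real^'n::finite \<Rightarrow> real) \<Rightarrow> real^'n^'n \<Rightarrow> ennreal" where
  "proj_integral j f P = (\<integral>\<^sup>+x. ennreal (exp (- proj_inf f P x)) *
     ennreal (gauss_const ^ (CARD('n) - j) * exp (- (norm (x - P *v x))\<^sup>2 / 2)) \<partial>lborel)"

lemma proj_integral_borel [measurable]:
  fixes f :: "real^'n::finite \<Rightarrow> real"
  assumes "continuous_on UNIV f" "\<And>x. f x \<ge> 0"
  shows "proj_integral j f \<in> borel_measurable borel"
  unfolding proj_integral_def
proof (rule lborel.borel_measurable_nn_integral)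
  have [measurable]: "(\<lambda>q. proj_inf f (fst q) (snd q)) \<in> borel_measurable borel"
    by (rule proj_inf_borel[OF assms])
  have [measurable]: "(\<lambda>q :: (real^'n^'n) \<times> (real^'n). norm (snd q - fst q *v snd q)) \<in> borel_measurable borel"
    by (intro borel_measurable_continuous_onI continuous_intros)
  have m: "(\<lambda>q. ennreal (exp (- proj_inf f (fst q) (snd q))) *
     ennreal (gauss_const ^ (CARD('n) - j) * exp (- (norm (snd q - fst q *v snd q))\<^sup>2 / 2)))
     \<in> borel_measurable borel" by measurable
  have s: "sets (borel \<Otimes>\<^sub>M lborel) = sets (borel :: ((real^'n^'n) \<times> (real^'n)) measure)"
    unfolding borel_prod[symmetric] by (rule sets_pair_measure_cong) simp_all
  show "(\<lambda>(P, x). ennreal (exp (- proj_inf f P x)) *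
     ennreal (gauss_const ^ (CARD('n) - j) * exp (- (norm (x - P *v x))\<^sup>2 / 2)))
     \<in> borel_measurable (borel \<Otimes>\<^sub>M lborel)"
    unfolding split_beta' measurable_cong_sets[OF s refl] by (rule m)
qed

text \<open>If the integral diverges, both sides take the default value 0;
  \<open>proj_integral_bounded\<close> excludes this case later.\<close>

lemma proj_integral_eq:
  fixes f :: "real^'n::finite \<Rightarrow> real"
  assumes "continuous_on UNIV f" "\<And>x. f x \<ge> 0" and E: "subspace E" "dim E = j"
  shows "(LINT y|subspace_lborel E. exp (- proj_fun E f y)) = enn2real (proj_integral j f (matrix (closest_point E)))"
proof -
  note [measurable] = proj_fun_borel[OF assms(1,2), of E]
  have s: "sets (subspace_lborel E) = sets borel" by (simp add: subspace_lborel_def Let_def)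
  have "(\<lambda>y. exp (- proj_fun E f y)) \<in> borel_measurable borel" by measurable
  then have "(LINT y|subspace_lborel E. exp (- proj_fun E f y))
      = enn2real (\<integral>\<^sup>+y. ennreal (exp (- proj_fun E f y)) \<partial>subspace_lborel E)"
    by (intro integral_eq_nn_integral) (simp_all cong: measurable_cong_sets add: s)
  also have "(\<integral>\<^sup>+y. ennreal (exp (- proj_fun E f y)) \<partial>subspace_lborel E)
      = proj_integral j f (matrix (closest_point E))"
    by (subst nn_integral_subspace_lborel[OF E(1)])
      (simp_all add: proj_integral_def E(2) proj_fun_eq_proj_inf[OF E(1) refl])
  finally show ?thesis .
qed

lemma nn_integral_gauss_finite:
  assumes "c > 0"
  shows "(\<integral>\<^sup>+x. ennreal (exp (- c * (norm x)\<^sup>2)) \<partial>(lborel :: (real^'n::finite) measure)) < \<infinity>"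
proof -
  \<comment> \<open>The deviation for which the normal density is proportional to
    \<open>exp (- c * s\<^sup>2)\<close>.\<close>
  define \<sigma> where "\<sigma> = 1 / sqrt (2 * c)"
  have \<sigma>: "\<sigma> > 0" "\<sigma>\<^sup>2 = 1 / (2 * c)" using assms by (simp_all add: \<sigma>_def power_divide)
  interpret N: prob_space "density lborel (normal_density 0 \<sigma>)"
    by (rule prob_space_normal_density) (rule \<sigma>)
  have 1: "(\<integral>\<^sup>+s. ennreal (normal_density 0 \<sigma> s) \<partial>lborel) = 1"
    using N.emeasure_space_1 by (simp add: emeasure_density)
  have "exp (- c * s\<^sup>2) = sqrt (2 * pi * \<sigma>\<^sup>2) * normal_density 0 \<sigma> s" for s
    using \<sigma> assms by (simp add: normal_density_def)
  then have "(\<integral>\<^sup>+s. ennreal (exp (- c * s\<^sup>2)) \<partial>lborel) = ennreal (sqrt (2 * pi * \<sigma>\<^sup>2))"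
    using 1 by (simp add: ennreal_mult nn_integral_cmult)
  then have fin: "(\<integral>\<^sup>+s. ennreal (exp (- c * s\<^sup>2)) \<partial>lborel) < \<infinity>" by simp
  have "(norm x)\<^sup>2 = (\<Sum>b\<in>Basis. (x \<bullet> b)\<^sup>2)" for x :: "real^'n"
    by (subst power2_norm_eq_inner, subst euclidean_inner) (simp add: power2_eq_square)
  then have "ennreal (exp (- c * (norm x)\<^sup>2)) = (\<Prod>b\<in>Basis. ennreal (exp (- c * (x \<bullet> b)\<^sup>2)))" for x :: "real^'n"
    by (simp add: prod_ennreal exp_sum sum_distrib_left flip: sum_negf)
  then have "(\<integral>\<^sup>+x. ennreal (exp (- c * (norm x)\<^sup>2)) \<partial>(lborel :: (real^'n) measure))
      = (\<Prod>b\<in>(Basis :: (real^'n) set). (\<integral>\<^sup>+s. ennreal (exp (- c * s\<^sup>2)) \<partial>lborel))"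
    using nn_integral_lborel_prod[of "\<lambda>(b :: real^'n) s. ennreal (exp (- c * s\<^sup>2))"] by simp
  also have "\<dots> < \<infinity>" using fin by (simp add: power_less_top_ennreal)
  finally show ?thesis .
qed

text \<open>Only finiteness uniformly in E matters here, so the bound may depend on
  \<open>f\<close>. Since d is at least 2, \<open>f\<close> dominates a multiple of the squared norm
  minus 1, and projecting does not increase norms. With \<open>c0\<close> at most 1/2, the Gaussian
  weight supplies the same decay in the complement, and together they give a Gaussian in the full
  norm.\<close>

lemma proj_integral_bounded:
  fixes f :: "real^'n::finite \<Rightarrow> real"
  assumes f: "f \<in> hom_convex_polys d" "d \<ge> 2"
  shows "\<exists>M<\<infinity>. \<forall>E. subspace E \<longrightarrow> proj_integral j f (matrix (closest_point E)) \<le> M"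
proof -
  obtain c where c: "c > 0" "\<And>x. c * norm x ^ d \<le> f x" using hom_lower[OF f] by blast
  define c0 where "c0 = min c (1/2)"
  have c0: "c0 > 0" "c0 \<le> c" "c0 \<le> 1/2" using c(1) by (auto simp: c0_def)
  let ?k = "gauss_const ^ (CARD('n) - j) * exp c0"
  let ?M = "ennreal ?k * (\<integral>\<^sup>+x. ennreal (exp (- c0 * (norm x)\<^sup>2)) \<partial>(lborel :: (real^'n) measure))"
  have k: "?k \<ge> 0" using gauss_const_pos by (simp add: less_imp_le)
  have "proj_integral j f P \<le> ?M" if E: "subspace E" and P: "P = matrix (closest_point E)" for E P
  proof -
    note pf = subspace_proj_facts[OF E, folded P]
    have sq: "s\<^sup>2 - 1 \<le> s ^ d" if "s \<ge> 0" for s :: real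
    proof (cases "s \<ge> 1")
      case True
      then have "s\<^sup>2 \<le> s ^ d" using f(2) by (intro power_increasing) auto
      then show ?thesis by simp
    next
      case False
      then have "s\<^sup>2 \<le> 1" using that by (intro power_le_one) auto
      moreover have "s ^ d \<ge> 0" using that by simp
      ultimately show ?thesis by linarith
    qed
    have "c0 * (norm (P *v x))\<^sup>2 - c0 \<le> proj_inf f P x" for x
      unfolding proj_inf_def
    proof (rule cINF_greatest)
      fix z
      have "norm (P *v x) \<le> norm (P *v x + (z - P *v z))"
        by (rule power2_le_imp_le) (simp_all add: pf(8))
      then have "norm (P *v x) ^ d \<le> norm (P *v x + (z - P *v z)) ^ d" by (intro power_mono) auto
      with sq[of "norm (P *v x)"] have "(norm (P *v x))\<^sup>2 - 1 \<le> norm (P *v x + (z - P *v z)) ^ d" by simp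
      then have "c0 * ((norm (P *v x))\<^sup>2 - 1) \<le> c0 * norm (P *v x + (z - P *v z)) ^ d"
        using c0(1) by simp
      also have "\<dots> \<le> c * norm (P *v x + (z - P *v z)) ^ d" using c0 by (intro mult_right_mono) auto
      also have "\<dots> \<le> f (P *v x + (z - P *v z))" by (rule c)
      finally show "c0 * (norm (P *v x))\<^sup>2 - c0 \<le> f (P *v x + (z - P *v z))"
        by (simp add: right_diff_distrib)
    qed simp
    moreover have "c0 * (norm (x - P *v x))\<^sup>2 \<le> (norm (x - P *v x))\<^sup>2 / 2" for x
      using mult_right_mono[OF c0(3), of "(norm (x - P *v x))\<^sup>2"] by simp
    moreover have "c0 * (norm x)\<^sup>2 = c0 * (norm (P *v x))\<^sup>2 + c0 * (norm (x - P *v x))\<^sup>2" for x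
      using pf(8)[of x x] by (simp flip: distrib_left)
    ultimately have e: "- proj_inf f P x - (norm (x - P *v x))\<^sup>2 / 2 \<le> c0 - c0 * (norm x)\<^sup>2" for x
      by (smt (verit))
    have pw: "ennreal (exp (- proj_inf f P x)) *
        ennreal (gauss_const ^ (CARD('n) - j) * exp (- (norm (x - P *v x))\<^sup>2 / 2))
      \<le> ennreal ?k * ennreal (exp (- c0 * (norm x)\<^sup>2))" for x
    proof -
      have "exp (- proj_inf f P x) * (gauss_const ^ (CARD('n) - j) * exp (- (norm (x - P *v x))\<^sup>2 / 2))
          = gauss_const ^ (CARD('n) - j) * exp (- proj_inf f P x - (norm (x - P *v x))\<^sup>2 / 2)"
        by (simp add: mult.left_commute flip: exp_add)
      also have "\<dots> \<le> gauss_const ^ (CARD('n) - j) * exp (c0 - c0 * (norm x)\<^sup>2)"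
        using e gauss_const_pos by (intro mult_left_mono) auto
      also have "\<dots> = ?k * exp (- c0 * (norm x)\<^sup>2)"
        by (simp add: mult.assoc flip: exp_add)
      finally show ?thesis using k by (simp add: ennreal_leI flip: ennreal_mult')
    qed
    have "proj_integral j f P \<le> (\<integral>\<^sup>+x. ennreal ?k * ennreal (exp (- c0 * (norm x)\<^sup>2)) \<partial>(lborel :: (real^'n) measure))"
      unfolding proj_integral_def by (rule nn_integral_mono) (rule pw)
    also have "\<dots> = ?M" by (rule nn_integral_cmult) measurable
    finally show ?thesis .
  qed
  moreover have "?M < \<infinity>" using nn_integral_gauss_finite[OF c0(1), where 'n='n]
    by (simp add: ennreal_mult_less_top)
  ultimately show ?thesis by blast
qed

subsection \<open>Neighbourhoods in the Grassmannian\<close>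

lemma nn_integral_lborel_translate:
  fixes g :: "'a::euclidean_space \<Rightarrow> ennreal"
  assumes [measurable]: "g \<in> borel_measurable borel"
  shows "(\<integral>\<^sup>+x. g (c + x) \<partial>lborel) = (\<integral>\<^sup>+x. g x \<partial>lborel)"
  by (subst (2) lborel_distr_plus[of c, symmetric]) (simp add: nn_integral_distr)

text \<open>The pushforward of Lebesgue measure under a linear bijection is translation invariant; Fubini
  applied to \<open>indicator A x * indicator B (x - M y)\<close> shows that it is a multiple of Lebesgue measure.\<close>

lemma emeasure_linear_vimage:
  fixes M L :: "real^'n::finite \<Rightarrow> real^'n"
  assumes M: "linear M" and LM: "\<And>x. M (L x) = x" and A [measurable]: "A \<in> sets borel"
  shows "emeasure lborel (cball 0 1 :: (real^'n) set) * emeasure lborel (M -` A)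
    = emeasure lborel (M -` cball 0 1) * emeasure lborel A"
proof -
  have mM [measurable]: "M \<in> borel_measurable borel"
    by (intro borel_measurable_continuous_onI linear_continuous_on) (simp add: M linear_conv_bounded_linear[symmetric])
  let ?B = "cball 0 1 :: (real^'n) set"
  let ?b = "indicator ?B :: real^'n \<Rightarrow> ennreal"
  have [measurable]: "?B \<in> sets borel" by simp
  have vB [measurable]: "M -` ?B \<in> sets borel" by (rule measurable_sets_borel[OF mM]) simp
  have vA [measurable]: "M -` A \<in> sets borel" by (rule measurable_sets_borel[OF mM A])
  have 1: "(\<integral>\<^sup>+y. ?b (x - M y) \<partial>lborel) = emeasure lborel (M -` ?B)" for x
  proof -
    have "x - M y = - M (- L x + y)" for y using LM[of x] by (simp add: linear_diff[OF M])
    then have "?b (x - M y) = indicator (M -` ?B) (- L x + y)" for y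
      by (auto simp: indicator_def)
    then have "(\<integral>\<^sup>+y. ?b (x - M y) \<partial>lborel) = (\<integral>\<^sup>+y. indicator (M -` ?B) (- L x + y) \<partial>lborel)" by simp
    also have "\<dots> = (\<integral>\<^sup>+y. indicator (M -` ?B) y \<partial>lborel)"
      by (rule nn_integral_lborel_translate) measurable
    finally show ?thesis by simp
  qed
  have 2: "(\<integral>\<^sup>+y. indicator A (M y + x) \<partial>lborel) = emeasure lborel (M -` A)" for x
  proof -
    have "M y + x = M (L x + y)" for y using LM[of x] by (simp add: linear_add[OF M])
    then have "indicator A (M y + x) = (indicator (M -` A) (L x + y) :: ennreal)" for y
      by (auto simp: indicator_def)
    then have "(\<integral>\<^sup>+y. indicator A (M y + x) \<partial>lborel) = (\<integral>\<^sup>+y. indicator (M -` A) (L x + y) \<partial>lborel)" by simp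
    also have "\<dots> = (\<integral>\<^sup>+y. indicator (M -` A) y \<partial>lborel)"
      by (rule nn_integral_lborel_translate) measurable
    finally show ?thesis by simp
  qed
  have "emeasure lborel (M -` ?B) * emeasure lborel A
      = (\<integral>\<^sup>+x. indicator A x * (\<integral>\<^sup>+y. ?b (x - M y) \<partial>lborel) \<partial>lborel)"
    by (simp add: 1 nn_integral_multc mult.commute)
  also have "\<dots> = (\<integral>\<^sup>+x. \<integral>\<^sup>+y. indicator A x * ?b (x - M y) \<partial>lborel \<partial>lborel)"
    by (simp add: nn_integral_cmult)
  also have "\<dots> = (\<integral>\<^sup>+y. \<integral>\<^sup>+x. indicator A x * ?b (x - M y) \<partial>lborel \<partial>lborel)"
    by (rule lborel_pair.Fubini') measurable
  also have "\<dots> = (\<integral>\<^sup>+y. \<integral>\<^sup>+x. indicator A (M y + x) * ?b x \<partial>lborel \<partial>lborel)"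
  proof (rule nn_integral_cong)
    fix y :: "real^'n"
    show "(\<integral>\<^sup>+x. indicator A x * ?b (x - M y) \<partial>lborel)
        = (\<integral>\<^sup>+x. indicator A (M y + x) * ?b x \<partial>lborel)"
      by (subst nn_integral_lborel_translate[of "\<lambda>x. indicator A x * ?b (x - M y)" "M y", symmetric]) simp_all
  qed
  also have "\<dots> = (\<integral>\<^sup>+x. \<integral>\<^sup>+y. indicator A (M y + x) * ?b x \<partial>lborel \<partial>lborel)"
    by (rule lborel_pair.Fubini') measurable
  also have "\<dots> = (\<integral>\<^sup>+x. emeasure lborel (M -` A) * ?b x \<partial>lborel)"
    by (simp add: nn_integral_multc 2)
  also have "\<dots> = emeasure lborel (M -` A) * emeasure lborel ?B"
    by (subst nn_integral_cmult) simp_all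
  finally show ?thesis by (simp add: mult.commute)
qed

text \<open>A map this close to the identity shrinks norms by at most a factor 2. Hence it is
  invertible, and the image of the unit ball contains the ball of radius 1/2, which fixes the volume
  factor.\<close>

lemma emeasure_linear_image_ge:
  fixes T :: "real^'n::finite \<Rightarrow> real^'n"
  assumes T: "linear T" "\<And>x. norm (T x - x) \<le> norm x / 2" and A: "compact A"
  shows "ennreal ((1/2) ^ CARD('n)) * emeasure lborel A \<le> emeasure lborel (T ` A)"
proof -
  have ge: "norm x / 2 \<le> norm (T x)" for x
    using T(2)[of x] norm_triangle_ineq2[of x "T x"] by (simp add: norm_minus_commute)
  have "inj T" unfolding linear_injective_0[OF T(1)] using ge by (metis divide_le_0_iff norm_le_zero_iff
        norm_zero not_numeral_le_zero)
  then obtain M where M: "linear M" "\<And>x. M (T x) = x" "\<And>x. T (M x) = x"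
    using linear_injective_isomorphism[OF T(1)] by blast
  let ?B = "cball 0 1 :: (real^'n) set"
  have TA: "T ` A = M -` A" using M(2,3) by (auto simp: image_iff) metis
  have "cball 0 (1/2) \<subseteq> M -` ?B"
  proof
    fix y :: "real^'n" assume "y \<in> cball 0 (1/2)"
    then show "y \<in> M -` ?B" using ge[of "M y"] by (simp add: M(3))
  qed
  moreover have "M -` ?B \<in> sets borel"
  proof (rule measurable_sets_borel)
    show "M \<in> borel_measurable borel"
      by (intro borel_measurable_continuous_onI linear_continuous_on) (simp add: M(1) linear_conv_bounded_linear[symmetric])
  qed simp
  ultimately have "emeasure lborel (cball 0 (1/2) :: (real^'n) set) \<le> emeasure lborel (M -` ?B)"
    by (intro emeasure_mono) auto
  moreover have "emeasure lborel (cball 0 (1/2) :: (real^'n) set) = ennreal ((1/2) ^ CARD('n)) * emeasure lborel ?B"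
    by (simp add: emeasure_cball mult.commute flip: ennreal_mult')
  ultimately have "ennreal ((1/2) ^ CARD('n)) * emeasure lborel ?B * emeasure lborel A
      \<le> emeasure lborel (M -` ?B) * emeasure lborel A"
    by (intro mult_right_mono) auto
  also have "\<dots> = emeasure lborel ?B * emeasure lborel (T ` A)"
    unfolding TA by (rule emeasure_linear_vimage[OF M(1) M(2), symmetric]) (use A in \<open>simp add: borel_compact\<close>)
  finally have "emeasure lborel ?B * (ennreal ((1/2) ^ CARD('n)) * emeasure lborel A)
      \<le> emeasure lborel ?B * emeasure lborel (T ` A)"
    by (simp add: mult_ac)
  then show ?thesis
    using emeasure_unit_cball[where 'n='n] by (subst (asm) ennreal_mult_le_mult_iff) auto
qed

text \<open>Operator norm distance at most 1/4. Two such errors add up to the deviation 1/2 from the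
  identity that \<open>emeasure_linear_image_ge\<close> allows.\<close>

definition near_proj :: "real^'n::finite^'n \<Rightarrow> real^'n^'n \<Rightarrow> bool" where
  "near_proj P F \<longleftrightarrow> (\<forall>x. norm (P *v x - F *v x) \<le> norm x / 4)"

text \<open>The map \<open>T\<close> sends a point \<open>y + w\<close>, with \<open>y\<close> in the span \<open>F\<close> of the first \<open>j\<close> axes and \<open>w\<close>
  orthogonal to \<open>F\<close>, to the sum of the projections of \<open>y\<close> to \<open>E\<close> and of \<open>w\<close> to the complement of
  \<open>E\<close>. On the image of a box under \<open>T\<close> the integrand is bounded below.\<close>

lemma proj_integral_lower:
  fixes f :: "real^'n::finite \<Rightarrow> real"
  assumes f: "f \<in> hom_convex_polys d" "d \<ge> 2" and box: "frame_box {x. f x \<le> 1} u r"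
    and j: "j \<le> CARD('n)" and E: "subspace E"
  defines "P \<equiv> matrix (closest_point E)" and "c \<equiv> gauss_const ^ (CARD('n) - j) * exp (- 1 - CARD('n) / 2) / CARD('n) ^ j"
  assumes near: "near_proj P (frame_proj j u)"
  shows "ennreal (c * (\<Prod>i<j. r i)) \<le> proj_integral j f P"
proof -
  let ?n = "CARD('n)"
  let ?F = "frame_proj j u"
  let ?T = "P ** ?F + (mat 1 - P) ** (mat 1 - ?F)"
  \<comment> \<open>Along the first \<open>j\<close> axes the half-sides are those of the inner box,
    so that the part of a point in F lies in K; along the others they are 1, within reach of the
    Gaussian weight.\<close>
  define a where "a = (\<lambda>i. if i < j then r i / ?n else 1)"
  define S where "S = {x. \<forall>i<?n. \<bar>u i \<bullet> x\<bar> \<le> a i}"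
  define A where "A = (*v) ?T ` S"
  have u: "orthonormal_frame u" and r: "\<And>i. i < ?n \<Longrightarrow> r i > 0"
    and inner: "\<And>x. (\<And>i. i < ?n \<Longrightarrow> \<bar>u i \<bullet> x\<bar> \<le> r i / ?n) \<Longrightarrow> f x \<le> 1"
    using box unfolding frame_box_def by auto
  note pf = subspace_proj_facts[OF E, folded P_def]
  note Fx = frame_proj_mult[OF j, of u]
  have a: "a i > 0" if "i < ?n" for i using r[OF that] by (simp add: a_def)
  note S = frame_box_emeasure[OF u, of a, folded S_def]
  have ePS: "emeasure lborel S = ennreal (\<Prod>i<?n. 2 * a i)" using S(2) a by (simp add: less_imp_le)
  have prod_a: "(\<Prod>i<?n. 2 * a i) = 2 ^ ?n / ?n ^ j * (\<Prod>i<j. r i)"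
  proof -
    have "(\<Prod>i<?n. a i) = (\<Prod>i<j. r i / ?n)"
      by (rule prod.mono_neutral_cong_right) (use j in \<open>auto simp: a_def\<close>)
    then show ?thesis by (simp add: prod.distrib prod_dividef)
  qed
  have uF: "u i \<bullet> (?F *v y) = (if i < j then u i \<bullet> y else 0)" if "i < ?n" for i y
    unfolding Fx using inner_frame_sum[OF u, of "{..<j}" i "\<lambda>i. u i \<bullet> y"] that j by auto
  have SF: "f (?F *v y) \<le> 1" if "y \<in> S" for y
  proof (rule inner)
    fix i assume i: "i < ?n"
    show "\<bar>u i \<bullet> (?F *v y)\<bar> \<le> r i / ?n"
      using that i r[OF i] unfolding uF[OF i] S_def a_def by (auto split: if_splits)
  qed
  have SW: "(norm (y - ?F *v y))\<^sup>2 \<le> ?n" if "y \<in> S" for y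
  proof -
    have "y - ?F *v y = (\<Sum>i<?n. (u i \<bullet> (y - ?F *v y)) *\<^sub>R u i)" by (rule frame_expansion[OF u])
    then have "(norm (y - ?F *v y))\<^sup>2 = (\<Sum>i<?n. (u i \<bullet> (y - ?F *v y))\<^sup>2)"
      using norm_frame_sum[OF u, of "{..<?n}" "\<lambda>i. u i \<bullet> (y - ?F *v y)"] by simp
    also have "\<dots> \<le> (\<Sum>i<?n. 1)"
    proof (rule sum_mono)
      fix i assume i: "i \<in> {..<?n}"
      have "\<bar>u i \<bullet> (y - ?F *v y)\<bar> \<le> 1"
        using that i uF[of i y] unfolding S_def a_def by (auto simp: inner_diff_right split: if_splits)
      then show "(u i \<bullet> (y - ?F *v y))\<^sup>2 \<le> 1" by (simp add: abs_square_le_1)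
    qed
    finally show ?thesis by simp
  qed
  have T: "?T *v y = P *v (?F *v y) + ((y - ?F *v y) - P *v (y - ?F *v y))" for y
    by (simp only: matrix_vector_mult_add_rdistrib matrix_vector_mult_diff_rdistrib matrix_vector_mul_lid
        flip: matrix_vector_mul_assoc)
  have PT: "P *v (?T *v y) = P *v (?F *v y)" for y
  proof -
    have "P *v (z - P *v z) = 0" for z using pf(2,4) by blast
    then show ?thesis unfolding T by (simp only: matrix_vector_right_distrib pf(3) add_0_right)
  qed
  let ?g = "gauss_const ^ (?n - j)"
  have lower: "ennreal (?g * exp (- 1 - ?n / 2)) * indicator A x
      \<le> ennreal (exp (- proj_inf f P x)) * ennreal (?g * exp (- (norm (x - P *v x))\<^sup>2 / 2))" for x
  proof (cases "x \<in> A")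
    case True
    then obtain y where y: "y \<in> S" "x = ?T *v y" by (auto simp: A_def)
    \<comment> \<open>The infimum is tested at \<open>z = ?F *v y\<close>: the projection of
      \<open>x\<close> is that of \<open>?F *v y\<close>, so the tested point is
      \<open>?F *v y\<close> itself, where \<open>f\<close> is at most 1.\<close>
    have "proj_inf f P x \<le> f (P *v x + (?F *v y - P *v (?F *v y)))"
      unfolding proj_inf_def
      by (rule cINF_lower) (auto intro!: bdd_belowI[of _ 0] hom_nonneg[OF f])
    also have "P *v x + (?F *v y - P *v (?F *v y)) = ?F *v y" using PT by (simp add: y(2))
    finally have 1: "proj_inf f P x \<le> 1" using SF[OF y(1)] by simp
    have "x - P *v x = (y - ?F *v y) - P *v (y - ?F *v y)" unfolding y(2) PT unfolding T by simp
    then have "norm (x - P *v x) \<le> norm (y - ?F *v y)" using pf(7)[of "y - ?F *v y"] by simp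
    then have "(norm (x - P *v x))\<^sup>2 \<le> (norm (y - ?F *v y))\<^sup>2" by (rule power_mono) simp
    then have 2: "(norm (x - P *v x))\<^sup>2 \<le> ?n" using SW[OF y(1)] by linarith
    have "?g * exp (- 1 - ?n / 2) \<le> ?g * exp (- proj_inf f P x + - (norm (x - P *v x))\<^sup>2 / 2)"
      using 1 2 gauss_const_pos by (intro mult_left_mono) auto
    also have "\<dots> = exp (- proj_inf f P x) * (?g * exp (- (norm (x - P *v x))\<^sup>2 / 2))"
      unfolding exp_add by simp
    finally show ?thesis using True by (simp add: ennreal_leI flip: ennreal_mult')
  qed simp
  have S_comp: "compact S"
  proof -
    have "closed S" unfolding S_def
      by (intro closed_Collect_all closed_Collect_imp open_Collect_const closed_Collect_le continuous_intros)
    moreover have "bounded S"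
    proof (rule boundedI)
      fix x assume x: "x \<in> S"
      have "norm x = norm (\<Sum>i<?n. (u i \<bullet> x) *\<^sub>R u i)" using frame_expansion[OF u, of x] by simp
      also have "\<dots> \<le> (\<Sum>i<?n. norm ((u i \<bullet> x) *\<^sub>R u i))" by (rule norm_sum)
      also have "\<dots> \<le> (\<Sum>i<?n. a i)"
        by (rule sum_mono) (use x orthonormal_upto_norm[OF u] in \<open>auto simp: S_def\<close>)
      finally show "norm x \<le> (\<Sum>i<?n. a i)" .
    qed
    ultimately show ?thesis by (simp add: compact_eq_bounded_closed)
  qed
  have A_comp: "compact A" unfolding A_def
    by (rule compact_continuous_image[OF _ S_comp]) (intro continuous_intros)
  have A_borel: "A \<in> sets borel" using A_comp by (simp add: borel_compact)
  have Tid: "norm (?T *v y - y) \<le> norm y / 2" for y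
  proof -
    have F: "?F = matrix (closest_point (span (u ` {..<j})))" by (rule frame_proj_closest_point[OF u j])
    note ff = subspace_proj_facts[OF subspace_span[of "u ` {..<j}"], folded F]
    \<comment> \<open>That is, T - 1 = P (F - P) + (P - F) F by idempotence of both projections;
      each summand has norm at most 1/4.\<close>
    have "?T *v y - y = P *v (?F *v y - P *v y) + (P *v (?F *v y) - ?F *v (?F *v y))"
      unfolding T ff(3) matrix_vector_mult_diff_distrib pf(3) by simp
    also have "norm \<dots> \<le> norm (P *v (?F *v y - P *v y)) + norm (P *v (?F *v y) - ?F *v (?F *v y))"
      by (rule norm_triangle_ineq)
    also have "norm (P *v (?F *v y - P *v y)) \<le> norm (P *v y - ?F *v y)"
      using pf(6)[of "?F *v y - P *v y"] by (simp add: norm_minus_commute)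
    also have "norm (P *v y - ?F *v y) \<le> norm y / 4" using near by (simp add: near_proj_def)
    also have "norm (P *v (?F *v y) - ?F *v (?F *v y)) \<le> norm (?F *v y) / 4" using near by (simp add: near_proj_def)
    also have "norm (?F *v y) / 4 \<le> norm y / 4" using ff(6)[of y] by simp
    finally show ?thesis by simp
  qed
  have "ennreal ((1/2) ^ ?n) * emeasure lborel S \<le> emeasure lborel A"
    unfolding A_def by (rule emeasure_linear_image_ge[OF matrix_vector_mul_linear Tid S_comp])
  moreover have "(\<Prod>i<j. r i) / ?n ^ j = (1/2) ^ ?n * (\<Prod>i<?n. 2 * a i)"
    unfolding prod_a by (simp add: power_divide)
  then have "ennreal ((\<Prod>i<j. r i) / ?n ^ j) = ennreal ((1/2) ^ ?n) * emeasure lborel S"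
    unfolding ePS by (subst ennreal_mult'[symmetric]) simp_all
  ultimately have mA: "ennreal ((\<Prod>i<j. r i) / ?n ^ j) \<le> emeasure lborel A" by simp
  have "ennreal (c * (\<Prod>i<j. r i)) = ennreal (?g * exp (- 1 - ?n / 2)) * ennreal ((\<Prod>i<j. r i) / ?n ^ j)"
    using gauss_const_pos r j by (subst ennreal_mult[symmetric]) (auto simp: c_def less_imp_le intro!: prod_nonneg divide_nonneg_nonneg)
  also have "\<dots> \<le> ennreal (?g * exp (- 1 - ?n / 2)) * emeasure lborel A"
    by (rule mult_left_mono[OF mA]) simp
  also have "\<dots> = (\<integral>\<^sup>+x. ennreal (?g * exp (- 1 - ?n / 2)) * indicator A x \<partial>lborel)"
    using A_borel by (simp add: nn_integral_cmult_indicator)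
  also have "\<dots> \<le> proj_integral j f P"
    unfolding proj_integral_def by (rule nn_integral_mono) (rule lower)
  finally show ?thesis .
qed

lemma closed_near_proj: "closed {P. near_proj P F}" for F :: "real^'n::finite^'n"
  unfolding near_proj_def by (intro closed_Collect_all closed_Collect_le continuous_intros)

lemma near_proj_sets [measurable]: "{P. near_proj P F} \<in> sets borel"
  by (rule borel_closed[OF closed_near_proj])

lemma near_proj_conjugate:
  fixes P F Q :: "real^'n::finite^'n"
  assumes Q: "orthogonal_matrix Q"
  shows "near_proj (Q ** P ** transpose Q) (Q ** F ** transpose Q) \<longleftrightarrow> near_proj P F"
proof -
  have nQ: "norm (Q *v x) = norm x" for x
    using Q by (simp add: orthogonal_transformation_matrix orthogonal_transformation_norm)
  have "norm ((Q ** P ** transpose Q) *v x - (Q ** F ** transpose Q) *v x)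
      = norm (P *v (transpose Q *v x) - F *v (transpose Q *v x))" for x
    by (simp only: nQ flip: matrix_vector_mul_assoc matrix_vector_mult_diff_distrib)
  moreover have "norm (transpose Q *v x) = norm x" for x
    using nQ[of "transpose Q *v x"] by (simp only: orthogonal_matrix_inner(3)[OF Q])
  ultimately have "near_proj (Q ** P ** transpose Q) (Q ** F ** transpose Q)
      \<longleftrightarrow> (\<forall>x. norm (P *v (transpose Q *v x) - F *v (transpose Q *v x)) \<le> norm (transpose Q *v x) / 4)"
    unfolding near_proj_def by simp
  also have "\<dots> \<longleftrightarrow> near_proj P F"
    unfolding near_proj_def by (metis orthogonal_matrix_inner(2)[OF Q])
  finally show ?thesis .
qed

text \<open>The sum of absolute entries dominates the operator norm. As a strict inequality between
  continuous functions of the entries it defines an open set, which the density argument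
  requires.\<close>

lemma near_projI:
  fixes P F :: "real^'n::finite^'n"
  assumes "(\<Sum>a\<in>UNIV. \<Sum>b\<in>UNIV. \<bar>(P - F) $ a $ b\<bar>) < 1/4"
  shows "near_proj P F"
  unfolding near_proj_def
proof
  fix x
  have "norm ((P - F) *v x) \<le> onorm ((*v) (P - F)) * norm x"
    by (rule onorm) (rule matrix_vector_mul_bounded_linear)
  also have "\<dots> \<le> 1/4 * norm x"
    using onorm_le_matrix_component_sum[of "P - F"] assms by (intro mult_right_mono) auto
  finally show "norm (P *v x - F *v x) \<le> norm x / 4" by (simp add: matrix_vector_mult_diff_rdistrib)
qed

lemma matrix_closest_point_rotate:
  fixes E :: "(real^'n::finite) set"
  assumes E: "subspace E" and Q: "orthogonal_matrix Q"
  shows "matrix (closest_point ((*v) Q ` E)) = Q ** matrix (closest_point E) ** transpose Q"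
proof -
  have sub: "subspace ((*v) Q ` E)" using E by (simp add: linear_subspace_image)
  have "matrix (closest_point ((*v) Q ` E)) *v x = (Q ** matrix (closest_point E) ** transpose Q) *v x" for x
    by (simp only: matrix_closest_point_mul[OF sub] closest_point_rotate[OF E Q]
        matrix_closest_point_mul[OF E] flip: matrix_vector_mul_assoc)
  then show ?thesis unfolding matrix_eq by blast
qed

section \<open>Probability that a random subspace is close to a given one\<close>

context
  fixes \<nu> :: "(real^'n::finite) set measure" and j :: nat
  assumes haar: "is_grassmannian_haar j \<nu>" and j: "j < CARD('n)"
begin

lemma haar_sets: "sets \<nu> = sets (grassmannian_borel j)"
  using haar by (simp add: is_grassmannian_haar_def)

lemma haar_space: "space \<nu> = grassmannian j"
  using sets_eq_imp_space_eq[OF haar_sets] by simp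

lemma haar_matrix_measurable [measurable]: "(\<lambda>E. matrix (closest_point E)) \<in> borel_measurable \<nu>"
  using matrix_measurable_grassmannian haar_sets by (simp cong: measurable_cong_sets)

lemma haar_nn_integral_rotate:
  fixes g :: "real^'n^'n \<Rightarrow> ennreal"
  assumes [measurable]: "g \<in> borel_measurable borel" and Q: "rotation_matrix Q"
  shows "(\<integral>\<^sup>+E. g (Q ** matrix (closest_point E) ** transpose Q) \<partial>\<nu>) = (\<integral>\<^sup>+E. g (matrix (closest_point E)) \<partial>\<nu>)"
proof -
  have oQ: "orthogonal_matrix Q" using Q by (simp add: rotation_matrix_def)
  have m: "(\<lambda>E. (*v) Q ` E) \<in> \<nu> \<rightarrow>\<^sub>M \<nu>"
    using rotate_measurable[OF oQ, of j] haar_sets by (simp cong: measurable_cong_sets)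
  have "(\<integral>\<^sup>+E. g (matrix (closest_point E)) \<partial>\<nu>)
      = (\<integral>\<^sup>+E. g (matrix (closest_point E)) \<partial>distr \<nu> \<nu> (\<lambda>E. (*v) Q ` E))"
    using haar Q by (simp add: is_grassmannian_haar_def)
  also have "\<dots> = (\<integral>\<^sup>+E. g (matrix (closest_point ((*v) Q ` E))) \<partial>\<nu>)"
    by (rule nn_integral_distr[OF m]) measurable
  also have "\<dots> = (\<integral>\<^sup>+E. g (Q ** matrix (closest_point E) ** transpose Q) \<partial>\<nu>)"
    by (rule nn_integral_cong)
      (simp add: haar_space grassmannian_def matrix_closest_point_rotate[OF _ oQ])
  finally show ?thesis ..
qed

text \<open>A rotation conjugates the coordinate projection into that of the frame, and conjugation
  preserves closeness. This is what makes the probability independent of the axes of K.\<close>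

lemma haar_near_proj_frame:
  assumes u: "orthonormal_frame u"
  shows "(\<integral>\<^sup>+E. indicator {P. near_proj P (frame_proj j u)} (matrix (closest_point E)) \<partial>\<nu>)
    = (\<integral>\<^sup>+E. indicator {P. near_proj P (coord_proj j)} (matrix (closest_point E)) \<partial>\<nu>)"
proof -
  obtain Q where Q: "rotation_matrix Q" "frame_proj j u = Q ** coord_proj j ** transpose Q"
    using frame_proj_rotation[OF u j] by blast
  have "orthogonal_matrix Q" using Q(1) by (simp add: rotation_matrix_def)
  then have "indicator {P. near_proj P (frame_proj j u)} (Q ** P ** transpose Q)
      = (indicator {P. near_proj P (coord_proj j)} P :: ennreal)" for P
    using near_proj_conjugate[of Q P "coord_proj j"] Q(2) by (simp add: indicator_def)
  then show ?thesis
    using haar_nn_integral_rotate[OF borel_measurable_indicator[OF near_proj_sets] Q(1), of "frame_proj j u"] by simp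
qed

text \<open>If the integral were zero, then almost every \<open>E\<close> would be such that no \<open>Q\<close> in a countable
  dense set of rotations brings \<open>E\<close> close to the coordinate subspace. But some rotation maps \<open>E\<close>
  onto it.\<close>

lemma haar_near_proj_pos:
  "(\<integral>\<^sup>+E. indicator {P. near_proj P (coord_proj j)} (matrix (closest_point E)) \<partial>\<nu>) > 0"
proof (rule ccontr)
  let ?F = "coord_proj j :: real^'n^'n"
  let ?N = "{P. near_proj P ?F}"
  assume "\<not> ?thesis"
  then have z: "(\<integral>\<^sup>+E. indicator ?N (matrix (closest_point E)) \<partial>\<nu>) = 0" by simp
  obtain R :: "(real^'n^'n) set" where R: "countable R" "R \<subseteq> Collect rotation_matrix" "Collect rotation_matrix \<subseteq> closure R"
    using separable[of "Collect rotation_matrix"] by blast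
  have "AE E in \<nu>. \<not> near_proj (Q ** matrix (closest_point E) ** transpose Q) ?F" if "Q \<in> R" for Q
  proof -
    have Q: "rotation_matrix Q" using that R(2) by auto
    have [measurable]: "(\<lambda>P. Q ** P ** transpose Q) \<in> borel_measurable borel"
      by (intro borel_measurable_continuous_onI continuous_intros)
    have "(\<integral>\<^sup>+E. indicator ?N (Q ** matrix (closest_point E) ** transpose Q) \<partial>\<nu>) = 0"
      using haar_nn_integral_rotate[OF borel_measurable_indicator[OF near_proj_sets] Q, of ?F] z by simp
    then have "AE E in \<nu>. indicator ?N (Q ** matrix (closest_point E) ** transpose Q) = (0::ennreal)"
      by (subst (asm) nn_integral_0_iff_AE) measurable
    then show ?thesis by (simp add: indicator_def)
  qed
  then have ae: "AE E in \<nu>. \<forall>Q\<in>R. \<not> near_proj (Q ** matrix (closest_point E) ** transpose Q) ?F"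
    by (simp add: AE_ball_countable[OF R(1)])
  interpret prob_space \<nu> using haar by (simp add: is_grassmannian_haar_def)
  \<comment> \<open>A measure of total mass 1 has a point at which an almost sure property
    holds.\<close>
  have "\<exists>E\<in>space \<nu>. \<forall>Q\<in>R. \<not> near_proj (Q ** matrix (closest_point E) ** transpose Q) ?F"
  proof (rule ccontr)
    assume no: "\<not> ?thesis"
    have "AE E in \<nu>. False" using ae AE_space by eventually_elim (use no in blast)
    then show False by simp
  qed
  then obtain E where E: "E \<in> space \<nu>"
    "\<forall>Q\<in>R. \<not> near_proj (Q ** matrix (closest_point E) ** transpose Q) ?F" by blast
  then have sE: "subspace E" "dim E = j" by (simp_all add: haar_space grassmannian_def)
  let ?P = "matrix (closest_point E)"
  obtain u where u: "orthonormal_frame u" "?P = frame_proj j u"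
    using subspace_frame[OF sE(1)] sE(2) by metis
  obtain Q where Q: "rotation_matrix Q" "frame_proj j u = Q ** coord_proj j ** transpose Q"
    using frame_proj_rotation[OF u(1) j] by blast
  have QQ: "transpose Q ** Q = mat 1" using Q(1) by (auto simp: rotation_matrix_def orthogonal_matrix_def)
  have "transpose Q ** ?P ** Q = (transpose Q ** Q) ** coord_proj j ** (transpose Q ** Q)"
    by (simp only: u(2) Q(2) matrix_mul_assoc)
  also have "\<dots> = coord_proj j" by (simp only: QQ matrix_mul_lid matrix_mul_rid)
  finally have PF: "transpose Q ** ?P ** Q = ?F" .
  \<comment> \<open>An open neighbourhood of \<open>transpose Q\<close>, which maps \<open>E\<close>
    exactly onto the coordinate subspace. It meets the dense set \<open>R\<close>, and any common
    element contradicts the choice of \<open>E\<close>.\<close>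
  define W where "W = {X :: real^'n^'n. (\<Sum>a\<in>UNIV. \<Sum>b\<in>UNIV. \<bar>(X ** ?P ** transpose X - ?F) $ a $ b\<bar>) < 1/4}"
  have "open W"
  proof -
    have "continuous_on UNIV (\<lambda>X :: real^'n^'n. transpose X)"
      unfolding transpose_def by (intro continuous_on_vec_lambda continuous_intros)
    then have "continuous_on UNIV (\<lambda>X :: real^'n^'n. X ** ?P ** transpose X - ?F)"
      by (intro continuous_on_diff continuous_on_const continuous_matrix_matrix_mult continuous_on_id)
    then show ?thesis unfolding W_def
      by (intro open_Collect_less continuous_on_const continuous_on_sum continuous_on_rabs continuous_on_component)
  qed
  moreover have "transpose Q \<in> W" by (simp add: W_def PF)
  moreover have "rotation_matrix (transpose Q)"
    using Q(1) by (simp add: rotation_matrix_def orthogonal_matrix_transpose)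
  then have "transpose Q \<in> closure R" using R(3) by auto
  ultimately obtain X where "X \<in> R" "X \<in> W" unfolding closure_iff_nhds_not_empty by blast
  then show False using near_projI[of "X ** ?P ** transpose X" ?F] E(2) by (simp add: W_def)
qed

end

subsection \<open>Intrinsic volumes\<close>

text \<open>Applied to 1 + j/d, which lies between 1 and 1 + n, so that the bound does not depend on
  d.\<close>

lemma Gamma_bounded:
  fixes b :: real
  obtains m where "m > 0" "\<And>x. 1 \<le> x \<Longrightarrow> x \<le> b \<Longrightarrow> 0 < Gamma x \<and> Gamma x \<le> m"
proof -
  have pos: "0 < Gamma x" if "1 \<le> x" for x :: real using that by (intro Gamma_real_pos) simp
  have "continuous_on {1..b} (Gamma :: real \<Rightarrow> real)"
  proof (rule continuous_on_Gamma)
    show "{1..b} \<inter> \<int>\<^sub>\<le>\<^sub>0 = {}" by (auto elim!: nonpos_Ints_cases)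
  qed
  then have "bounded (Gamma ` {1..b})" by (intro compact_imp_bounded compact_continuous_image) simp_all
  then obtain a where a: "\<forall>y\<in>Gamma ` {1..b}. norm y \<le> a" unfolding bounded_iff by blast
  have "Gamma x \<le> max a 1" if "1 \<le> x" "x \<le> b" for x
  proof -
    have "Gamma x \<in> Gamma ` {1..b}" using that by auto
    then show ?thesis using a by (force simp: abs_le_iff)
  qed
  then show ?thesis using that[of "max a 1"] pos by simp
qed

lemma kubota_coeff_pos: "j \<le> n \<Longrightarrow> kubota_coeff j n > 0"
  unfolding kubota_coeff_def by (intro mult_pos_pos divide_pos_pos unit_ball_vol_pos) auto

lemma intrinsic_V_nonneg:
  fixes f :: "real^'n::finite \<Rightarrow> real"
  assumes "j < CARD('n)"
  shows "intrinsic_V d j f \<ge> 0"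
proof -
  have "Gamma (1 + real j / real d) > 0" by (intro Gamma_real_pos add_pos_nonneg) auto
  moreover have "kubota_coeff j CARD('n) > 0" using assms by (intro kubota_coeff_pos) simp
  ultimately show ?thesis
    using assms unfolding intrinsic_V_def
    by (auto intro!: mult_nonneg_nonneg divide_nonneg_nonneg integral_nonneg less_imp_le)
qed

text \<open>The constant precedes \<open>d\<close>, \<open>f\<close> and the axes. It combines the
  pointwise bound for subspaces close to the first \<open>j\<close> axes, their probability, and the
  uniform bound on Gamma.\<close>

lemma intrinsic_V_lower:
  assumes j: "j < CARD('n::finite)"
  shows "\<exists>c>0. \<forall>d\<ge>2. \<forall>f \<in> (hom_convex_polys d :: (real^'n \<Rightarrow> real) set). \<forall>u r.
    frame_box {x. f x \<le> 1} u r \<longrightarrow> c * (\<Prod>i<j. r i) \<le> intrinsic_V d j f"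
proof (cases "j = 0")
  case True
  then show ?thesis by (intro exI[of _ 1]) (simp add: intrinsic_V_def)
next
  case False
  let ?n = "CARD('n)"
  let ?\<nu> = "grassmannian_haar j :: (real^'n) set measure"
  have haar: "is_grassmannian_haar j ?\<nu>" by (rule is_grassmannian_haar_grassmannian_haar) (use j in simp)
  let ?N = "\<lambda>F E. indicator {P. near_proj P F} (matrix (closest_point E)) :: ennreal"
  \<comment> \<open>A value strictly below the probability is finite, hence yields a positive real
    lower bound.\<close>
  obtain y where y: "0 < y" "y < (\<integral>\<^sup>+E. ?N (coord_proj j) E \<partial>?\<nu>)"
    using dense[OF haar_near_proj_pos[OF haar j]] by blast
  define \<delta> where "\<delta> = enn2real y"
  have "y < \<top>" using y(2) by (rule order_less_le_trans) simp
  then have \<delta>: "\<delta> > 0" "ennreal \<delta> < (\<integral>\<^sup>+E. ?N (coord_proj j) E \<partial>?\<nu>)"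
    using y by (simp_all add: \<delta>_def enn2real_positive_iff)
  obtain m where m: "m > 0" "\<And>x. 1 \<le> x \<Longrightarrow> x \<le> 1 + real ?n \<Longrightarrow> 0 < Gamma x \<and> Gamma x \<le> m"
    using Gamma_bounded by metis
  define c where "c = gauss_const ^ (?n - j) * exp (- 1 - ?n / 2) / ?n ^ j"
  have c: "c > 0" using gauss_const_pos by (simp add: c_def)
  let ?k = "kubota_coeff j ?n"
  have k: "?k > 0" using j by (intro kubota_coeff_pos) simp
  have "?k / m * (c * \<delta>) * (\<Prod>i<j. r i) \<le> intrinsic_V d j f"
    if d: "d \<ge> 2" and f: "f \<in> hom_convex_polys d" and box: "frame_box {x. f x \<le> 1} u r"
    for d and f :: "real^'n \<Rightarrow> real" and u r
  proof -
    note fc = hom_continuous[OF f d, of UNIV] and fn = hom_nonneg[OF f d]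
    have u: "orthonormal_frame u" and r: "\<And>i. i < ?n \<Longrightarrow> r i > 0"
      using box unfolding frame_box_def by auto
    define p where "p = (\<Prod>i<j. r i)"
    have p: "p \<ge> 0" unfolding p_def using r j by (intro prod_nonneg) (auto simp: less_imp_le)
    let ?G = "\<lambda>E. proj_integral j f (matrix (closest_point E))"
    have sub: "subspace E" "dim E = j" if "E \<in> space ?\<nu>" for E
      using that by (simp_all add: haar_space[OF haar j] grassmannian_def)
    have mG: "?G \<in> borel_measurable ?\<nu>"
      by (rule measurable_compose[OF haar_matrix_measurable[OF haar j] proj_integral_borel[OF fc fn]])
    obtain M where M: "M < \<infinity>" "\<And>E. subspace E \<Longrightarrow> ?G E \<le> M"
      using proj_integral_bounded[OF f d, of j] by blast
    interpret prob_space ?\<nu> using haar by (simp add: is_grassmannian_haar_def)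
    have fin: "?G E < \<infinity>" if "E \<in> space ?\<nu>" for E using M sub(1)[OF that] le_less_trans by blast
    have "(\<integral>\<^sup>+E. ?G E \<partial>?\<nu>) \<le> (\<integral>\<^sup>+E. M \<partial>?\<nu>)" by (intro nn_integral_mono M sub)
    also have "\<dots> = M" by (simp add: emeasure_space_1)
    finally have Gfin: "(\<integral>\<^sup>+E. ?G E \<partial>?\<nu>) < \<infinity>" using M(1) by simp
    have mN: "?N (frame_proj j u) \<in> borel_measurable ?\<nu>"
      by (rule measurable_compose[OF haar_matrix_measurable[OF haar j] borel_measurable_indicator[OF near_proj_sets]])
    have "ennreal (c * p) * ennreal \<delta> \<le> ennreal (c * p) * (\<integral>\<^sup>+E. ?N (frame_proj j u) E \<partial>?\<nu>)"
      using \<delta>(2) haar_near_proj_frame[OF haar j u] by (intro mult_left_mono) (auto simp: less_imp_le)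
    also have "\<dots> = (\<integral>\<^sup>+E. ennreal (c * p) * ?N (frame_proj j u) E \<partial>?\<nu>)"
      by (rule nn_integral_cmult[OF mN, symmetric])
    also have "\<dots> \<le> (\<integral>\<^sup>+E. ?G E \<partial>?\<nu>)"
    proof (rule nn_integral_mono)
      fix E assume E: "E \<in> space ?\<nu>"
      show "ennreal (c * p) * ?N (frame_proj j u) E \<le> ?G E"
        using proj_integral_lower[OF f d box less_imp_le[OF j] sub(1)[OF E]]
        by (auto simp: c_def p_def indicator_def)
    qed
    finally have "ennreal (c * p * \<delta>) \<le> (\<integral>\<^sup>+E. ?G E \<partial>?\<nu>)"
      using c p \<delta>(1) by (simp add: ennreal_mult less_imp_le)
    \<comment> \<open>Finiteness is essential: \<open>enn2real\<close> sends infinity to 0, which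
      would destroy the lower bound.\<close>
    from enn2real_mono[OF this] Gfin have low: "c * p * \<delta> \<le> enn2real (\<integral>\<^sup>+E. ?G E \<partial>?\<nu>)"
      using c p \<delta>(1) by simp
    have "(LINT E|?\<nu>. LINT y|subspace_lborel E. exp (- proj_fun E f y)) = (LINT E|?\<nu>. enn2real (?G E))"
      by (rule Bochner_Integration.integral_cong) (simp_all add: proj_integral_eq[OF fc fn] sub)
    also have "\<dots> = enn2real (\<integral>\<^sup>+E. ennreal (enn2real (?G E)) \<partial>?\<nu>)"
      by (rule integral_eq_nn_integral) (use mG in auto)
    also have "(\<integral>\<^sup>+E. ennreal (enn2real (?G E)) \<partial>?\<nu>) = (\<integral>\<^sup>+E. ?G E \<partial>?\<nu>)"
      by (rule nn_integral_cong) (use fin in simp)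
    finally have I: "c * p * \<delta> \<le> (LINT E|?\<nu>. LINT y|subspace_lborel E. exp (- proj_fun E f y))"
      using low by simp
    have "real j / real d \<le> real ?n"
      using d j by (simp add: divide_le_eq) (metis less_imp_le mult_le_mono nat_mult_1_right of_nat_le_iff of_nat_mult order_trans one_le_numeral)
    then have g: "0 < Gamma (1 + real j / real d)" "Gamma (1 + real j / real d) \<le> m"
      using m(2)[of "1 + real j / real d"] by auto
    have "?k / m * (c * \<delta>) * p = ?k / m * (c * p * \<delta>)" by simp
    also have "\<dots> \<le> ?k / Gamma (1 + real j / real d) * (c * p * \<delta>)"
      using g k c p \<delta>(1) by (intro mult_right_mono divide_left_mono) (auto simp: m)
    also have "\<dots> \<le> ?k / Gamma (1 + real j / real d) * (LINT E|?\<nu>. LINT y|subspace_lborel E. exp (- proj_fun E f y))"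
      using g(1) k I by (intro mult_left_mono) auto
    also have "\<dots> = intrinsic_V d j f" using False j by (simp add: intrinsic_V_def)
    finally show ?thesis unfolding p_def .
  qed
  then show ?thesis using k m(1) c \<delta>(1) by (intro exI[of _ "?k / m * (c * \<delta>)"]) auto
qed

lemma intrinsic_V_top:
  fixes f :: "real^'n::finite \<Rightarrow> real"
  assumes "f \<in> hom_convex_polys d" "d \<ge> 2"
  shows "intrinsic_V d CARD('n) f = measure lborel {x. f x \<le> 1}"
proof -
  have "Gamma (1 + real CARD('n) / real d) > 0" by (intro Gamma_real_pos add_pos_nonneg) auto
  then show ?thesis by (simp add: intrinsic_V_def integral_exp_hom[OF assms])
qed

lemma lattice_count_intrinsic:
  obtains C where "C > 0"
    "\<And>d (f :: real^'n::finite \<Rightarrow> real) \<alpha>. d \<ge> 2 \<Longrightarrow> even d \<Longrightarrow> f \<in> hom_convex_polys d \<Longrightarrow> \<alpha> > 0 \<Longrightarrow>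
      \<bar>real (lattice_count f \<alpha>) - intrinsic_V d CARD('n) f * \<alpha> powr (real CARD('n) / real d)\<bar>
      \<le> C * (\<Sum>j<CARD('n). intrinsic_V d j f * \<alpha> powr (real j / real d))"
proof -
  let ?n = "CARD('n)"
  obtain c where c: "\<And>j. j < ?n \<Longrightarrow> c j > 0"
    "\<And>j d (f :: real^'n \<Rightarrow> real) u r. j < ?n \<Longrightarrow> d \<ge> 2 \<Longrightarrow> f \<in> hom_convex_polys d \<Longrightarrow>
      frame_box {x. f x \<le> 1} u r \<Longrightarrow> c j * (\<Prod>i<j. r i) \<le> intrinsic_V d j f"
    using intrinsic_V_lower[where 'n='n] by metis
  \<comment> \<open>One constant that serves all \<open>j\<close> below the dimension.\<close>
  define b where "b = Max ((\<lambda>j. 1 / c j) ` {..<?n})"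
  have b: "1 / c j \<le> b" if "j < ?n" for j using that by (auto simp: b_def)
  have b0: "b > 0" using b[of 0] c(1)[of 0] by (simp add: less_le_trans[of 0 "1 / c 0"])
  let ?s = "real ?n * sqrt ?n"
  define C0 where "C0 = (2 ^ ?n) ^ ?n * (?s * real ?n * 2 ^ ?n + ?s + sqrt ?n ^ ?n * (1 + ?s) * 2 ^ ?n)"
  have C0: "C0 > 0" unfolding C0_def by (intro mult_pos_pos add_pos_pos) auto
  show ?thesis
  proof (rule that[of "C0 * b"])
    show "C0 * b > 0" using C0 b0 by simp
    fix d and f :: "real^'n \<Rightarrow> real" and \<alpha> :: real
    assume d: "d \<ge> 2" "even d" and f: "f \<in> hom_convex_polys d" and \<alpha>: "\<alpha> > 0"
    define t where "t = \<alpha> powr (1 / real d)"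
    have t: "t > 0" using \<alpha> by (simp add: t_def)
    have tk: "t ^ k = \<alpha> powr (real k / real d)" for k
      using \<alpha> by (simp add: t_def powr_powr flip: powr_realpow)
    have td: "t ^ d = \<alpha>" using tk[of d] d \<alpha> by simp
    obtain u r where box: "frame_box {x. f x \<le> 1} u r" using hom_frame_box[OF f d] by blast
    have "\<bar>real (lattice_count f \<alpha>) - intrinsic_V d ?n f * \<alpha> powr (real ?n / real d)\<bar>
        \<le> C0 * (\<Sum>j<?n. t ^ j * (\<Prod>i<j. r i))"
      using lattice_discrepancy[OF f d(1) t box]
      by (simp add: td intrinsic_V_top[OF f d(1)] C0_def mult.commute flip: tk)
    also have "\<dots> \<le> C0 * (\<Sum>j<?n. b * (intrinsic_V d j f * t ^ j))"
    proof (intro mult_left_mono sum_mono)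
      fix j assume j: "j \<in> {..<?n}"
      have V: "intrinsic_V d j f \<ge> 0" using j by (intro intrinsic_V_nonneg) simp
      have "(\<Prod>i<j. r i) \<le> 1 / c j * intrinsic_V d j f"
        using c(1)[of j] c(2)[OF _ d(1) f box, of j] j by (simp add: field_simps)
      also have "\<dots> \<le> b * intrinsic_V d j f" using b j V by (intro mult_right_mono) auto
      finally have "t ^ j * (\<Prod>i<j. r i) \<le> t ^ j * (b * intrinsic_V d j f)"
        using t by (intro mult_left_mono) auto
      then show "t ^ j * (\<Prod>i<j. r i) \<le> b * (intrinsic_V d j f * t ^ j)" by (simp add: mult_ac)
    qed (use C0 in simp)
    also have "\<dots> = C0 * b * (\<Sum>j<?n. intrinsic_V d j f * \<alpha> powr (real j / real d))"
      by (simp add: tk flip: sum_distrib_left)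
    finally show "\<bar>real (lattice_count f \<alpha>) - intrinsic_V d ?n f * \<alpha> powr (real ?n / real d)\<bar>
      \<le> C0 * b * (\<Sum>j<?n. intrinsic_V d j f * \<alpha> powr (real j / real d))" .
  qed
qed

theorem proposition5p4:
  assumes "CARD('n::finite) \<ge> 2"
  shows "(\<exists>C>0. \<forall>d\<ge>2. even d \<longrightarrow>
            (\<forall>f \<in> (hom_convex_polys d :: (real^'n \<Rightarrow> real) set). \<forall>\<alpha>>0.
               \<bar>real (lattice_count f \<alpha>)
                  - intrinsic_V d CARD('n) f * \<alpha> powr (real CARD('n) / real d)\<bar>
               \<le> C * (\<Sum>j<CARD('n). intrinsic_V d j f * \<alpha> powr (real j / real d)))) \<and>
         (\<forall>d\<ge>2. even d \<longrightarrow>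
            (\<forall>f \<in> (hom_convex_polys d :: (real^'n \<Rightarrow> real) set).
               (\<lambda>\<alpha>. real (lattice_count f \<alpha>)
                  - intrinsic_V d CARD('n) f * \<alpha> powr (real CARD('n) / real d))
               \<in> O[at_top](\<lambda>\<alpha>. \<alpha> powr ((real CARD('n) - 1) / real d))))"
proof -
  let ?n = "CARD('n)"
  obtain C where C: "C > 0"
    "\<And>d (f :: real^'n \<Rightarrow> real) \<alpha>. d \<ge> 2 \<Longrightarrow> even d \<Longrightarrow> f \<in> hom_convex_polys d \<Longrightarrow> \<alpha> > 0 \<Longrightarrow>
      \<bar>real (lattice_count f \<alpha>) - intrinsic_V d ?n f * \<alpha> powr (real ?n / real d)\<bar>
      \<le> C * (\<Sum>j<?n. intrinsic_V d j f * \<alpha> powr (real j / real d))"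
    using lattice_count_intrinsic[where 'n='n] by blast
  have "(\<lambda>\<alpha>. real (lattice_count f \<alpha>) - intrinsic_V d ?n f * \<alpha> powr (real ?n / real d))
      \<in> O[at_top](\<lambda>\<alpha>. \<alpha> powr ((real ?n - 1) / real d))"
    if d: "d \<ge> 2" "even d" and f: "f \<in> hom_convex_polys d" for d and f :: "real^'n \<Rightarrow> real"
  proof (rule bigoI)
    \<comment> \<open>For \<open>\<alpha> \<ge> 1\<close> every power with j at most n - 1 is
      bounded by the top one. The implied constant \<open>C * ?S\<close> depends on \<open>f\<close>
      through its intrinsic volumes.\<close>
    let ?S = "\<Sum>j<?n. intrinsic_V d j f"
    have "norm (real (lattice_count f \<alpha>) - intrinsic_V d ?n f * \<alpha> powr (real ?n / real d))
        \<le> (C * ?S) * norm (\<alpha> powr ((real ?n - 1) / real d))" if \<alpha>: "\<alpha> \<ge> 1" for \<alpha>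
    proof -
      have "(\<Sum>j<?n. intrinsic_V d j f * \<alpha> powr (real j / real d))
          \<le> (\<Sum>j<?n. intrinsic_V d j f * \<alpha> powr ((real ?n - 1) / real d))"
      proof (intro sum_mono mult_left_mono powr_mono divide_right_mono)
        show "real j \<le> real ?n - 1" if "j \<in> {..<?n}" for j using that by simp
        show "0 \<le> intrinsic_V d j f" if "j \<in> {..<?n}" for j using that by (simp add: intrinsic_V_nonneg)
      qed (use \<alpha> in auto)
      then have "C * (\<Sum>j<?n. intrinsic_V d j f * \<alpha> powr (real j / real d))
          \<le> C * (?S * \<alpha> powr ((real ?n - 1) / real d))"
        using C(1) by (simp add: sum_distrib_right)
      with C(2)[OF d f, of \<alpha>] \<alpha> show ?thesis by simp
    qed
    then show "\<forall>\<^sub>F \<alpha> in at_top. norm (real (lattice_count f \<alpha>) - intrinsic_V d ?n f * \<alpha> powr (real ?n / real d))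
        \<le> (C * ?S) * norm (\<alpha> powr ((real ?n - 1) / real d))"
      using eventually_ge_at_top[of 1] by (rule eventually_mono[rotated])
  qed
  with C show ?thesis by blast
qed

end
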